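(* There exists a unique family $(\tilde Q_m^{(a)}(y))_{(a,m)\in H}$ of invertible power series in $\mathbb{C}[[y]]$ satisfying the following two conditions. (Q-system) With $\tilde Q_0^{(a)}(y)=1$, for all $a=1,\dots,n$ and $m=1,2,\dots$, $$(\tilde Q_m^{(a)}(y))^2=\tilde Q_{m+1}^{(a)}(y)\,\tilde Q_{m-1}^{(a)}(y)+y_a^m(\tilde Q_m^{(a)}(y))^2\prod_{(b,k)\in H}(\tilde Q_k^{(b)}(y))^{-(\alpha_a|\alpha_b)B_{am,bk}} .$$ (Convergence) For each $a$, the limit $\lim_{m\to\infty}\tilde Q_m^{(a)}(y)$ exists in $\mathbb{C}[[y]]$. In fact, for all $(a,m)\in H$, $$\tilde Q_m^{(a)}(y)=\tilde R_m^{(a)}(y)=\tilde K_m^{(a)}(y)/\tilde K^0(y).$$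
   Context: Let $X_n$ be a finite-dimensional simple Lie algebra over $\mathbb{C}$ of rank $n$ with simple roots $\alpha_1,\dots,\alpha_n$; $(\cdot|\cdot)$ is the standard bilinear form normalized by $(\alpha|\alpha)=2$ for long roots $\alpha$; $t_a=2/(\alpha_a|\alpha_a)\in\{1,2,3\}$. $\mathbb{C}[[y]]$ is the ring of formal power series in $y=(y_1,\dots,y_n)$ with its standard ($y$-adic) topology. $H=\{(a,m)\mid a\in\{1,\dots,n\},\ m\in\{1,2,\dots\}\}$. $B_{am,bk}=2\min(t_bm,t_ak)-\min(t_bm,t_a(k+1))-\min(t_bm,t_a(k-1))$ (for fixed $(a,m)$ only finitely many $(b,k)$ give a nonzero value). $\mathcal N$ is the set of families $N=(N_m^{(a)})_{(a,m)\in H}$ of nonnegative integers with finitely many nonzero entries. Binomials: for $k\in\mathbb C$, $j\in\mathbb Z$, $\binom kj=k(k-1)\cdots(k-j+1)/j!$ if $j>0$, $1$ if $j=0$, $0$ if $j<0$. For $\nu,N\in\mathcal N$: $H'=H'(N)=\{(a,m)\in H\mid N_m^{(a)}>0\}$, $\gamma_m^{(a)}=\sum_{k\ge1}\min(m,k)\nu_k^{(a)}$, $P_m^{(a)}=P_m^{(a)}(\nu,N)=\gamma_m^{(a)}-\sum_{(b,k)\in H}(\alpha_a|\alpha_b)\min(t_bm,t_ak)N_k^{(b)}$, $F_{am,bk}=\delta_{ab}\delta_{mk}P_m^{(a)}+(\alpha_a|\alpha_b)\min(t_bm,t_ak)N_k^{(b)}$, $$R(\nu,N)=\Bigl(\det_{(a,m),(b,k)\in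 H'}F_{am,bk}\Bigr)\prod_{(a,m)\in H'}\frac1{N_m^{(a)}}\binom{P_m^{(a)}+N_m^{(a)}-1}{N_m^{(a)}-1}\ (N\ne0),\qquad R(\nu,0)=1,$$ $$K(\nu,N)=\prod_{(a,m)\in H}\binom{P_m^{(a)}+N_m^{(a)}}{N_m^{(a)}}.$$ Power series: $\tilde R^\nu(y)=\sum_{N\in\mathcal N}R(\nu,N)\prod_{a=1}^n y_a^{\sum_m mN_m^{(a)}}$ and $\tilde K^\nu(y)=\sum_{N\in\mathcal N}K(\nu,N)\prod_{a=1}^n y_a^{\sum_m mN_m^{(a)}}$. $\tilde K^0$ is the case $\nu=0$; $\tilde R_m^{(a)}$ and $\tilde K_m^{(a)}$ are the cases $\nu=\delta_m^{(a)}$, where $\delta_m^{(a)}\in\mathcal N$ has entry $1$ at $(a,m)$ and $0$ elsewhere. *)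

theory Defs
  imports
    "HOL-Analysis.Infinite_Sum"
    "HOL-Combinatorics.Permutations"
    "HOL-Library.Multiset"
begin

section \<open>Formal power series in several variables\<close>

text \<open>A monomial is a multiset of variables: \<open>e\<close> stands for the product of \<open>y\<^sub>a ^ count e a\<close>.
  For finite \<open>'i\<close> this gives the ring of formal power series in the variables \<open>y\<^sub>a\<close>, \<open>a :: 'i\<close>.\<close>

typedef ('i, 'c) mfps = "UNIV :: ('i multiset \<Rightarrow> 'c) set"
  morphisms mcoeff Abs_mfps ..

setup_lifting type_definition_mfps

lemma mfps_eqI: "(\<And>e. mcoeff f e = mcoeff g e) \<Longrightarrow> f = g"
  by transfer auto

lemma finite_submultisets: "finite {d. d \<subseteq># (e :: 'i multiset)}"
proof (induction e)
  case empty
  have "{d. d \<subseteq># {#}} = {{#} :: 'i multiset}" by auto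
  then show ?case by simp
next
  case (add x e)
  have "{d. d \<subseteq># add_mset x e} \<subseteq> {d. d \<subseteq># e} \<union> add_mset x ` {d. d \<subseteq># e}"
  proof
    fix d assume "d \<in> {d. d \<subseteq># add_mset x e}"
    then have d: "d \<subseteq># add_mset x e" by simp
    show "d \<in> {d. d \<subseteq># e} \<union> add_mset x ` {d. d \<subseteq># e}"
    proof (cases "x \<in># d")
      case True
      then obtain d' where "d = add_mset x d'" by (meson mset_add)
      then show ?thesis using d by auto
    next
      case False
      then show ?thesis using d
        by (metis (no_types, lifting) UnI1 diff_single_trivial mem_Collect_eq subset_eq_diff_conv
            add_mset_add_single)
    qed
  qed
  then show ?case using add finite_subset by fastforce
qed

instantiation mfps :: (type, comm_ring_1) comm_ring_1
begin

lift_definition zero_mfps :: "('i, 'c::comm_ring_1) mfps" is "\<lambda>_ :: 'i multiset. 0 :: 'c" .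
lift_definition one_mfps :: "('i, 'c::comm_ring_1) mfps" is "\<lambda>e :: 'i multiset. if e = {#} then 1 else 0 :: 'c" .
lift_definition plus_mfps :: "('i, 'c::comm_ring_1) mfps \<Rightarrow> ('i, 'c) mfps \<Rightarrow> ('i, 'c) mfps"
  is "\<lambda>(f :: 'i multiset \<Rightarrow> 'c) g e. f e + g e" .
lift_definition uminus_mfps :: "('i, 'c::comm_ring_1) mfps \<Rightarrow> ('i, 'c) mfps" is "\<lambda>(f :: 'i multiset \<Rightarrow> 'c) e. - f e" .
lift_definition minus_mfps :: "('i, 'c::comm_ring_1) mfps \<Rightarrow> ('i, 'c) mfps \<Rightarrow> ('i, 'c) mfps"
  is "\<lambda>(f :: 'i multiset \<Rightarrow> 'c) g e. f e - g e" .
lift_definition times_mfps :: "('i, 'c::comm_ring_1) mfps \<Rightarrow> ('i, 'c) mfps \<Rightarrow> ('i, 'c) mfps"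
  is "\<lambda>(f :: 'i multiset \<Rightarrow> 'c) g e. \<Sum>d | d \<subseteq># e. f d * g (e - d)" .

instance
proof
  fix a b c :: "('a, 'b::comm_ring_1) mfps"
  show "a * b * c = a * (b * c)"
  proof (rule mfps_eqI)
    fix e :: "'a multiset"
    have *: "p + q \<subseteq># e" if "p \<subseteq># e" "q \<subseteq># e - p" for p q
      using that by (simp add: subset_mset.le_diff_conv2 add.commute)
    have **: "p \<subseteq># e" "d - p \<subseteq># e - p" "p + (d - p) = d" "e - p - (d - p) = e - d"
      if "d \<subseteq># e" "p \<subseteq># d" for d p
    proof -
      show "p \<subseteq># e" using that by (rule subset_mset.order_trans[rotated])
      show "p + (d - p) = d" using that by simp
      then show "e - p - (d - p) = e - d" by (metis diff_diff_add_mset)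
      show "d - p \<subseteq># e - p"
        using that by (auto simp: subseteq_mset_def intro: diff_le_mono)
    qed
    have "mcoeff (a * b * c) e
        = (\<Sum>d | d \<subseteq># e. \<Sum>p | p \<subseteq># d. mcoeff a p * mcoeff b (d - p) * mcoeff c (e - d))"
      by (simp add: times_mfps.rep_eq sum_distrib_right)
    also have "\<dots> = (\<Sum>(d, p) \<in> Sigma {d. d \<subseteq># e} (\<lambda>d. {p. p \<subseteq># d}).
          mcoeff a p * mcoeff b (d - p) * mcoeff c (e - d))"
      by (rule sum.Sigma) (auto simp: finite_submultisets)
    also have "\<dots> = (\<Sum>(p, q) \<in> Sigma {p. p \<subseteq># e} (\<lambda>p. {q. q \<subseteq># e - p}).
          mcoeff a p * (mcoeff b q * mcoeff c (e - p - q)))"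
      by (rule sum.reindex_bij_witness[where i = "\<lambda>(p, q). (p + q, p)" and j = "\<lambda>(d, p). (p, d - p)"])
         (auto simp: mult.assoc * **)
    also have "\<dots> = (\<Sum>p | p \<subseteq># e. \<Sum>q | q \<subseteq># e - p.
          mcoeff a p * (mcoeff b q * mcoeff c (e - p - q)))"
      by (rule sum.Sigma[symmetric]) (auto simp: finite_submultisets)
    also have "\<dots> = mcoeff (a * (b * c)) e"
      by (simp add: times_mfps.rep_eq sum_distrib_left)
    finally show "mcoeff (a * b * c) e = mcoeff (a * (b * c)) e" .
  qed
  show "a * b = b * a"
  proof (rule mfps_eqI)
    fix e :: "'a multiset"
    have *: "e - (e - d) = d" if "d \<subseteq># e" for d
      using that by (simp add: multiset_eq_iff subseteq_mset_def)
    show "mcoeff (a * b) e = mcoeff (b * a) e"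
      unfolding times_mfps.rep_eq
      by (rule sum.reindex_bij_witness[where i = "\<lambda>d. e - d" and j = "\<lambda>d. e - d"])
         (auto simp: mult.commute *)
  qed
  show "1 * a = a"
  proof (rule mfps_eqI)
    fix e :: "'a multiset"
    have "mcoeff (1 * a) e = (\<Sum>d | d \<subseteq># e. if d = {#} then mcoeff a e else 0)"
      unfolding times_mfps.rep_eq by (rule sum.cong) (auto simp: one_mfps.rep_eq)
    then show "mcoeff (1 * a) e = mcoeff a e"
      by (simp add: sum.delta finite_submultisets)
  qed
  show "a + b + c = a + (b + c)" by transfer (simp add: add.assoc)
  show "a + b = b + a" by transfer (simp add: add.commute)
  show "0 + a = a" by transfer simp
  show "- a + a = 0" by transfer simp
  show "a - b = a + - b" by transfer simp
  show "(a + b) * c = a * c + b * c"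
    by transfer (simp add: distrib_right sum.distrib)
  show "(0 :: ('a, 'b::comm_ring_1) mfps) \<noteq> 1"
    by transfer (metis zero_neq_one)
qed

end

text \<open>The inverse is the multiplicative inverse for units, and \<open>0\<close> otherwise.\<close>

instantiation mfps :: (type, comm_ring_1) inverse
begin

definition inverse_mfps :: "('a, 'b::comm_ring_1) mfps \<Rightarrow> ('a, 'b) mfps" where
  "inverse_mfps f = (if f dvd 1 then THE g. f * g = 1 else 0)"

definition divide_mfps :: "('a, 'b::comm_ring_1) mfps \<Rightarrow> ('a, 'b) mfps \<Rightarrow> ('a, 'b) mfps" where
  "divide_mfps f g = f * inverse g"

instance ..

end

lift_definition mfps_const :: "'c::zero \<Rightarrow> ('i, 'c) mfps" is "\<lambda>c (e :: 'i multiset). if e = {#} then c else 0 :: 'c" .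

lift_definition mfps_var :: "'i \<Rightarrow> ('i, 'c::zero_neq_one) mfps"
  is "\<lambda>(a :: 'i) e. if e = {#a#} then 1 else 0 :: 'c" .

text \<open>The adic topology: a neighbourhood basis of \<open>f\<close> is given by the sets of all \<open>g\<close> that agree
  with \<open>f\<close> in all total degrees \<open>< n\<close>. The coefficients carry the discrete topology.\<close>

instantiation mfps :: (type, type) topological_space
begin

definition open_mfps :: "('a, 'b) mfps set \<Rightarrow> bool" where
  "open_mfps U \<longleftrightarrow> (\<forall>f\<in>U. \<exists>n. \<forall>g. (\<forall>e. size e < n \<longrightarrow> mcoeff g e = mcoeff f e) \<longrightarrow> g \<in> U)"

instance
proof
  show "open (UNIV :: ('a, 'b) mfps set)" by (simp add: open_mfps_def)
  fix S T :: "('a, 'b) mfps set"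
  assume S: "open S" and T: "open T"
  show "open (S \<inter> T)"
    unfolding open_mfps_def
  proof
    fix f :: "('a, 'b) mfps" assume "f \<in> S \<inter> T"
    then obtain m n
      where "\<forall>g. (\<forall>e. size e < m \<longrightarrow> mcoeff g e = mcoeff f e) \<longrightarrow> g \<in> S"
        and "\<forall>g. (\<forall>e. size e < n \<longrightarrow> mcoeff g e = mcoeff f e) \<longrightarrow> g \<in> T"
      using S T unfolding open_mfps_def by blast
    then show "\<exists>k. \<forall>g. (\<forall>e. size e < k \<longrightarrow> mcoeff g e = mcoeff f e) \<longrightarrow> g \<in> S \<inter> T"
      by (intro exI[of _ "max m n"]) auto
  qed
next
  fix \<K> :: "('a, 'b) mfps set set"
  assume "\<forall>S\<in>\<K>. open S"
  then show "open (\<Union>\<K>)" unfolding open_mfps_def by (meson Union_iff)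
qed

end

instance mfps :: (type, type) t2_space
proof
  fix f g :: "('i, 'c) mfps"
  assume "f \<noteq> g"
  then obtain e where e: "mcoeff f e \<noteq> mcoeff g e" using mfps_eqI by blast
  define U where "U = (\<lambda>f :: ('i, 'c) mfps. {h. \<forall>d. size d < Suc (size e) \<longrightarrow> mcoeff h d = mcoeff f d})"
  have "open (U h)" for h
    unfolding open_mfps_def U_def by (intro ballI exI[of _ "Suc (size e)"]) auto
  moreover have "f \<in> U f" "g \<in> U g" by (auto simp: U_def)
  moreover have "U f \<inter> U g = {}"
  proof -
    have False if "h \<in> U f" "h \<in> U g" for h
      using that e by (auto simp: U_def)
    then show ?thesis by blast
  qed
  ultimately show "\<exists>U V. open U \<and> open V \<and> f \<in> U \<and> g \<in> V \<and> U \<inter> V = {}" by blast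
qed


section \<open>Complex simple Lie algebras, roots, and the normalized form\<close>

locale lie_algebra = vector_space scale
  for scale :: "complex \<Rightarrow> 'g::ab_group_add \<Rightarrow> 'g" +
  fixes br :: "'g \<Rightarrow> 'g \<Rightarrow> 'g"
  assumes linear_br_right: "Vector_Spaces.linear scale scale (\<lambda>y. br x y)"
    and linear_br_left: "Vector_Spaces.linear scale scale (\<lambda>x. br x y)"
    and br_self: "br x x = 0"
    and jacobi: "br x (br y z) + br y (br z x) + br z (br x y) = 0"
begin

definition ideal :: "'g set \<Rightarrow> bool" where
  "ideal I \<longleftrightarrow> subspace I \<and> (\<forall>x. \<forall>y\<in>I. br x y \<in> I)"

definition cartan_subalgebra :: "'g set \<Rightarrow> bool" where
  "cartan_subalgebra h \<longleftrightarrow>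
     subspace h \<and>
     (\<forall>x\<in>h. \<forall>y\<in>h. br x y = 0) \<and>
     (\<forall>x. (\<forall>y\<in>h. br y x = 0) \<longrightarrow> x \<in> h) \<and>
     (\<forall>x\<in>h. span {v. \<exists>c. br x v = scale c v} = UNIV)"

text \<open>Linear functionals on \<open>h\<close> are represented by functions vanishing outside \<open>h\<close>.\<close>

definition dual :: "'g set \<Rightarrow> ('g \<Rightarrow> complex) set" where
  "dual h = {\<phi>. (\<forall>x\<in>h. \<forall>y\<in>h. \<phi> (x + y) = \<phi> x + \<phi> y) \<and>
                (\<forall>c. \<forall>x\<in>h. \<phi> (scale c x) = c * \<phi> x) \<and>
                (\<forall>x. x \<notin> h \<longrightarrow> \<phi> x = 0)}"

definition root_space :: "'g set \<Rightarrow> ('g \<Rightarrow> complex) \<Rightarrow> 'g set" where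
  "root_space h \<phi> = {x. \<forall>y\<in>h. br y x = scale (\<phi> y) x}"

definition roots :: "'g set \<Rightarrow> ('g \<Rightarrow> complex) set" where
  "roots h = {\<phi> \<in> dual h. \<phi> \<noteq> (\<lambda>_. 0) \<and> root_space h \<phi> \<noteq> {0}}"

definition simple_roots :: "'g set \<Rightarrow> ('i::finite \<Rightarrow> 'g \<Rightarrow> complex) \<Rightarrow> bool" where
  "simple_roots h \<alpha> \<longleftrightarrow>
     (\<forall>a. \<alpha> a \<in> roots h) \<and>
     (\<forall>\<phi>\<in>dual h. \<exists>!c :: 'i \<Rightarrow> complex. \<phi> = (\<lambda>x. \<Sum>a\<in>UNIV. c a * \<alpha> a x)) \<and>
     (\<forall>\<phi>\<in>roots h. \<exists>k :: 'i \<Rightarrow> nat.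
        \<phi> = (\<lambda>x. \<Sum>a\<in>UNIV. of_nat (k a) * \<alpha> a x) \<or>
        \<phi> = (\<lambda>x. - (\<Sum>a\<in>UNIV. of_nat (k a) * \<alpha> a x)))"

definition invariant_form :: "('g \<Rightarrow> 'g \<Rightarrow> complex) \<Rightarrow> bool" where
  "invariant_form \<kappa> \<longleftrightarrow>
     (\<forall>x. Vector_Spaces.linear scale (*) (\<lambda>y. \<kappa> x y)) \<and>
     (\<forall>x y. \<kappa> x y = \<kappa> y x) \<and>
     (\<forall>x y z. \<kappa> (br x y) z = \<kappa> x (br y z)) \<and>
     (\<forall>x. (\<forall>y. \<kappa> x y = 0) \<longrightarrow> x = 0)"

text \<open>The form induced on the dual of \<open>h\<close> through the isomorphism of \<open>h\<close> with its dual given by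
  the restriction of \<open>\<kappa>\<close> to \<open>h\<close>.\<close>

definition dual_vec :: "'g set \<Rightarrow> ('g \<Rightarrow> 'g \<Rightarrow> complex) \<Rightarrow> ('g \<Rightarrow> complex) \<Rightarrow> 'g" where
  "dual_vec h \<kappa> \<phi> = (THE v. v \<in> h \<and> (\<forall>x\<in>h. \<kappa> v x = \<phi> x))"

definition dual_form ::
    "'g set \<Rightarrow> ('g \<Rightarrow> 'g \<Rightarrow> complex) \<Rightarrow> ('g \<Rightarrow> complex) \<Rightarrow> ('g \<Rightarrow> complex) \<Rightarrow> complex" where
  "dual_form h \<kappa> \<phi> \<psi> = \<kappa> (dual_vec h \<kappa> \<phi>) (dual_vec h \<kappa> \<psi>)"

text \<open>An invariant form is determined up to a nonzero complex scalar, and on roots it takes real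
  values up to that scalar; so long roots are compared by the modulus of \<open>(\<phi>|\<phi>)\<close>, which makes
  sense before the form is normalized.\<close>

definition long_roots :: "'g set \<Rightarrow> ('g \<Rightarrow> 'g \<Rightarrow> complex) \<Rightarrow> ('g \<Rightarrow> complex) set" where
  "long_roots h \<kappa> =
     {\<phi> \<in> roots h. \<forall>\<psi>\<in>roots h. norm (dual_form h \<kappa> \<psi> \<psi>) \<le> norm (dual_form h \<kappa> \<phi> \<phi>)}"

definition normalized_form :: "'g set \<Rightarrow> ('g \<Rightarrow> 'g \<Rightarrow> complex) \<Rightarrow> bool" where
  "normalized_form h \<kappa> \<longleftrightarrow>
     invariant_form \<kappa> \<and> (\<forall>\<phi>\<in>long_roots h \<kappa>. dual_form h \<kappa> \<phi> \<phi> = 2)"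

end

locale simple_lie_algebra = lie_algebra +
  assumes finite_dimensional: "\<exists>B. finite B \<and> span B = UNIV"
    and nonabelian: "\<exists>x y. br x y \<noteq> 0"
    and simple: "ideal I \<Longrightarrow> I = {0} \<or> I = UNIV"


section \<open>Data attached to the Gram matrix of the simple roots\<close>

text \<open>In this section \<open>g a b\<close> stands for \<open>(\<alpha>\<^sub>a|\<alpha>\<^sub>b)\<close>. Since the form is complex valued, the integers
  \<open>t\<^sub>a\<close> and \<open>(\<alpha>\<^sub>a|\<alpha>\<^sub>b) B\<^bsub>am,bk\<^esub>\<close> are extracted by definite descriptions.\<close>

definition tnum :: "('i \<Rightarrow> 'i \<Rightarrow> complex) \<Rightarrow> 'i \<Rightarrow> nat" where
  "tnum g a = (THE t. of_nat t = 2 / g a a)"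

definition HH :: "('i \<times> nat) set" where
  "HH = UNIV \<times> {1..}"

definition BB :: "('i \<Rightarrow> 'i \<Rightarrow> complex) \<Rightarrow> 'i \<times> nat \<Rightarrow> 'i \<times> nat \<Rightarrow> int" where
  "BB g = (\<lambda>(a, m) (b, k).
     2 * int (min (tnum g b * m) (tnum g a * k))
       - int (min (tnum g b * m) (tnum g a * (k + 1)))
       - int (min (tnum g b * m) (tnum g a * (k - 1))))"

definition Qexp :: "('i \<Rightarrow> 'i \<Rightarrow> complex) \<Rightarrow> 'i \<times> nat \<Rightarrow> 'i \<times> nat \<Rightarrow> int" where
  "Qexp g h l = (THE z. of_int z = g (fst h) (fst l) * of_int (BB g h l))"

definition NN :: "('i \<times> nat \<Rightarrow> nat) set" where
  "NN = {N. (\<forall>h. h \<notin> HH \<longrightarrow> N h = 0) \<and> finite {h. N h \<noteq> 0}}"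

definition supp :: "('i \<times> nat \<Rightarrow> nat) \<Rightarrow> ('i \<times> nat) set" where
  "supp N = {h \<in> HH. N h > 0}"

text \<open>Sums over \<open>HH\<close> weighted by \<open>N\<close> are written as sums over the finite set \<open>supp N\<close>.\<close>

definition gam :: "('i \<times> nat \<Rightarrow> nat) \<Rightarrow> 'i \<times> nat \<Rightarrow> nat" where
  "gam \<nu> = (\<lambda>(a, m). \<Sum>k | (a, k) \<in> supp \<nu>. min m k * \<nu> (a, k))"

definition PP ::
    "('i \<Rightarrow> 'i \<Rightarrow> complex) \<Rightarrow> ('i \<times> nat \<Rightarrow> nat) \<Rightarrow> ('i \<times> nat \<Rightarrow> nat) \<Rightarrow> 'i \<times> nat \<Rightarrow> complex" where
  "PP g \<nu> N = (\<lambda>(a, m). of_nat (gam \<nu> (a, m)) -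
     (\<Sum>(b, k)\<in>supp N. g a b * of_nat (min (tnum g b * m) (tnum g a * k)) * of_nat (N (b, k))))"

definition FF ::
    "('i \<Rightarrow> 'i \<Rightarrow> complex) \<Rightarrow> ('i \<times> nat \<Rightarrow> nat) \<Rightarrow> ('i \<times> nat \<Rightarrow> nat) \<Rightarrow>
     'i \<times> nat \<Rightarrow> 'i \<times> nat \<Rightarrow> complex" where
  "FF g \<nu> N = (\<lambda>(a, m) (b, k). (if (a, m) = (b, k) then PP g \<nu> N (a, m) else 0) +
     g a b * of_nat (min (tnum g b * m) (tnum g a * k)) * of_nat (N (b, k)))"

definition det_on :: "'a set \<Rightarrow> ('a \<Rightarrow> 'a \<Rightarrow> 'c::comm_ring_1) \<Rightarrow> 'c" where
  "det_on S A = (\<Sum>p | p permutes S. of_int (sign p) * (\<Prod>i\<in>S. A i (p i)))"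

definition RR ::
    "('i \<Rightarrow> 'i \<Rightarrow> complex) \<Rightarrow> ('i \<times> nat \<Rightarrow> nat) \<Rightarrow> ('i \<times> nat \<Rightarrow> nat) \<Rightarrow> complex" where
  "RR g \<nu> N = (if N = (\<lambda>_. 0) then 1 else
     det_on (supp N) (FF g \<nu> N) *
     (\<Prod>h\<in>supp N. 1 / of_nat (N h) * ((PP g \<nu> N h + of_nat (N h) - 1) gchoose (N h - 1))))"

text \<open>The factors with \<open>N h = 0\<close> are \<open>1\<close>, so the product over \<open>HH\<close> is taken over \<open>supp N\<close>.\<close>

definition KK ::
    "('i \<Rightarrow> 'i \<Rightarrow> complex) \<Rightarrow> ('i \<times> nat \<Rightarrow> nat) \<Rightarrow> ('i \<times> nat \<Rightarrow> nat) \<Rightarrow> complex" where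
  "KK g \<nu> N = (\<Prod>h\<in>supp N. (PP g \<nu> N h + of_nat (N h)) gchoose (N h))"

definition ymon :: "('i::finite \<times> nat \<Rightarrow> nat) \<Rightarrow> ('i, complex) mfps" where
  "ymon N = (\<Prod>a\<in>UNIV. mfps_var a ^ (\<Sum>m | (a, m) \<in> supp N. m * N (a, m)))"

definition Rser ::
    "('i::finite \<Rightarrow> 'i \<Rightarrow> complex) \<Rightarrow> ('i \<times> nat \<Rightarrow> nat) \<Rightarrow> ('i, complex) mfps" where
  "Rser g \<nu> = (\<Sum>\<^sub>\<infinity>N\<in>NN. mfps_const (RR g \<nu> N) * ymon N)"

definition Kser ::
    "('i::finite \<Rightarrow> 'i \<Rightarrow> complex) \<Rightarrow> ('i \<times> nat \<Rightarrow> nat) \<Rightarrow> ('i, complex) mfps" where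
  "Kser g \<nu> = (\<Sum>\<^sub>\<infinity>N\<in>NN. mfps_const (KK g \<nu> N) * ymon N)"

definition unit_family :: "'i \<Rightarrow> nat \<Rightarrow> 'i \<times> nat \<Rightarrow> nat" where
  "unit_family a m = (\<lambda>h. if h = (a, m) then 1 else 0)"

text \<open>A family indexed by \<open>HH\<close> is extended to \<open>m = 0\<close> by the convention \<open>Q a 0 = 1\<close>. The product
  over \<open>HH\<close> is taken over the finitely many indices with \<open>BB g (a, m) l \<noteq> 0\<close>.\<close>

definition Q_system ::
    "('i \<Rightarrow> 'i \<Rightarrow> complex) \<Rightarrow> ('i \<Rightarrow> nat \<Rightarrow> ('i, complex) mfps) \<Rightarrow> bool" where
  "Q_system g Q \<longleftrightarrow>
     (\<forall>a. Q a 0 = 1) \<and>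
     (\<forall>a. \<forall>m\<ge>1. (Q a m)^2 = Q a (m + 1) * Q a (m - 1) +
        mfps_var a ^ m * (Q a m)^2 *
        (\<Prod>(b, k)\<in>{l \<in> HH. BB g (a, m) l \<noteq> 0}. Q b k powi (- Qexp g (a, m) (b, k))))"

definition canonical_solution ::
    "('i \<Rightarrow> 'i \<Rightarrow> complex) \<Rightarrow> ('i \<Rightarrow> nat \<Rightarrow> ('i, complex) mfps) \<Rightarrow> bool" where
  "canonical_solution g Q \<longleftrightarrow>
     (\<forall>a. \<forall>m\<ge>1. Q a m dvd 1) \<and> Q_system g Q \<and> (\<forall>a. convergent (Q a))"

end

theory Submission
  imports Defs "HOL-Analysis.Convex"
begin

text \<open>Write \<open>i = (a, m)\<close>, \<open>j = (b, k)\<close> and \<open>G i j = - (\<alpha>\<^sub>a|\<alpha>\<^sub>b) min (t\<^sub>b m) (t\<^sub>a k)\<close>. The coefficients \<open>K(\<nu>, N)\<close> and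
  \<open>R(\<nu>, N)\<close> involve \<open>\<nu>\<close> only through the numbers \<open>\<gamma>\<^sub>i\<close>, so \<open>\<gamma>\<close> may be taken to be an arbitrary
  family of integers. Pascal's rule for the \<open>j\<close>-th binomial then reads
  \<open>K\<^sup>\<gamma> = K\<^sup>\<gamma>\<^sup>' + y\<^sub>b ^ k K\<^sup>\<gamma>\<^sup>'\<^sup>'\<close>, where \<open>\<gamma>'\<close> arises from \<open>\<gamma>\<close> by lowering \<open>\<gamma>\<^sub>j\<close> by one, and \<open>\<gamma>''\<close> by
  adding the column \<open>G \<cdot> j\<close>. The point is that this recursion, which is linear and invariant under
  translations of \<open>\<gamma>\<close>, determines a family of series by its member at \<open>\<gamma> = 0\<close>, provided that each
  coefficient depends on only finitely many entries of \<open>\<gamma>\<close> (\<open>series_family_eq_0\<close>). This plays the part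
  of a Lagrange inversion formula, and it has two consequences.

  First, \<open>K\<^sup>\<gamma> K\<^sup>\<delta>\<close> and \<open>K\<^sup>\<gamma>\<^sup>+\<^sup>\<delta> K\<^sup>0\<close> satisfy the recursion in \<open>\<gamma>\<close> and agree at \<open>\<gamma> = 0\<close>. So
  \<open>A\<^sup>\<gamma> = K\<^sup>\<gamma> / K\<^sup>0\<close> is multiplicative in \<open>\<gamma>\<close> (\<open>K_ratio_add\<close>), and the recursion at \<open>\<gamma> = 0\<close> says that
  \<open>1\<close> is the sum of \<open>A\<close> at the negative of the \<open>j\<close>-th unit family and of \<open>y\<^sub>b ^ k\<close> times \<open>A\<close> at the
  column \<open>G \<cdot> j\<close> (\<open>K_ratio_step\<close>). This is the Q-system for the values \<open>Q\<^sub>m\<^sup>(\<^sup>a\<^sup>)\<close> of \<open>A\<close> at the families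
  \<open>k \<mapsto> min m k\<close> in row \<open>a\<close> (\<open>Q_sol_system\<close>): second differences of \<open>min m k\<close> in \<open>m\<close> are negative
  unit families, and summation by parts writes the columns of \<open>G\<close> as combinations of the families
  \<open>min m k\<close> with coefficients \<open>- (\<alpha>\<^sub>a|\<alpha>\<^sub>b) B\<close>. A coefficient of degree \<open>n\<close> sees only indices
  \<open>(a, k)\<close> with \<open>k \<le> n\<close>, where \<open>min m k = k\<close> for \<open>m \<ge> n\<close>; hence convergence.

  Secondly, the series \<open>R\<^sup>\<gamma>\<close> satisfy the same recursion. After the factors \<open>1 / N\<close> are absorbed, the
  \<open>j\<close>-th column of the determinant depends only on \<open>P\<^sub>j\<close> and \<open>N\<^sub>j\<close>, and Pascal's rule applies to this
  column (\<open>coeff_family_R\<close>). For \<open>\<gamma> = 0\<close> the matrix \<open>F\<close> has zero row sums, so \<open>R\<^sup>0 = 1\<close>, and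
  \<open>R\<^sup>\<gamma> = A\<^sup>\<gamma>\<close> follows (\<open>R_series_eq_K_ratio\<close>).

  Uniqueness is a contraction argument (\<open>canonical_solution_agree\<close>). The Q-system expresses the ratio
  of consecutive quotients \<open>Q\<^sub>m\<^sub>+\<^sub>1 / Q\<^sub>m\<close> through a term divisible by \<open>y\<^sub>a ^ m\<close>, so two solutions that agree
  below degree \<open>n\<close> have ratios that agree below degree \<open>n + 1\<close>. The quotients tend to \<open>1\<close> by the
  convergence condition, which fixes the remaining freedom.

  All this needs \<open>G\<close> to be integral. From the Lie algebra it uses that \<open>t\<^sub>a = 2 / (\<alpha>\<^sub>a|\<alpha>\<^sub>a)\<close> is a positive
  integer and that \<open>(\<alpha>\<^sub>a|\<alpha>\<^sub>b) t\<^sub>b\<close> is an integer (\<open>integral_gram_simple_roots\<close>). The latter number is a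
  Cartan integer, obtained from root strings. For the former, the squared length of a long root must be
  an integral multiple of that of any other root (\<open>long_multiple_of_short\<close>,
  \<open>nonorthogonal_root_of_given_length\<close>). The given form is complex valued, so positivity and the
  Cauchy-Schwarz inequality are taken from the integral form
  \<open>\<Sum>\<^sub>\<phi> 2 (\<phi>|\<alpha>) / (\<alpha>|\<alpha>) \<cdot> 2 (\<phi>|\<beta>) / (\<beta>|\<beta>)\<close>, the sum extending over all roots \<open>\<phi>\<close>.\<close>

section \<open>Weights of a commuting family in a Lie algebra\<close>

context lie_algebra
begin

lemma br_add_right: "br x (y + z) = br x y + br x z"
  and br_scale_right: "br x (scale c y) = scale c (br x y)"
  using linear_br_right[of x] by (simp_all add: Vector_Spaces.linear_iff)

lemma br_add_left: "br (x + y) z = br x z + br y z"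
  and br_scale_left: "br (scale c x) z = scale c (br x z)"
  using linear_br_left[of z] by (simp_all add: Vector_Spaces.linear_iff)

lemma br_zero_right [simp]: "br x 0 = 0"
  using br_scale_right[of x 0 0] by simp

lemma br_zero_left [simp]: "br 0 x = 0"
  using br_scale_left[of 0 0 x] by simp

lemma br_sum_right: "br x (sum f A) = (\<Sum>i\<in>A. br x (f i))"
  by (induction A rule: infinite_finite_induct) (simp_all add: br_add_right)

lemma br_skew: "br y x = - br x y"
proof -
  have "br x y + br y x = 0"
    using br_self[of "x + y"] br_self[of x] br_self[of y]
    unfolding br_add_left br_add_right by (simp add: add.commute)
  then show ?thesis by (metis add.commute add_eq_0_iff)
qed

lemma br_minus_right: "br x (- y) = - br x y"
  by (metis br_add_right br_zero_right add.right_inverse add_eq_0_iff)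

lemma br_br: "br x (br y z) = br (br x y) z + br y (br x z)"
proof -
  have "br x (br y z) = - br y (br z x) - br z (br x y)"
    using jacobi[of x y z] by (simp add: eq_neg_iff_add_eq_0 algebra_simps)
  also have "br y (br z x) = - br y (br x z)" by (metis br_skew br_minus_right)
  also have "br z (br x y) = - br (br x y) z" by (rule br_skew)
  finally show ?thesis by simp
qed

lemma root_spaceD: "x \<in> root_space Y \<phi> \<Longrightarrow> y \<in> Y \<Longrightarrow> br y x = scale (\<phi> y) x"
  by (simp add: root_space_def)

lemma subspace_root_space: "subspace (root_space Y \<phi>)"
  by (rule subspaceI)
     (auto simp: root_space_def br_add_right br_scale_right scale_right_distrib scale_left_commute)

text \<open>Subtracting \<open>\<psi> y\<close> times the sum from its image under \<open>ad y\<close> removes the component of weight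
  \<open>\<psi>\<close> and rescales the others by nonzero factors, for a suitable \<open>y\<close>; so the number of components
  can be reduced. With \<open>V = {0}\<close> this is the linear independence of eigenvectors for different
  weights; with a larger \<open>V\<close> it restricts diagonalizability to invariant subspaces.\<close>

lemma weight_components_in_subspace:
  assumes "finite I" and V: "subspace V" and stable: "\<And>y x. y \<in> Y \<Longrightarrow> x \<in> V \<Longrightarrow> br y x \<in> V"
    and "\<And>i j. i \<in> I \<Longrightarrow> j \<in> I \<Longrightarrow> i \<noteq> j \<Longrightarrow> \<exists>y\<in>Y. \<phi> i y \<noteq> \<phi> j y"
    and "\<And>i. i \<in> I \<Longrightarrow> v i \<in> root_space Y (\<phi> i)"
    and "(\<Sum>i\<in>I. v i) \<in> V"
  shows "\<forall>i\<in>I. v i \<in> V"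
  using assms(1,4-)
proof (induction I arbitrary: v)
  case empty
  then show ?case by simp
next
  case (insert j I)
  define S where "S = (\<Sum>i\<in>insert j I. v i)"
  have scaled: "scale (\<phi> i y - \<phi> j y) (v i) \<in> V" if y: "y \<in> Y" and i: "i \<in> I" for y i
  proof -
    have "\<forall>i\<in>I. scale (\<phi> i y - \<phi> j y) (v i) \<in> V"
    proof (rule insert.IH)
      show "\<exists>y\<in>Y. \<phi> i y \<noteq> \<phi> k y" if "i \<in> I" "k \<in> I" "i \<noteq> k" for i k
        using insert.prems(1) that by auto
      show "scale (\<phi> i y - \<phi> j y) (v i) \<in> root_space Y (\<phi> i)" if "i \<in> I" for i
        by (rule subspace_scale[OF subspace_root_space]) (use insert.prems(2) that in auto)
      have "br y S = (\<Sum>i\<in>insert j I. scale (\<phi> i y) (v i))"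
        unfolding S_def br_sum_right
        by (rule sum.cong[OF refl], rule root_spaceD) (use insert.prems(2) y in auto)
      then have "br y S - scale (\<phi> j y) S = (\<Sum>i\<in>insert j I. scale (\<phi> i y - \<phi> j y) (v i))"
        unfolding S_def by (simp only: scale_sum_right scale_left_diff_distrib sum_subtractf)
      also have "\<dots> = (\<Sum>i\<in>I. scale (\<phi> i y - \<phi> j y) (v i))"
        using insert.hyps by simp
      finally show "(\<Sum>i\<in>I. scale (\<phi> i y - \<phi> j y) (v i)) \<in> V"
        using insert.prems(3) V stable[OF y] unfolding S_def[symmetric]
        by (metis subspace_diff subspace_scale)
    qed
    then show ?thesis using i by blast
  qed
  have in_V: "v i \<in> V" if i: "i \<in> I" for i
  proof -
    obtain y where y: "y \<in> Y" "\<phi> i y \<noteq> \<phi> j y"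
      using insert.prems(1)[of i j] insert.hyps i by auto
    have "scale (inverse (\<phi> i y - \<phi> j y)) (scale (\<phi> i y - \<phi> j y) (v i)) \<in> V"
      by (rule subspace_scale[OF V scaled[OF y(1) i]])
    then show ?thesis using y(2) by simp
  qed
  have "v j = S - (\<Sum>i\<in>I. v i)" using insert.hyps by (simp add: S_def)
  then have "v j \<in> V"
    using insert.prems(3) V in_V unfolding S_def by (metis subspace_diff subspace_sum)
  then show ?case using in_V by blast
qed

lemma eigenvector_decomposition:
  assumes "x \<in> span {v. \<exists>c. br y v = scale c v}"
  shows "\<exists>C f. finite C \<and> (\<forall>c. f c \<in> root_space {y} (\<lambda>_. c)) \<and> (\<forall>c. c \<notin> C \<longrightarrow> f c = 0) \<and> x = (\<Sum>c\<in>C. f c)"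
  using assms
proof (induction rule: span_induct_alt)
  case base
  show ?case
    by (rule exI[of _ "{}"], rule exI[of _ "\<lambda>_. 0"]) (simp add: root_space_def)
next
  case (step k x z)
  then obtain C f d where C: "finite C" and f: "\<forall>c. f c \<in> root_space {y} (\<lambda>_. c)"
    and f0: "\<forall>c. c \<notin> C \<longrightarrow> f c = 0" and z: "z = (\<Sum>c\<in>C. f c)"
    and d: "br y x = scale d x" by blast
  have x: "x \<in> root_space {y} (\<lambda>_. d)" using d by (simp add: root_space_def)
  have "z = f d + (\<Sum>c\<in>C - {d}. f c)"
    using C f0 z by (cases "d \<in> C") (auto simp: sum.remove)
  moreover have "(\<Sum>c\<in>insert d C. (f(d := scale k x + f d)) c) = scale k x + f d + (\<Sum>c\<in>C - {d}. f c)"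
    using C by (simp add: sum.insert_remove)
  ultimately have "scale k x + z = (\<Sum>c\<in>insert d C. (f(d := scale k x + f d)) c)"
    by (simp add: add.assoc)
  moreover have "\<forall>c. (f(d := scale k x + f d)) c \<in> root_space {y} (\<lambda>_. c)"
    using f x by (auto intro!: subspace_add subspace_scale subspace_root_space)
  moreover have "\<forall>c. c \<notin> insert d C \<longrightarrow> (f(d := scale k x + f d)) c = 0"
    using f0 by auto
  ultimately show ?case using C by blast
qed

text \<open>Commuting diagonalizable operators are simultaneously diagonalizable: each joint eigenspace
  of the first operators is invariant under the next one.\<close>

lemma simultaneous_eigenvectors_span:
  assumes "finite F" and "\<And>x y. x \<in> F \<Longrightarrow> y \<in> F \<Longrightarrow> br x y = 0"
    and "\<And>x. x \<in> F \<Longrightarrow> span {v. \<exists>c. br x v = scale c v} = UNIV"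
  shows "span {v. \<exists>\<phi>. v \<in> root_space F \<phi>} = UNIV"
  using assms
proof (induction F)
  case empty
  then show ?case by (simp add: root_space_def)
next
  case (insert x F)
  let ?E = "{v. \<exists>\<phi>. v \<in> root_space (insert x F) \<phi>}"
  have "u \<in> span ?E" if u: "u \<in> root_space F \<phi>" for u \<phi>
  proof -
    have "u \<in> span {v. \<exists>c. br x v = scale c v}" using insert.prems(2)[of x] by simp
    then obtain C f where C: "finite C" and f: "\<And>c. f c \<in> root_space {x} (\<lambda>_. c)"
      and uf: "u = (\<Sum>c\<in>C. f c)" using eigenvector_decomposition by blast
    have "\<forall>c\<in>C. f c \<in> root_space F \<phi>"
    proof (rule weight_components_in_subspace[where Y = "{x}" and \<phi> = "\<lambda>c _. c"])
      show "br y w \<in> root_space F \<phi>" if "y \<in> {x}" "w \<in> root_space F \<phi>" for y w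
      proof -
        have "br z (br x w) = scale (\<phi> z) (br x w)" if z: "z \<in> F" for z
        proof -
          have "br z x = 0" using insert.prems(1) z by auto
          then show ?thesis
            using br_br[of z x w] root_spaceD[OF \<open>w \<in> root_space F \<phi>\<close> z]
            by (simp add: br_scale_right)
        qed
        then show ?thesis using \<open>y \<in> {x}\<close> by (simp add: root_space_def)
      qed
    qed (use C f u uf subspace_root_space in auto)
    then have "f c \<in> ?E" if "c \<in> C" for c
      using that f[of c] insert.hyps(2)
      by (auto simp: root_space_def intro!: exI[of _ "\<phi>(x := c)"])
    then show ?thesis unfolding uf by (intro span_sum span_base)
  qed
  then have "{v. \<exists>\<phi>. v \<in> root_space F \<phi>} \<subseteq> span ?E" by blast
  then have "span {v. \<exists>\<phi>. v \<in> root_space F \<phi>} \<subseteq> span ?E"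
    by (rule span_minimal) simp
  then show ?case using insert by auto
qed

lemma root_space_bracket:
  assumes "x \<in> root_space Y \<phi>" "z \<in> root_space Y \<psi>"
  shows "br x z \<in> root_space Y (\<lambda>y. \<phi> y + \<psi> y)"
  using assms by (auto simp: root_space_def br_br[of _ x z] br_scale_left br_scale_right scale_left_distrib)

lemma dual_zero: "(\<lambda>_. 0) \<in> dual h"
  by (simp add: dual_def)

lemma dual_add: "\<phi> \<in> dual h \<Longrightarrow> \<psi> \<in> dual h \<Longrightarrow> (\<lambda>y. \<phi> y + \<psi> y) \<in> dual h"
  by (simp add: dual_def algebra_simps)

lemma dual_scale: "\<phi> \<in> dual h \<Longrightarrow> (\<lambda>y. c * \<phi> y) \<in> dual h"
  by (simp add: dual_def algebra_simps)

lemma dual_eqI: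
  assumes "\<phi> \<in> dual h" "\<psi> \<in> dual h" "\<And>y. y \<in> h \<Longrightarrow> \<phi> y = \<psi> y"
  shows "\<phi> = \<psi>"
proof
  fix y show "\<phi> y = \<psi> y"
    using assms by (cases "y \<in> h") (auto simp: dual_def)
qed

end

section \<open>Roots and the invariant form\<close>

locale simple_lie_algebra_with_form = simple_lie_algebra scale br
  for scale :: "complex \<Rightarrow> 'g::ab_group_add \<Rightarrow> 'g" and br :: "'g \<Rightarrow> 'g \<Rightarrow> 'g" +
  fixes h :: "'g set" and \<kappa> :: "'g \<Rightarrow> 'g \<Rightarrow> complex"
  assumes cartan: "cartan_subalgebra h" and form: "invariant_form \<kappa>"
begin

lemma subspace_h: "subspace h"
  and abelian_h: "x \<in> h \<Longrightarrow> y \<in> h \<Longrightarrow> br x y = 0"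
  and diagonalizable_h: "x \<in> h \<Longrightarrow> span {v. \<exists>c. br x v = scale c v} = UNIV"
  using cartan by (auto simp: cartan_subalgebra_def)

lemma root_space_zero: "root_space h (\<lambda>_. 0) = h"
  using cartan by (auto simp: cartan_subalgebra_def root_space_def)

lemma form_add_right: "\<kappa> x (y + z) = \<kappa> x y + \<kappa> x z"
  and form_scale_right: "\<kappa> x (scale c y) = c * \<kappa> x y"
  and form_sym: "\<kappa> x y = \<kappa> y x"
  and form_inv: "\<kappa> (br x y) z = \<kappa> x (br y z)"
  and form_nondegenerate: "(\<And>y. \<kappa> x y = 0) \<Longrightarrow> x = 0"
  using form by (auto simp: invariant_form_def Vector_Spaces.linear_iff)

lemma form_add_left: "\<kappa> (x + y) z = \<kappa> x z + \<kappa> y z"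
  and form_scale_left: "\<kappa> (scale c x) z = c * \<kappa> x z"
  by (metis form_sym form_add_right form_scale_right)+

lemma form_zero [simp]: "\<kappa> x 0 = 0" "\<kappa> 0 x = 0"
  using form_scale_right[of x 0 0] form_scale_left[of 0 0 x] by simp_all

lemma form_minus_right: "\<kappa> x (- y) = - \<kappa> x y"
  by (metis form_add_right form_zero(1) add.right_inverse add_eq_0_iff)

lemma form_diff_left: "\<kappa> (x - y) z = \<kappa> x z - \<kappa> y z"
  by (metis diff_add_cancel form_add_left add_diff_cancel_right')

lemma root_spaces_span: "span (\<Union>\<phi>\<in>dual h. root_space h \<phi>) = UNIV"
proof -
  let ?W = "\<Union>\<phi>\<in>dual h. root_space h \<phi>"
  obtain F where F: "F \<subseteq> h" "independent F" "h \<subseteq> span F"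
    using maximal_independent_subset by blast
  have "finite F"
    using finite_dimensional independent_span_bound[OF _ F(2)] by blast
  then have "span {v. \<exists>\<phi>. v \<in> root_space F \<phi>} = UNIV"
    by (rule simultaneous_eigenvectors_span) (use F(1) abelian_h diagonalizable_h in blast)+
  moreover have "v \<in> span ?W" if v: "v \<in> root_space F \<phi>" for v \<phi>
  proof (cases "v = 0")
    case True
    then show ?thesis by (simp add: span_zero)
  next
    case False
    have "subspace {x. \<exists>c. br x v = scale c v}"
    proof (rule subspaceI)
      show "0 \<in> {x. \<exists>c. br x v = scale c v}" by (auto intro!: exI[of _ 0])
    qed (auto simp: br_add_left br_scale_left scale_left_distrib[symmetric] intro: exI)
    moreover have "F \<subseteq> {x. \<exists>c. br x v = scale c v}"
      using v by (auto simp: root_space_def)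
    ultimately have "h \<subseteq> {x. \<exists>c. br x v = scale c v}"
      using F(3) span_minimal by blast
    then have "\<forall>x. \<exists>c. x \<in> h \<longrightarrow> br x v = scale c v" by blast
    then obtain \<psi>' where \<psi>': "\<And>x. x \<in> h \<Longrightarrow> br x v = scale (\<psi>' x) v"
      by metis
    define \<psi> where "\<psi> = (\<lambda>x. if x \<in> h then \<psi>' x else 0)"
    have \<psi>: "br x v = scale (\<psi> x) v" if "x \<in> h" for x using \<psi>' that by (simp add: \<psi>_def)
    have "\<psi> \<in> dual h"
      unfolding dual_def
    proof (intro CollectI conjI ballI allI impI)
      fix x y assume xy: "x \<in> h" "y \<in> h"
      then have "x + y \<in> h" using subspace_h by (simp add: subspace_add)
      then have "scale (\<psi> (x + y)) v = scale (\<psi> x + \<psi> y) v"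
        using xy by (simp add: \<psi>[symmetric] scale_left_distrib br_add_left)
      then show "\<psi> (x + y) = \<psi> x + \<psi> y" using False by simp
    next
      fix c x assume x: "x \<in> h"
      then have "scale c x \<in> h" using subspace_h by (simp add: subspace_scale)
      then have "scale (\<psi> (scale c x)) v = scale (c * \<psi> x) v"
        using x by (simp add: \<psi>[symmetric] br_scale_left flip: scale_scale)
      then show "\<psi> (scale c x) = c * \<psi> x" using False by simp
    qed (simp add: \<psi>_def)
    moreover have "v \<in> root_space h \<psi>" using \<psi> by (simp add: root_space_def)
    ultimately show ?thesis by (intro span_base) blast
  qed
  then have "{v. \<exists>\<phi>. v \<in> root_space F \<phi>} \<subseteq> span ?W" by blast
  then have "span {v. \<exists>\<phi>. v \<in> root_space F \<phi>} \<subseteq> span ?W" by (rule span_minimal) simp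
  ultimately show ?thesis by auto
qed

lemma root_space_cases:
  assumes "\<phi> \<in> dual h" "x \<in> root_space h \<phi>" "x \<noteq> 0"
  shows "\<phi> = (\<lambda>_. 0) \<or> \<phi> \<in> roots h"
  using assms by (auto simp: roots_def)

lemma finite_roots: "finite (roots h)"
proof -
  have "\<forall>\<phi>\<in>roots h. \<exists>v. v \<in> root_space h \<phi> \<and> v \<noteq> 0"
    using subspace_0[OF subspace_root_space] unfolding roots_def by blast
  then obtain v where v: "\<And>\<phi>. \<phi> \<in> roots h \<Longrightarrow> v \<phi> \<in> root_space h \<phi> \<and> v \<phi> \<noteq> 0" by metis
  have sep: "\<exists>y\<in>h. \<phi> y \<noteq> \<psi> y" if "\<phi> \<in> roots h" "\<psi> \<in> roots h" "\<phi> \<noteq> \<psi>" for \<phi> \<psi>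
    using that dual_eqI[of \<phi> h \<psi>] by (auto simp: roots_def)
  have inj: "inj_on v (roots h)"
  proof (rule inj_onI, rule ccontr)
    fix \<phi> \<psi> assume *: "\<phi> \<in> roots h" "\<psi> \<in> roots h" "v \<phi> = v \<psi>" "\<phi> \<noteq> \<psi>"
    then obtain y where "y \<in> h" "\<phi> y \<noteq> \<psi> y" using sep by blast
    then show False
      using * v[of \<phi>] v[of \<psi>] by (auto simp: root_space_def)
  qed
  have "independent (v ` roots h)"
    unfolding independent_explicit_module
  proof (intro allI impI)
    fix t u w assume t: "finite t" "t \<subseteq> v ` roots h" and s: "(\<Sum>w\<in>t. scale (u w) w) = 0" and w: "w \<in> t"
    define I where "I = {\<phi>\<in>roots h. v \<phi> \<in> t}"
    have tI: "t = v ` I" using t(2) by (auto simp: I_def)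
    have injI: "inj_on v I" using inj by (rule inj_on_subset) (auto simp: I_def)
    have "\<forall>\<phi>\<in>I. scale (u (v \<phi>)) (v \<phi>) \<in> {0}"
    proof (rule weight_components_in_subspace[where Y = h and \<phi> = "\<lambda>\<phi>. \<phi>"])
      show "finite I" using t(1) tI injI finite_image_iff by blast
      show "(\<Sum>\<phi>\<in>I. scale (u (v \<phi>)) (v \<phi>)) \<in> {0}"
        using s injI by (simp add: tI sum.reindex)
    qed (use sep v in \<open>auto simp: I_def intro!: subspace_scale subspace_root_space\<close>)
    moreover obtain \<phi> where "\<phi> \<in> I" "w = v \<phi>" using w tI by blast
    ultimately show "u w = 0" using v by (auto simp: I_def)
  qed
  then have "finite (v ` roots h)"
    using finite_dimensional independent_span_bound by blast
  then show ?thesis using inj finite_image_iff by blast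
qed

lemma form_root_spaces_orthogonal:
  assumes "x \<in> root_space h \<phi>" "z \<in> root_space h \<psi>" "y \<in> h" "\<phi> y + \<psi> y \<noteq> 0"
  shows "\<kappa> x z = 0"
proof -
  have "\<phi> y * \<kappa> x z = \<kappa> (br y x) z"
    using assms by (simp add: root_spaceD form_scale_left)
  also have "\<dots> = \<kappa> (br x (- y)) z" by (metis br_skew br_minus_right)
  also have "\<dots> = \<kappa> x (br (- y) z)" by (rule form_inv)
  also have "br (- y) z = - br y z" by (metis br_skew br_minus_right)
  also have "\<kappa> x (- br y z) = - (\<psi> y * \<kappa> x z)"
    using assms by (simp add: root_spaceD form_minus_right form_scale_right)
  finally have "(\<phi> y + \<psi> y) * \<kappa> x z = 0" by (simp add: algebra_simps)
  then show ?thesis using assms by simp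
qed

text \<open>A root space pairs to zero with all root spaces but the opposite one, so nondegeneracy can be
  tested there; for the weight \<open>0\<close> this says that the form is nondegenerate on \<open>h\<close>.\<close>

lemma form_nondegenerate_root_space:
  assumes \<phi>: "\<phi> \<in> dual h" and x: "x \<in> root_space h \<phi>"
    and "\<And>z. z \<in> root_space h (\<lambda>y. - \<phi> y) \<Longrightarrow> \<kappa> x z = 0"
  shows "x = 0"
proof (rule form_nondegenerate)
  have "(\<Union>\<psi>\<in>dual h. root_space h \<psi>) \<subseteq> {z. \<kappa> x z = 0}"
  proof clarify
    fix \<psi> z assume \<psi>: "\<psi> \<in> dual h" and z: "z \<in> root_space h \<psi>"
    show "\<kappa> x z = 0"
    proof (cases "\<forall>y\<in>h. \<phi> y + \<psi> y = 0")
      case True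
      have "\<psi> = (\<lambda>y. - \<phi> y)"
      proof (rule dual_eqI[OF \<psi>])
        show "(\<lambda>y. - \<phi> y) \<in> dual h" using dual_scale[OF \<phi>, of "-1"] by simp
        show "\<psi> y = - \<phi> y" if "y \<in> h" for y
          using True that by (simp add: eq_neg_iff_add_eq_0 add.commute)
      qed
      then show ?thesis using assms z by blast
    next
      case False
      then show ?thesis using form_root_spaces_orthogonal[OF x z] by blast
    qed
  qed
  moreover have "subspace {z. \<kappa> x z = 0}"
    by (rule subspaceI) (simp_all add: form_add_right form_scale_right)
  ultimately have "span (\<Union>\<psi>\<in>dual h. root_space h \<psi>) \<subseteq> {z. \<kappa> x z = 0}"
    by (rule span_minimal)
  then show "\<kappa> x y = 0" for y using root_spaces_span by auto
qed

lemma form_nondegenerate_h: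
  assumes "x \<in> h" "\<And>z. z \<in> h \<Longrightarrow> \<kappa> x z = 0"
  shows "x = 0"
  by (rule form_nondegenerate_root_space[OF dual_zero]) (use assms root_space_zero in auto)

end

section \<open>Root strings\<close>

context simple_lie_algebra_with_form
begin

abbreviation ip :: "('g \<Rightarrow> complex) \<Rightarrow> ('g \<Rightarrow> complex) \<Rightarrow> complex" where
  "ip \<equiv> dual_form h \<kappa>"

lemma dual_vec_eqI:
  assumes "v \<in> h" "\<And>y. y \<in> h \<Longrightarrow> \<kappa> v y = \<phi> y"
  shows "dual_vec h \<kappa> \<phi> = v"
  unfolding dual_vec_def
proof (rule the_equality)
  show "w = v" if w: "w \<in> h \<and> (\<forall>x\<in>h. \<kappa> w x = \<phi> x)" for w
  proof -
    have "w - v = 0"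
      by (rule form_nondegenerate_h) (use w assms subspace_h in \<open>auto simp: subspace_diff form_diff_left\<close>)
    then show ?thesis by simp
  qed
qed (use assms in auto)

lemma root_in_dual: "\<phi> \<in> roots h \<Longrightarrow> \<phi> \<in> dual h"
  by (simp add: roots_def)

lemma dual_uminus: "\<phi> \<in> dual h \<Longrightarrow> (\<lambda>y. - \<phi> y) \<in> dual h"
  using dual_scale[of \<phi> h "-1"] by simp

lemma root_vector_exists:
  assumes "\<phi> \<in> roots h"
  obtains e where "e \<in> root_space h \<phi>" "e \<noteq> 0"
  using assms subspace_0[OF subspace_root_space, of h \<phi>] unfolding roots_def by blast

lemma opposite_root_vectors:
  assumes "\<phi> \<in> roots h"
  obtains e f where "e \<in> root_space h \<phi>" "f \<in> root_space h (\<lambda>y. - \<phi> y)" "\<kappa> e f = 1"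
proof -
  obtain e where e: "e \<in> root_space h \<phi>" "e \<noteq> 0"
    using root_vector_exists assms by blast
  then obtain z where z: "z \<in> root_space h (\<lambda>y. - \<phi> y)" "\<kappa> e z \<noteq> 0"
    using form_nondegenerate_root_space[OF root_in_dual[OF assms]] by blast
  show ?thesis
  proof (rule that[OF e(1)])
    show "scale (1 / \<kappa> e z) z \<in> root_space h (\<lambda>y. - \<phi> y)"
      using z(1) by (intro subspace_scale subspace_root_space)
    show "\<kappa> e (scale (1 / \<kappa> e z) z) = 1" using z(2) by (simp add: form_scale_right)
  qed
qed

lemma bracket_opposite:
  assumes e: "e \<in> root_space h \<phi>" and f: "f \<in> root_space h (\<lambda>y. - \<phi> y)"
  shows "br e f \<in> h" "\<And>y. y \<in> h \<Longrightarrow> \<kappa> (br e f) y = \<kappa> e f * \<phi> y"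
proof -
  show "br e f \<in> h" using root_space_bracket[OF e f] by (simp add: root_space_zero)
  fix y assume y: "y \<in> h"
  have "\<kappa> (br e f) y = \<kappa> e (- br y f)" by (metis form_inv br_skew)
  also have "\<dots> = \<kappa> e f * \<phi> y"
    using root_spaceD[OF f y] by (simp add: form_scale_right form_minus_right)
  finally show "\<kappa> (br e f) y = \<kappa> e f * \<phi> y" .
qed

text \<open>For roots, this provides the existence of the vector that \<open>dual_vec\<close> describes; uniqueness is
  nondegeneracy of the form on \<open>h\<close>.\<close>

lemma dual_vec_eq_bracket:
  assumes "e \<in> root_space h \<phi>" "f \<in> root_space h (\<lambda>y. - \<phi> y)" "\<kappa> e f = 1"
  shows "dual_vec h \<kappa> \<phi> = br e f"
  by (rule dual_vec_eqI) (use bracket_opposite[OF assms(1,2)] assms(3) in auto)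

lemma dual_vec_root:
  assumes "\<phi> \<in> roots h"
  shows "dual_vec h \<kappa> \<phi> \<in> h" "\<And>y. y \<in> h \<Longrightarrow> \<kappa> (dual_vec h \<kappa> \<phi>) y = \<phi> y"
proof -
  obtain e f where ef: "e \<in> root_space h \<phi>" "f \<in> root_space h (\<lambda>y. - \<phi> y)" "\<kappa> e f = 1"
    using opposite_root_vectors assms by blast
  show "dual_vec h \<kappa> \<phi> \<in> h" "\<And>y. y \<in> h \<Longrightarrow> \<kappa> (dual_vec h \<kappa> \<phi>) y = \<phi> y"
    using dual_vec_eq_bracket[OF ef] bracket_opposite[OF ef(1,2)] ef(3) by auto
qed

lemma ip_eval: "\<phi> \<in> roots h \<Longrightarrow> \<psi> \<in> roots h \<Longrightarrow> ip \<phi> \<psi> = \<phi> (dual_vec h \<kappa> \<psi>)"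
  by (simp add: dual_form_def dual_vec_root)

lemma ip_sym: "ip \<phi> \<psi> = ip \<psi> \<phi>"
  by (simp add: dual_form_def form_sym)

text \<open>Weights moved repeatedly by a fixed nonzero functional leave the finite set of weights.\<close>

lemma weight_ray_ends:
  assumes \<phi>: "\<phi> \<in> dual h" "\<phi> \<noteq> (\<lambda>_. 0)" and \<mu>: "\<mu> \<in> dual h"
    and u: "\<And>n. u n \<in> root_space h (\<lambda>y. \<mu> y + of_nat n * \<phi> y)"
  shows "\<exists>n. u n = 0"
proof (rule ccontr)
  assume ne: "\<nexists>n. u n = 0"
  obtain y where y: "\<phi> y \<noteq> 0" using \<phi>(2) by auto
  have "inj (\<lambda>n::nat. (\<lambda>y. \<mu> y + of_nat n * \<phi> y))"
  proof (rule injI)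
    fix m n :: nat
    assume "(\<lambda>y. \<mu> y + of_nat m * \<phi> y) = (\<lambda>y. \<mu> y + of_nat n * \<phi> y)"
    then have "\<mu> y + of_nat m * \<phi> y = \<mu> y + of_nat n * \<phi> y" by (rule fun_cong)
    then show "m = n" using y by simp
  qed
  moreover have "range (\<lambda>n::nat. (\<lambda>y. \<mu> y + of_nat n * \<phi> y)) \<subseteq> insert (\<lambda>_. 0) (roots h)"
  proof clarify
    fix n :: nat
    assume "(\<lambda>y. \<mu> y + of_nat n * \<phi> y) \<notin> roots h"
    moreover have "(\<lambda>y. \<mu> y + of_nat n * \<phi> y) \<in> dual h" by (intro dual_add dual_scale \<mu> \<phi>)
    ultimately show "(\<lambda>y. \<mu> y + of_nat n * \<phi> y) = (\<lambda>_. 0)"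
      using root_space_cases u[of n] ne by blast
  qed
  then have "finite (range (\<lambda>n::nat. (\<lambda>y. \<mu> y + of_nat n * \<phi> y)))"
    by (rule finite_subset) (simp add: finite_roots)
  ultimately show False using finite_imageD by fastforce
qed

lemma iterate_in_root_space:
  assumes "x \<in> root_space h \<phi>" "v \<in> root_space h \<mu>"
  shows "(br x ^^ n) v \<in> root_space h (\<lambda>y. \<mu> y + of_nat n * \<phi> y)"
proof (induction n)
  case 0
  then show ?case using assms by simp
next
  case (Suc n)
  have "br x ((br x ^^ n) v) \<in> root_space h (\<lambda>y. \<phi> y + (\<mu> y + of_nat n * \<phi> y))"
    by (rule root_space_bracket[OF assms(1) Suc])
  then show ?case by (simp add: algebra_simps)
qed

text \<open>The computation behind the representation theory of \<open>sl\<^sub>2\<close>. With \<open>[e, f] = t\<close>, the vector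
  \<open>e f\<^sup>n\<^sup>+\<^sup>1 v\<close> is a multiple of \<open>f\<^sup>n v\<close> with factor \<open>(n + 1) (\<mu> t - n/2 \<phi> t)\<close>, which must vanish for the
  last \<open>n = q\<close> with \<open>f\<^sup>n v \<noteq> 0\<close>. The case \<open>\<phi> t = 0\<close> is included, since \<open>\<phi> t \<noteq> 0\<close> is deduced from
  this lemma.\<close>

lemma highest_weight_string:
  assumes \<phi>: "\<phi> \<in> roots h" and e: "e \<in> root_space h \<phi>" and f: "f \<in> root_space h (\<lambda>y. - \<phi> y)"
    and ef: "\<kappa> e f = 1"
    and \<mu>: "\<mu> \<in> dual h" and v: "v \<in> root_space h \<mu>" "v \<noteq> 0" and ev: "br e v = 0"
  obtains q :: nat where
    "2 * \<mu> (dual_vec h \<kappa> \<phi>) = of_nat q * \<phi> (dual_vec h \<kappa> \<phi>)"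
    "\<And>i. i \<le> q \<Longrightarrow> (br f ^^ i) v \<noteq> 0"
proof -
  define t where "t = dual_vec h \<kappa> \<phi>"
  have t: "br e f = t" using dual_vec_eq_bracket[OF e f ef] by (simp add: t_def)
  have th: "t \<in> h" using dual_vec_root[OF \<phi>] by (simp add: t_def)
  define F where "F = (\<lambda>n. (br f ^^ n) v)"
  have F: "F n \<in> root_space h (\<lambda>y. \<mu> y + of_nat n * - \<phi> y)" for n
    unfolding F_def by (rule iterate_in_root_space[OF f v(1)])
  have eF: "br e (F (Suc n)) = scale (of_nat (Suc n) * (\<mu> t - of_nat n / 2 * \<phi> t)) (F n)" for n
  proof (induction n)
    case 0
    have "br e (br f v) = br t v" using br_br[of e f v] ev t by simp
    then show ?case using root_spaceD[OF v(1) th] by (simp add: F_def)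
  next
    case (Suc n)
    have "br e (F (Suc (Suc n))) = br t (F (Suc n)) + br f (br e (F (Suc n)))"
      using br_br[of e f "F (Suc n)"] by (simp add: F_def t)
    also have "br f (br e (F (Suc n))) = scale (of_nat (Suc n) * (\<mu> t - of_nat n / 2 * \<phi> t)) (F (Suc n))"
      unfolding Suc br_scale_right by (simp add: F_def)
    also have "br t (F (Suc n)) = scale (\<mu> t - of_nat (Suc n) * \<phi> t) (F (Suc n))"
      using root_spaceD[OF F th, of "Suc n"] by simp
    finally have "br e (F (Suc (Suc n))) =
        scale ((\<mu> t - of_nat (Suc n) * \<phi> t) + of_nat (Suc n) * (\<mu> t - of_nat n / 2 * \<phi> t)) (F (Suc n))"
      by (simp only: scale_left_distrib)
    then show ?case by (simp add: field_simps)
  qed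
  have "(\<lambda>y. - \<phi> y) \<noteq> (\<lambda>_. 0)"
    using \<phi> by (simp add: roots_def fun_eq_iff)
  then have "\<exists>n. F n = 0"
    using weight_ray_ends[of "\<lambda>y. - \<phi> y" \<mu> F] F dual_uminus root_in_dual \<phi> \<mu> by blast
  then obtain n where n: "F n = 0" "\<And>i. i < n \<Longrightarrow> F i \<noteq> 0"
    using exists_least_iff[of "\<lambda>n. F n = 0"] by blast
  have "n \<noteq> 0" using n(1) v(2) by (auto simp: F_def intro: gr0I)
  then obtain q where q: "n = Suc q" using not0_implies_Suc by blast
  have "scale (of_nat (Suc q) * (\<mu> t - of_nat q / 2 * \<phi> t)) (F q) = 0"
    using eF[of q] n(1) by (simp add: q)
  then have "of_nat (Suc q) * (\<mu> t - of_nat q / 2 * \<phi> t) = 0"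
    using n(2)[of q] q by (simp del: of_nat_Suc)
  then have "\<mu> t - of_nat q / 2 * \<phi> t = 0" by (simp del: of_nat_Suc)
  then have "2 * \<mu> t = of_nat q * \<phi> t" by (simp add: mult.commute)
  then show ?thesis
    using that[of q] n(2) q by (auto simp: t_def F_def less_Suc_eq_le)
qed

text \<open>Raising a weight vector repeatedly must stop, by finiteness of the set of weights; the last nonzero
  vector has highest weight.\<close>

lemma highest_weight_vector:
  assumes \<phi>: "\<phi> \<in> roots h" and e: "e \<in> root_space h \<phi>"
    and \<psi>: "\<psi> \<in> dual h" and v: "v \<in> root_space h \<psi>" "v \<noteq> 0"
  obtains p w where "w \<in> root_space h (\<lambda>y. \<psi> y + of_nat p * \<phi> y)" "w \<noteq> 0" "br e w = 0"
proof -
  have "\<exists>n. (br e ^^ n) v = 0"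
    by (rule weight_ray_ends[of \<phi> \<psi>]) (use iterate_in_root_space[OF e v(1)] \<phi> \<psi> in \<open>auto simp: roots_def\<close>)
  then obtain n where n: "(br e ^^ n) v = 0" "\<And>i. i < n \<Longrightarrow> (br e ^^ i) v \<noteq> 0"
    using exists_least_iff[of "\<lambda>n. (br e ^^ n) v = 0"] by blast
  have "n \<noteq> 0" using n(1) v(2) by (auto intro: gr0I)
  then obtain q where q: "n = Suc q" using not0_implies_Suc by blast
  show ?thesis
    by (rule that[of "(br e ^^ q) v" q]) (use iterate_in_root_space[OF e v(1)] n q in auto)
qed

lemma center_trivial:
  assumes "\<And>y. br x y = 0"
  shows "x = 0"
proof -
  have "ideal {x. \<forall>y. br x y = 0}"
    unfolding ideal_def
  proof (intro conjI allI ballI)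
    show "subspace {x. \<forall>y. br x y = 0}"
      by (rule subspaceI) (simp_all add: br_add_left br_scale_left)
    show "br y z \<in> {x. \<forall>y. br x y = 0}" if "z \<in> {x. \<forall>y. br x y = 0}" for y z
    proof -
      have "br y z = 0" using that br_skew[of y z] by simp
      then show ?thesis by simp
    qed
  qed
  then have "{x. \<forall>y. br x y = 0} = {0} \<or> {x. \<forall>y. br x y = 0} = UNIV" by (rule simple)
  then show ?thesis using nonabelian assms by auto
qed

text \<open>If \<open>\<phi>\<close> were isotropic, all weights would vanish on the vector of \<open>h\<close> dual to \<open>\<phi>\<close>, making it
  central.\<close>

lemma root_anisotropic:
  assumes \<phi>: "\<phi> \<in> roots h"
  shows "ip \<phi> \<phi> \<noteq> 0"
proof
  define t where "t = dual_vec h \<kappa> \<phi>"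
  assume "ip \<phi> \<phi> = 0"
  then have t0: "\<phi> t = 0" by (simp add: ip_eval \<phi> t_def)
  have th: "t \<in> h" using dual_vec_root[OF \<phi>] by (simp add: t_def)
  obtain e f where ef: "e \<in> root_space h \<phi>" "f \<in> root_space h (\<lambda>y. - \<phi> y)" "\<kappa> e f = 1"
    using opposite_root_vectors \<phi> by blast
  have "br t v = 0" if \<psi>: "\<psi> \<in> dual h" and v: "v \<in> root_space h \<psi>" for \<psi> v
  proof (cases "v = 0")
    case False
    obtain p w where w: "w \<in> root_space h (\<lambda>y. \<psi> y + of_nat p * \<phi> y)" "w \<noteq> 0" "br e w = 0"
      using highest_weight_vector[OF \<phi> ef(1) \<psi> v False] by blast
    have "(\<lambda>y. \<psi> y + of_nat p * \<phi> y) \<in> dual h"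
      by (intro dual_add dual_scale \<psi> root_in_dual \<phi>)
    then obtain q :: nat where "2 * (\<psi> t + of_nat p * \<phi> t) = of_nat q * \<phi> t"
      using highest_weight_string[OF \<phi> ef _ w] unfolding t_def by blast
    then have "\<psi> t = 0" using t0 by simp
    then show ?thesis using root_spaceD[OF v th] by simp
  qed simp
  then have "(\<Union>\<psi>\<in>dual h. root_space h \<psi>) \<subseteq> {v. br t v = 0}" by blast
  moreover have "subspace {v. br t v = 0}"
    by (rule subspaceI) (simp_all add: br_add_right br_scale_right)
  ultimately have "br t v = 0" for v
    using span_minimal root_spaces_span by blast
  then have "t = 0" by (rule center_trivial)
  then have "\<phi> y = 0" if "y \<in> h" for y
    using dual_vec_root(2)[OF \<phi> that] by (simp add: t_def)
  then have "\<phi> = (\<lambda>_. 0)" using dual_eqI[OF root_in_dual[OF \<phi>] dual_zero] by blast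
  then show False using \<phi> by (simp add: roots_def)
qed

lemma root_uminus:
  assumes \<phi>: "\<phi> \<in> roots h"
  shows "(\<lambda>y. - \<phi> y) \<in> roots h"
proof -
  obtain e f where ef: "f \<in> root_space h (\<lambda>y. - \<phi> y)" "\<kappa> e f = 1"
    using opposite_root_vectors \<phi> by blast
  then have "f \<noteq> 0" by auto
  moreover have "(\<lambda>y. - \<phi> y) \<noteq> (\<lambda>_. 0)"
    using \<phi> by (simp add: roots_def fun_eq_iff)
  ultimately show ?thesis
    using ef root_space_cases[OF dual_uminus[OF root_in_dual[OF \<phi>]]] by blast
qed

text \<open>Going up the \<open>\<phi>\<close>-string from \<open>\<psi>\<close> by \<open>p\<close> steps gives a highest weight, and the string below it
  has length \<open>q\<close>, where \<open>q - 2 p = n\<close>. If \<open>n \<ge> 0\<close>, the reflected weight lies \<open>q - p\<close> steps below the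
  top, hence inside the string; otherwise the string of \<open>-\<phi>\<close> does the same.\<close>

lemma root_string_nonneg:
  assumes \<phi>: "\<phi> \<in> roots h" and \<psi>: "\<psi> \<in> roots h"
  obtains n :: int where "2 * ip \<psi> \<phi> = of_int n * ip \<phi> \<phi>"
    "n \<ge> 0 \<Longrightarrow> (\<lambda>y. \<psi> y - of_int n * \<phi> y) \<in> roots h"
proof -
  define t where "t = dual_vec h \<kappa> \<phi>"
  obtain e f where ef: "e \<in> root_space h \<phi>" "f \<in> root_space h (\<lambda>y. - \<phi> y)" "\<kappa> e f = 1"
    using opposite_root_vectors \<phi> by blast
  obtain v where v: "v \<in> root_space h \<psi>" "v \<noteq> 0" using root_vector_exists \<psi> by blast
  obtain p w where w: "w \<in> root_space h (\<lambda>y. \<psi> y + of_nat p * \<phi> y)" "w \<noteq> 0" "br e w = 0"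
    using highest_weight_vector[OF \<phi> ef(1) root_in_dual[OF \<psi>] v] by blast
  have "(\<lambda>y. \<psi> y + of_nat p * \<phi> y) \<in> dual h"
    by (intro dual_add dual_scale root_in_dual \<phi> \<psi>)
  then obtain q :: nat where q: "2 * (\<psi> t + of_nat p * \<phi> t) = of_nat q * \<phi> t"
    and ne: "\<And>i. i \<le> q \<Longrightarrow> (br f ^^ i) w \<noteq> 0"
    using highest_weight_string[OF \<phi> ef _ w] unfolding t_def by blast
  define n where "n = int q - 2 * int p"
  have n: "2 * \<psi> t = of_int n * \<phi> t" using q by (simp add: n_def algebra_simps)
  have t0: "\<phi> t \<noteq> 0" using root_anisotropic[OF \<phi>] by (simp add: ip_eval \<phi> t_def)
  show ?thesis
  proof (rule that[of n])
    show "2 * ip \<psi> \<phi> = of_int n * ip \<phi> \<phi>" using n by (simp add: ip_eval \<phi> \<psi> t_def)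
    assume "n \<ge> 0"
    then have pq: "p \<le> q" by (simp add: n_def)
    have "(br f ^^ (q - p)) w \<in> root_space h (\<lambda>y. \<psi> y + of_nat p * \<phi> y + of_nat (q - p) * - \<phi> y)"
      by (rule iterate_in_root_space[OF ef(2) w(1)])
    also have "(\<lambda>y. \<psi> y + of_nat p * \<phi> y + of_nat (q - p) * - \<phi> y) = (\<lambda>y. \<psi> y - of_int n * \<phi> y)"
      using pq by (auto simp: n_def of_nat_diff algebra_simps)
    finally have u: "(br f ^^ (q - p)) w \<in> root_space h (\<lambda>y. \<psi> y - of_int n * \<phi> y)" .
    have "(\<lambda>y. \<psi> y - of_int n * \<phi> y) \<noteq> (\<lambda>_. 0)"
    proof
      assume eq: "(\<lambda>y. \<psi> y - of_int n * \<phi> y) = (\<lambda>_. 0)"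
      then have "\<psi> t = of_int n * \<phi> t" using fun_cong[OF eq, of t] by simp
      then have "of_int n * \<phi> t = 0" using n by simp
      then have "n = 0" using t0 by simp
      then show False using eq \<psi> by (simp add: roots_def)
    qed
    moreover have "(\<lambda>y. \<psi> y - of_int n * \<phi> y) \<in> dual h"
      using dual_add[OF root_in_dual[OF \<psi>] dual_scale[OF root_in_dual[OF \<phi>], of "- of_int n"]] by simp
    ultimately show "(\<lambda>y. \<psi> y - of_int n * \<phi> y) \<in> roots h"
      using root_space_cases[OF _ u] ne[of "q - p"] by auto
  qed
qed

lemma ip_uminus_right:
  assumes "\<phi> \<in> roots h" "\<psi> \<in> roots h"
  shows "ip \<psi> (\<lambda>y. - \<phi> y) = - ip \<psi> \<phi>"
  using ip_eval[OF root_uminus[OF assms(1)] assms(2)] ip_eval[OF assms] by (simp add: ip_sym)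

lemma root_reflection:
  assumes \<phi>: "\<phi> \<in> roots h" and \<psi>: "\<psi> \<in> roots h"
  obtains n :: int where "2 * ip \<psi> \<phi> = of_int n * ip \<phi> \<phi>" "(\<lambda>y. \<psi> y - of_int n * \<phi> y) \<in> roots h"
proof -
  obtain n :: int where n: "2 * ip \<psi> \<phi> = of_int n * ip \<phi> \<phi>"
    "n \<ge> 0 \<Longrightarrow> (\<lambda>y. \<psi> y - of_int n * \<phi> y) \<in> roots h"
    using root_string_nonneg[OF \<phi> \<psi>] by blast
  let ?\<phi> = "\<lambda>y. - \<phi> y"
  obtain m :: int where m: "2 * ip \<psi> ?\<phi> = of_int m * ip ?\<phi> ?\<phi>"
    "m \<ge> 0 \<Longrightarrow> (\<lambda>y. \<psi> y - of_int m * - \<phi> y) \<in> roots h"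
    using root_string_nonneg[OF root_uminus[OF \<phi>] \<psi>] by blast
  have "ip ?\<phi> ?\<phi> = ip \<phi> \<phi>"
    using ip_uminus_right[OF \<phi> root_uminus[OF \<phi>]] ip_uminus_right[OF \<phi> \<phi>] by (simp add: ip_sym)
  then have "of_int (- n) * ip \<phi> \<phi> = of_int m * ip \<phi> \<phi>"
    using n(1) m(1) ip_uminus_right[OF \<phi> \<psi>] by simp
  then have "m = - n"
    using root_anisotropic[OF \<phi>] by (metis mult_cancel_right of_int_eq_iff)
  then show ?thesis using that[of n] n m by (cases "n \<ge> 0") auto
qed

end

section \<open>Squared lengths of roots\<close>

context simple_lie_algebra_with_form
begin

definition cartan_int :: "('g \<Rightarrow> complex) \<Rightarrow> ('g \<Rightarrow> complex) \<Rightarrow> int" where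
  "cartan_int \<psi> \<phi> = (THE n. 2 * ip \<psi> \<phi> = of_int n * ip \<phi> \<phi>)"

definition reflect :: "('g \<Rightarrow> complex) \<Rightarrow> ('g \<Rightarrow> complex) \<Rightarrow> 'g \<Rightarrow> complex" where
  "reflect \<phi> \<psi> = (\<lambda>y. \<psi> y - of_int (cartan_int \<psi> \<phi>) * \<phi> y)"

lemma cartan_int_eqI:
  assumes "\<phi> \<in> roots h" "2 * ip \<psi> \<phi> = of_int n * ip \<phi> \<phi>"
  shows "cartan_int \<psi> \<phi> = n"
  unfolding cartan_int_def
proof (rule the_equality)
  show "m = n" if "2 * ip \<psi> \<phi> = of_int m * ip \<phi> \<phi>" for m
    using that assms root_anisotropic by simp
qed (rule assms)

lemma cartan_int:
  assumes \<phi>: "\<phi> \<in> roots h" and \<psi>: "\<psi> \<in> roots h"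
  shows "2 * ip \<psi> \<phi> = of_int (cartan_int \<psi> \<phi>) * ip \<phi> \<phi>"
    and "reflect \<phi> \<psi> \<in> roots h"
proof -
  obtain n :: int where n: "2 * ip \<psi> \<phi> = of_int n * ip \<phi> \<phi>" "(\<lambda>y. \<psi> y - of_int n * \<phi> y) \<in> roots h"
    using root_reflection[OF \<phi> \<psi>] by blast
  then have "cartan_int \<psi> \<phi> = n" using cartan_int_eqI[OF \<phi>] by blast
  then show "2 * ip \<psi> \<phi> = of_int (cartan_int \<psi> \<phi>) * ip \<phi> \<phi>" "reflect \<phi> \<psi> \<in> roots h"
    using n by (simp_all add: reflect_def)
qed

lemma cartan_int_self: "\<phi> \<in> roots h \<Longrightarrow> cartan_int \<phi> \<phi> = 2"
  by (rule cartan_int_eqI) simp_all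

lemma ip_reflect:
  assumes "\<phi> \<in> roots h" "\<psi> \<in> roots h" "\<chi> \<in> roots h"
  shows "ip (reflect \<phi> \<psi>) \<chi> = ip \<psi> \<chi> - of_int (cartan_int \<psi> \<phi>) * ip \<phi> \<chi>"
  using assms cartan_int(2)[OF assms(1,2)] by (simp add: ip_eval) (simp add: reflect_def)

lemma cartan_int_reflect:
  assumes "\<phi> \<in> roots h" "\<psi> \<in> roots h" "\<chi> \<in> roots h"
  shows "cartan_int (reflect \<phi> \<psi>) \<chi> = cartan_int \<psi> \<chi> - cartan_int \<psi> \<phi> * cartan_int \<phi> \<chi>"
proof (rule cartan_int_eqI[OF assms(3)])
  show "2 * ip (reflect \<phi> \<psi>) \<chi> = of_int (cartan_int \<psi> \<chi> - cartan_int \<psi> \<phi> * cartan_int \<phi> \<chi>) * ip \<chi> \<chi>"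
    using cartan_int(1)[OF assms(3,2)] cartan_int(1)[OF assms(3,1)]
    by (simp add: ip_reflect assms algebra_simps)
qed

lemma reflect_involution:
  assumes "\<phi> \<in> roots h" "\<psi> \<in> roots h"
  shows "reflect \<phi> (reflect \<phi> \<psi>) = \<psi>"
proof -
  have "cartan_int (reflect \<phi> \<psi>) \<phi> = - cartan_int \<psi> \<phi>"
    using cartan_int_reflect[OF assms assms(1)] cartan_int_self[OF assms(1)] by simp
  then show ?thesis unfolding reflect_def by (simp add: fun_eq_iff)
qed

lemma reflect_isometry:
  assumes "\<phi> \<in> roots h" "\<psi> \<in> roots h"
  shows "ip (reflect \<phi> \<psi>) (reflect \<phi> \<psi>) = ip \<psi> \<psi>"
proof -
  define \<rho> where "\<rho> = reflect \<phi> \<psi>"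
  define n :: complex where "n = of_int (cartan_int \<psi> \<phi>)"
  have \<rho>: "\<rho> \<in> roots h" using cartan_int(2)[OF assms] by (simp add: \<rho>_def)
  have "ip \<rho> \<rho> = ip \<psi> \<rho> - n * ip \<phi> \<rho>" using ip_reflect[OF assms \<rho>] by (simp add: \<rho>_def n_def)
  also have "ip \<psi> \<rho> = ip \<psi> \<psi> - n * ip \<phi> \<psi>"
    using ip_reflect[OF assms assms(2)] by (simp add: \<rho>_def n_def ip_sym)
  also have "ip \<phi> \<rho> = ip \<psi> \<phi> - n * ip \<phi> \<phi>"
    using ip_reflect[OF assms assms(1)] by (simp add: \<rho>_def n_def ip_sym)
  also have "n * ip \<phi> \<phi> = 2 * ip \<psi> \<phi>" using cartan_int(1)[OF assms] by (simp add: n_def)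
  finally show ?thesis using ip_sym[of \<phi> \<psi>] by (simp add: \<rho>_def)
qed

text \<open>Up to the factor \<open>4 / ((\<alpha>|\<alpha>) (\<beta>|\<beta>))\<close>, this is the sum of \<open>(\<phi>|\<alpha>) (\<phi>|\<beta>)\<close> over all roots \<open>\<phi>\<close>, a form
  invariant under reflections. Invariance ties it to the given form (\<open>trace_form_proportional\<close>), which
  is only known to be complex valued. As the present values are integers and sums of squares for
  \<open>\<alpha> = \<beta>\<close>, this transfers positivity and the Cauchy-Schwarz inequality.\<close>

definition trace_form :: "('g \<Rightarrow> complex) \<Rightarrow> ('g \<Rightarrow> complex) \<Rightarrow> int" where
  "trace_form \<alpha> \<beta> = (\<Sum>\<phi>\<in>roots h. cartan_int \<phi> \<alpha> * cartan_int \<phi> \<beta>)"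

text \<open>Reflecting the summation index in \<open>\<alpha>\<close> changes the sign of \<open>cartan_int \<phi> \<alpha>\<close> and shifts
  \<open>cartan_int \<phi> \<beta>\<close> by a multiple of it.\<close>

lemma trace_form_proportional:
  assumes \<alpha>: "\<alpha> \<in> roots h" and \<beta>: "\<beta> \<in> roots h"
  shows "2 * trace_form \<alpha> \<beta> = cartan_int \<alpha> \<beta> * trace_form \<alpha> \<alpha>"
proof -
  have "trace_form \<alpha> \<beta> = (\<Sum>\<phi>\<in>roots h. cartan_int (reflect \<alpha> \<phi>) \<alpha> * cartan_int (reflect \<alpha> \<phi>) \<beta>)"
    unfolding trace_form_def
    by (rule sum.reindex_bij_witness[where i = "reflect \<alpha>" and j = "reflect \<alpha>"])
       (auto simp: reflect_involution cartan_int(2) \<alpha>)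
  also have "\<dots> = (\<Sum>\<phi>\<in>roots h. cartan_int \<alpha> \<beta> * (cartan_int \<phi> \<alpha> * cartan_int \<phi> \<alpha>)
                         - cartan_int \<phi> \<alpha> * cartan_int \<phi> \<beta>)"
    by (rule sum.cong) (auto simp: cartan_int_reflect cartan_int_self \<alpha> \<beta> algebra_simps)
  also have "\<dots> = cartan_int \<alpha> \<beta> * trace_form \<alpha> \<alpha> - trace_form \<alpha> \<beta>"
    by (simp add: trace_form_def sum_subtractf sum_distrib_left)
  finally show ?thesis by simp
qed

lemma trace_form_sym: "trace_form \<alpha> \<beta> = trace_form \<beta> \<alpha>"
  by (simp add: trace_form_def mult.commute)

lemma trace_form_pos:
  assumes \<alpha>: "\<alpha> \<in> roots h"
  shows "trace_form \<alpha> \<alpha> > 0"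
proof -
  have "0 < cartan_int \<alpha> \<alpha> * cartan_int \<alpha> \<alpha>" by (simp add: cartan_int_self \<alpha>)
  also have "\<dots> \<le> trace_form \<alpha> \<alpha>"
    unfolding trace_form_def by (rule member_le_sum[OF \<alpha>]) (simp_all add: finite_roots)
  finally show ?thesis .
qed

lemma trace_form_Cauchy_Schwarz: "(trace_form \<alpha> \<beta>)\<^sup>2 \<le> trace_form \<alpha> \<alpha> * trace_form \<beta> \<beta>"
proof -
  have "(\<Sum>\<phi>\<in>roots h. real_of_int (cartan_int \<phi> \<alpha>) * cartan_int \<phi> \<beta>)\<^sup>2
      \<le> (\<Sum>\<phi>\<in>roots h. (real_of_int (cartan_int \<phi> \<alpha>))\<^sup>2) * (\<Sum>\<phi>\<in>roots h. (real_of_int (cartan_int \<phi> \<beta>))\<^sup>2)"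
    by (rule Cauchy_Schwarz_ineq_sum)
  also have "\<dots> = real_of_int (trace_form \<alpha> \<alpha> * trace_form \<beta> \<beta>)"
    by (simp add: trace_form_def power2_eq_square)
  also have "(\<Sum>\<phi>\<in>roots h. real_of_int (cartan_int \<phi> \<alpha>) * cartan_int \<phi> \<beta>)\<^sup>2 = real_of_int ((trace_form \<alpha> \<beta>)\<^sup>2)"
    by (simp add: trace_form_def)
  finally show ?thesis by (simp only: of_int_le_iff)
qed

text \<open>By \<open>trace_form_proportional\<close> for both orders of \<open>\<alpha>\<close> and \<open>\<beta>\<close>, the product of the two Cartan integers
  is \<open>4 T(\<alpha>, \<beta>)\<^sup>2 / (T(\<alpha>, \<alpha>) T(\<beta>, \<beta>))\<close> for the trace form \<open>T\<close>.\<close>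

lemma cartan_int_product:
  assumes \<alpha>: "\<alpha> \<in> roots h" and \<beta>: "\<beta> \<in> roots h" and ne: "ip \<alpha> \<beta> \<noteq> 0"
  shows "cartan_int \<alpha> \<beta> * cartan_int \<beta> \<alpha> \<in> {1..4}"
proof -
  define n m where "n = cartan_int \<alpha> \<beta>" and "m = cartan_int \<beta> \<alpha>"
  define A B where "A = trace_form \<alpha> \<alpha>" and "B = trace_form \<beta> \<beta>"
  have AB: "A > 0" "B > 0" using trace_form_pos \<alpha> \<beta> by (auto simp: A_def B_def)
  have "n \<noteq> 0" using cartan_int(1)[OF \<beta> \<alpha>] ne by (auto simp: n_def)
  have 1: "2 * trace_form \<alpha> \<beta> = n * A"
    using trace_form_proportional[OF \<alpha> \<beta>] by (simp add: n_def A_def)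
  have 2: "2 * trace_form \<alpha> \<beta> = m * B"
    using trace_form_proportional[OF \<beta> \<alpha>] by (simp add: m_def B_def trace_form_sym)
  have eq: "(n * m) * (A * B) = 4 * (trace_form \<alpha> \<beta>)\<^sup>2"
  proof -
    have "(n * m) * (A * B) = (n * A) * (m * B)" by (simp add: mult_ac)
    also have "\<dots> = 4 * (trace_form \<alpha> \<beta>)\<^sup>2"
      unfolding 1[symmetric] 2[symmetric] by (simp add: power2_eq_square)
    finally show ?thesis .
  qed
  have "(n * m) * (A * B) \<le> 4 * (A * B)"
    unfolding eq using trace_form_Cauchy_Schwarz[of \<alpha> \<beta>] by (simp add: A_def B_def)
  then have "n * m \<le> 4" using AB by simp
  moreover have "trace_form \<alpha> \<beta> \<noteq> 0" using 1 \<open>n \<noteq> 0\<close> AB by auto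
  then have "0 < (n * m) * (A * B)" unfolding eq by simp
  then have "0 < n * m" using zero_less_mult_pos2[of "n * m" "A * B"] AB by simp
  ultimately show ?thesis by (simp add: n_def m_def)
qed

text \<open>The quotient of the squared lengths is \<open>n / m\<close> for the two Cartan integers, whose product lies
  between \<open>1\<close> and \<open>4\<close>. As \<open>\<bar>m\<bar> \<le> \<bar>n\<bar>\<close>, either \<open>m = \<plusminus> 1\<close> or \<open>n = m = \<plusminus> 2\<close>.\<close>

lemma long_multiple_of_short:
  assumes \<alpha>: "\<alpha> \<in> roots h" and \<beta>: "\<beta> \<in> roots h" and ne: "ip \<alpha> \<beta> \<noteq> 0"
    and le: "norm (ip \<alpha> \<alpha>) \<le> norm (ip \<beta> \<beta>)"
  shows "\<exists>t::nat. t \<ge> 1 \<and> ip \<beta> \<beta> = of_nat t * ip \<alpha> \<alpha>"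
proof -
  define n m where "n = cartan_int \<beta> \<alpha>" and "m = cartan_int \<alpha> \<beta>"
  have mn: "m * n \<in> {1..4}" using cartan_int_product[OF \<alpha> \<beta> ne] by (simp add: n_def m_def)
  have eq: "of_int n * ip \<alpha> \<alpha> = of_int m * ip \<beta> \<beta>"
    using cartan_int(1)[OF \<alpha> \<beta>] cartan_int(1)[OF \<beta> \<alpha>] ip_sym[of \<alpha> \<beta>] by (simp add: n_def m_def)
  have "norm (of_int m :: complex) * norm (ip \<beta> \<beta>) = norm (of_int n :: complex) * norm (ip \<alpha> \<alpha>)"
    by (simp only: norm_mult[symmetric] eq)
  also have "\<dots> \<le> norm (of_int n :: complex) * norm (ip \<beta> \<beta>)"
    by (rule mult_left_mono[OF le]) simp
  finally have "norm (of_int m :: complex) \<le> norm (of_int n :: complex)"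
    using root_anisotropic[OF \<beta>] by simp
  then have le': "\<bar>m\<bar> \<le> \<bar>n\<bar>" by simp
  have "\<exists>t::nat. t \<ge> 1 \<and> n = int t * m"
  proof -
    have "\<bar>m\<bar> * \<bar>n\<bar> \<le> 4" using mn by (simp flip: abs_mult)
    have "\<bar>m\<bar> \<le> 2"
    proof (rule ccontr)
      assume "\<not> \<bar>m\<bar> \<le> 2"
      then have "3 * 3 \<le> \<bar>m\<bar> * \<bar>n\<bar>" using le' by (intro mult_mono) auto
      then show False using \<open>\<bar>m\<bar> * \<bar>n\<bar> \<le> 4\<close> by simp
    qed
    then consider "m = 1" | "m = -1" | "m = 2" | "m = -2" | "m = 0" by linarith
    then show ?thesis
    proof cases
      case 1 then show ?thesis using mn by (intro exI[of _ "nat n"]) auto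
    next
      case 2 then show ?thesis using mn by (intro exI[of _ "nat (- n)"]) auto
    next
      case 3 then show ?thesis using mn le' by (intro exI[of _ 1]) auto
    next
      case 4 then show ?thesis using mn le' by (intro exI[of _ 1]) auto
    qed (use mn in auto)
  qed
  then obtain t :: nat where t: "t \<ge> 1" "n = int t * m" by blast
  have "m \<noteq> 0" using mn by auto
  moreover have "of_int m * (of_nat t * ip \<alpha> \<alpha>) = of_int m * ip \<beta> \<beta>"
    using eq t(2) by (simp add: mult_ac)
  ultimately show ?thesis using t(1) by auto
qed

text \<open>Irreducibility of the root system. The roots \<open>S\<close> that
  are not orthogonal to every root of the length of \<open>\<theta>\<close> are
  orthogonal to the remaining roots, because reflections preserve
  lengths. So the root spaces for \<open>S\<close> generate an ideal that commutes with the root spaces outside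
  \<open>S\<close>, and simplicity leaves no room for the latter.\<close>

lemma nonorthogonal_root_of_given_length:
  assumes \<theta>: "\<theta> \<in> roots h" and \<beta>: "\<beta> \<in> roots h"
  shows "\<exists>\<omega>\<in>roots h. ip \<omega> \<omega> = ip \<theta> \<theta> \<and> ip \<beta> \<omega> \<noteq> 0"
proof (rule ccontr)
  assume contra: "\<not> ?thesis"
  define \<Omega> where "\<Omega> = {\<omega>\<in>roots h. ip \<omega> \<omega> = ip \<theta> \<theta>}"
  define S where "S = {\<phi>\<in>roots h. \<exists>\<omega>\<in>\<Omega>. ip \<phi> \<omega> \<noteq> 0}"
  have S: "\<phi> \<in> roots h" if "\<phi> \<in> S" for \<phi> using that by (simp add: S_def)
  have \<beta>S: "\<beta> \<notin> S" using contra by (auto simp: S_def \<Omega>_def)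
  have \<theta>S: "\<theta> \<in> S" using \<theta> root_anisotropic[OF \<theta>] by (auto simp: S_def \<Omega>_def)
  have orth: "ip \<phi> \<psi> = 0" if \<phi>: "\<phi> \<in> S" and \<psi>: "\<psi> \<in> roots h" "\<psi> \<notin> S" for \<phi> \<psi>
  proof (rule ccontr)
    assume ne: "ip \<phi> \<psi> \<noteq> 0"
    obtain \<omega> where \<omega>: "\<omega> \<in> roots h" "ip \<omega> \<omega> = ip \<theta> \<theta>" "ip \<phi> \<omega> \<noteq> 0"
      using \<phi> by (auto simp: S_def \<Omega>_def)
    have "reflect \<phi> \<omega> \<in> \<Omega>"
      using \<omega> reflect_isometry cartan_int(2) S[OF \<phi>] by (simp add: \<Omega>_def)
    then have "ip (reflect \<phi> \<omega>) \<psi> = 0" using \<psi> by (auto simp: S_def ip_sym)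
    moreover have "ip \<omega> \<psi> = 0" using \<psi> \<omega> by (auto simp: S_def \<Omega>_def ip_sym)
    ultimately have "cartan_int \<omega> \<phi> = 0"
      using ip_reflect[OF S[OF \<phi>] \<omega>(1) \<psi>(1)] ne by simp
    then show False using cartan_int(1)[OF S[OF \<phi>] \<omega>(1)] \<omega>(3) by (simp add: ip_sym)
  qed
  (* X spans the ideal generated by the root spaces for S; the representing vectors of the roots
     in S are the brackets of opposite root vectors. *)
  define X where "X = (\<Union>\<phi>\<in>S. root_space h \<phi>) \<union> dual_vec h \<kappa> ` S"
  have sum_cases: "(\<lambda>y. \<psi> y + \<phi> y) = (\<lambda>_. 0) \<or> (\<lambda>y. \<psi> y + \<phi> y) \<in> roots h"
    if "\<phi> \<in> roots h" "\<psi> \<in> roots h" "x \<in> root_space h \<psi>" "z \<in> root_space h \<phi>" "br x z \<noteq> 0" for \<phi> \<psi> x z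
    using root_space_cases[OF dual_add[OF root_in_dual root_in_dual] root_space_bracket] that by blast
  have ip_sum: "ip (\<lambda>y. \<psi> y + \<phi> y) \<chi> = ip \<psi> \<chi> + ip \<phi> \<chi>"
    if "\<phi> \<in> roots h" "\<psi> \<in> roots h" "\<chi> \<in> roots h" "(\<lambda>y. \<psi> y + \<phi> y) \<in> roots h" for \<phi> \<psi> \<chi>
    using that by (simp add: ip_eval)
  have commute: "br x z = 0" if \<psi>: "\<psi> \<in> roots h" "\<psi> \<notin> S" and x: "x \<in> root_space h \<psi>" and z: "z \<in> X" for x z \<psi>
  proof -
    consider \<phi> where "\<phi> \<in> S" "z \<in> root_space h \<phi>" | \<phi> where "\<phi> \<in> S" "z = dual_vec h \<kappa> \<phi>"
      using z by (auto simp: X_def)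
    then show ?thesis
    proof cases
      case 1
      show ?thesis
      proof (rule ccontr)
        assume "br x z \<noteq> 0"
        then consider "(\<lambda>y. \<psi> y + \<phi> y) = (\<lambda>_. 0)" | "(\<lambda>y. \<psi> y + \<phi> y) \<in> roots h"
          using sum_cases[OF S[OF 1(1)] \<psi>(1) x 1(2)] by blast
        then show False
        proof cases
          case 1
          then have "\<psi> y = - \<phi> y" for y by (simp add: fun_eq_iff eq_neg_iff_add_eq_0)
          then have "\<psi> = (\<lambda>y. - \<phi> y)" by (simp add: fun_eq_iff)
          then show False
            using orth[OF \<open>\<phi> \<in> S\<close> \<psi>] ip_uminus_right[OF S[OF \<open>\<phi> \<in> S\<close>] S[OF \<open>\<phi> \<in> S\<close>]]
              root_anisotropic[OF S[OF \<open>\<phi> \<in> S\<close>]] by simp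
        next
          case 2
          note \<phi> = S[OF \<open>\<phi> \<in> S\<close>] and 0 = orth[OF \<open>\<phi> \<in> S\<close> \<psi>]
          show False
          proof (cases "(\<lambda>y. \<psi> y + \<phi> y) \<in> S")
            case True
            have "ip \<psi> \<psi> = 0" using orth[OF True \<psi>] ip_sum[OF \<phi> \<psi>(1) \<psi>(1) 2] 0 by simp
            then show False using root_anisotropic \<psi>(1) by blast
          next
            case False
            have "ip \<phi> \<phi> = 0"
              using orth[OF \<open>\<phi> \<in> S\<close> 2 False] ip_sum[OF \<phi> \<psi>(1) \<phi> 2] 0 by (simp add: ip_sym)
            then show False using root_anisotropic \<phi> by blast
          qed
        qed
      qed
    next
      case 2
      have "ip \<psi> \<phi> = 0" using orth[OF 2(1) \<psi>] by (simp add: ip_sym)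
      then have "\<psi> z = 0" using ip_eval[OF \<psi>(1) S[OF 2(1)]] 2(2) by simp
      then have "br z x = 0"
        using root_spaceD[OF x dual_vec_root(1)[OF S[OF 2(1)]]] 2(2) by simp
      then show ?thesis using br_skew[of x z] by simp
    qed
  qed
  have stable: "br x z \<in> span X" if \<psi>: "\<psi> \<in> dual h" and x: "x \<in> root_space h \<psi>" and z: "z \<in> X" for x z \<psi>
  proof (cases "br x z = 0")
    case True
    then show ?thesis by (simp add: span_zero)
  next
    case False
    then have "x \<noteq> 0" by auto
    then consider "\<psi> = (\<lambda>_. 0)" | "\<psi> \<in> roots h" using root_space_cases[OF \<psi> x] by blast
    then show ?thesis
    proof cases
      case 1
      then have xh: "x \<in> h" using x root_space_zero by simp
      then have "z \<notin> h" using False abelian_h by blast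
      then obtain \<phi> where "\<phi> \<in> S" "z \<in> root_space h \<phi>"
        using z dual_vec_root(1) S by (auto simp: X_def)
      then have "br x z = scale (\<phi> x) z" "z \<in> X" using root_spaceD xh by (auto simp: X_def)
      then show ?thesis by (simp add: span_base span_scale)
    next
      case 2
      then have \<psi>S: "\<psi> \<in> S" using commute[OF _ _ x z] False by blast
      have xX: "x \<in> span X" using x \<psi>S by (auto simp: X_def intro: span_base)
      consider \<phi> where "\<phi> \<in> S" "z \<in> root_space h \<phi>" | \<phi> where "\<phi> \<in> S" "z = dual_vec h \<kappa> \<phi>"
        using z by (auto simp: X_def)
      then show ?thesis
      proof cases
        case (1 \<phi>)
        note \<phi> = S[OF 1(1)]
        consider "(\<lambda>y. \<psi> y + \<phi> y) = (\<lambda>_. 0)" | "(\<lambda>y. \<psi> y + \<phi> y) \<in> roots h"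
          using sum_cases[OF \<phi> 2 x 1(2) False] by blast
        then show ?thesis
        proof cases
          case neg: 1
          then have "\<phi> y = - \<psi> y" for y by (simp add: fun_eq_iff eq_neg_iff_add_eq_0 add.commute)
          then have z': "z \<in> root_space h (\<lambda>y. - \<psi> y)" using 1(2) by (simp add: root_space_def)
          have "br x z - scale (\<kappa> x z) (dual_vec h \<kappa> \<psi>) = 0"
          proof (rule form_nondegenerate_h)
            show "br x z - scale (\<kappa> x z) (dual_vec h \<kappa> \<psi>) \<in> h"
              using bracket_opposite(1)[OF x z'] dual_vec_root(1)[OF 2] subspace_h
              by (simp add: subspace_diff subspace_scale)
            show "\<kappa> (br x z - scale (\<kappa> x z) (dual_vec h \<kappa> \<psi>)) y = 0" if "y \<in> h" for y
              using bracket_opposite(2)[OF x z' that] dual_vec_root(2)[OF 2 that]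
              by (simp add: form_diff_left form_scale_left)
          qed
          then have "br x z = scale (\<kappa> x z) (dual_vec h \<kappa> \<psi>)" by simp
          then show ?thesis using \<psi>S by (auto simp: X_def intro: span_base span_scale)
        next
          case sum: 2
          have "(\<lambda>y. \<psi> y + \<phi> y) \<in> S"
          proof (rule ccontr)
            assume n: "(\<lambda>y. \<psi> y + \<phi> y) \<notin> S"
            have "ip (\<lambda>y. \<psi> y + \<phi> y) (\<lambda>y. \<psi> y + \<phi> y) = 0"
              using orth[OF \<psi>S sum n] orth[OF 1(1) sum n] ip_sum[OF \<phi> 2 sum sum] by simp
            then show False using root_anisotropic[OF sum] by blast
          qed
          then show ?thesis
            using root_space_bracket[OF x 1(2)] by (auto simp: X_def intro: span_base)
        qed
      next
        case (2 \<phi>)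
        then have "br z x = scale (\<psi> z) x"
          using root_spaceD[OF x dual_vec_root(1)[OF S]] by simp
        then have "br x z = - scale (\<psi> z) x" using br_skew[of x z] by simp
        then show ?thesis using xX by (simp add: span_neg span_scale)
      qed
    qed
  qed
  have stable': "br x z \<in> span X" if z: "z \<in> X" for x z
  proof -
    have "(\<Union>\<psi>\<in>dual h. root_space h \<psi>) \<subseteq> {x. br x z \<in> span X}" using stable z by blast
    moreover have "subspace {x. br x z \<in> span X}"
      by (rule subspaceI) (simp_all add: br_add_left br_scale_left span_add span_scale span_zero)
    ultimately have "span (\<Union>\<psi>\<in>dual h. root_space h \<psi>) \<subseteq> {x. br x z \<in> span X}"
      by (rule span_minimal)
    then show ?thesis using root_spaces_span by auto
  qed
  have "ideal (span X)"
    unfolding ideal_def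
  proof (intro conjI allI ballI)
    fix x z assume z: "z \<in> span X"
    have "X \<subseteq> {z. br x z \<in> span X}" using stable' by blast
    moreover have "subspace {z. br x z \<in> span X}"
      by (rule subspaceI) (simp_all add: br_add_right br_scale_right span_add span_scale span_zero)
    ultimately have "span X \<subseteq> {z. br x z \<in> span X}" by (rule span_minimal)
    then show "br x z \<in> span X" using z by blast
  qed simp
  then have "span X = {0} \<or> span X = UNIV" by (rule simple)
  moreover obtain e where "e \<in> root_space h \<theta>" "e \<noteq> 0" using root_vector_exists[OF \<theta>] by blast
  then have "e \<in> span X" "e \<noteq> 0" using \<theta>S by (auto simp: X_def intro: span_base)
  ultimately have UNIV: "span X = UNIV" by auto
  obtain b where b: "b \<in> root_space h \<beta>" "b \<noteq> 0" using root_vector_exists[OF \<beta>] by blast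
  have "X \<subseteq> {z. br b z = 0}" using commute[OF \<beta> \<beta>S b(1)] by blast
  moreover have "subspace {z. br b z = 0}"
    by (rule subspaceI) (simp_all add: br_add_right br_scale_right)
  ultimately have "span X \<subseteq> {z. br b z = 0}" by (rule span_minimal)
  then have "br b z = 0" for z using UNIV by auto
  then have "b = 0" by (rule center_trivial)
  then show False using b(2) by simp
qed

text \<open>A root \<open>\<omega>\<close> of maximal length not orthogonal to \<open>\<beta>\<close> has \<open>(\<omega>|\<omega>) = 2\<close> by normalization, and \<open>2\<close> is
  then an integral multiple of \<open>(\<beta>|\<beta>)\<close>.\<close>

lemma normalized_root_length:
  assumes norm: "normalized_form h \<kappa>" and \<beta>: "\<beta> \<in> roots h"
  shows "\<exists>t::nat. t \<ge> 1 \<and> of_nat t * ip \<beta> \<beta> = 2"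
proof -
  let ?L = "(\<lambda>\<phi>. norm (ip \<phi> \<phi>)) ` roots h"
  have L: "finite ?L" "?L \<noteq> {}" using finite_roots \<beta> by auto
  obtain \<theta> where \<theta>: "\<theta> \<in> roots h" "norm (ip \<theta> \<theta>) = Max ?L"
    using Max_in[OF L] by auto
  have max: "norm (ip \<psi> \<psi>) \<le> norm (ip \<theta> \<theta>)" if "\<psi> \<in> roots h" for \<psi>
    unfolding \<theta>(2) using L(1) that by (intro Max_ge) auto
  then have "\<theta> \<in> long_roots h \<kappa>" using \<theta>(1) by (simp add: long_roots_def)
  then have two: "ip \<theta> \<theta> = 2" using norm by (simp add: normalized_form_def)
  obtain \<omega> where \<omega>: "\<omega> \<in> roots h" "ip \<omega> \<omega> = ip \<theta> \<theta>" "ip \<beta> \<omega> \<noteq> 0"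
    using nonorthogonal_root_of_given_length[OF \<theta>(1) \<beta>] by blast
  have "norm (ip \<beta> \<beta>) \<le> norm (ip \<omega> \<omega>)" using max[OF \<beta>] \<omega>(2) by simp
  then obtain t :: nat where "t \<ge> 1" "ip \<omega> \<omega> = of_nat t * ip \<beta> \<beta>"
    using long_multiple_of_short[OF \<beta> \<omega>(1,3)] by blast
  then show ?thesis using \<omega>(2) two by auto
qed

end

text \<open>The properties of the Gram matrix of the simple roots on which the power series identities
  rest. They make all exponents of the Q-system and all numbers \<open>P\<^sub>m\<^sup>(\<^sup>a\<^sup>)\<close> integers: each value
  \<open>min (t\<^sub>b m) (t\<^sub>a k)\<close> is a multiple of \<open>t\<^sub>a\<close> or of \<open>t\<^sub>b\<close>.\<close>

locale integral_gram =
  fixes g :: "'i::finite \<Rightarrow> 'i \<Rightarrow> complex" and t :: "'i \<Rightarrow> nat"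
  assumes g_sym: "g a b = g b a"
    and t_pos: "t a \<ge> 1"
    and t_g: "of_nat (t a) * g a a = 2"
    and integral: "g a b * of_nat (t b) \<in> \<int>"

lemma integral_gram_simple_roots:
  fixes scale :: "complex \<Rightarrow> 'g::ab_group_add \<Rightarrow> 'g"
    and \<alpha> :: "'i::finite \<Rightarrow> 'g \<Rightarrow> complex"
  assumes "simple_lie_algebra scale br"
    and "lie_algebra.cartan_subalgebra scale br h"
    and norm: "lie_algebra.normalized_form scale br h \<kappa>"
    and simple_roots: "lie_algebra.simple_roots scale br h \<alpha>"
    and g: "\<And>a b. g a b = lie_algebra.dual_form h \<kappa> (\<alpha> a) (\<alpha> b)"
  shows "\<exists>t. integral_gram g t"
proof -
  interpret simple_lie_algebra scale br by fact
  interpret simple_lie_algebra_with_form scale br h \<kappa>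
    by unfold_locales (use assms(2) norm in \<open>auto simp: normalized_form_def\<close>)
  have \<alpha>: "\<alpha> a \<in> roots h" for a using simple_roots by (simp add: simple_roots_def)
  have "\<forall>a. \<exists>t::nat. t \<ge> 1 \<and> of_nat t * g a a = 2"
    using normalized_root_length[OF norm \<alpha>] by (simp add: g)
  then obtain t :: "'i \<Rightarrow> nat" where t: "\<And>a. t a \<ge> 1" "\<And>a. of_nat (t a) * g a a = 2" by metis
  have "integral_gram g t"
  proof
    show "g a b = g b a" for a b by (simp add: g ip_sym)
    show "g a b * of_nat (t b) \<in> \<int>" for a b
    proof -
      have "g a b * of_nat (t b) = (2 * ip (\<alpha> a) (\<alpha> b)) * of_nat (t b) / 2" by (simp add: g)
      also have "\<dots> = of_int (cartan_int (\<alpha> a) (\<alpha> b)) * (of_nat (t b) * g b b) / 2"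
        unfolding cartan_int(1)[OF \<alpha> \<alpha>] by (simp add: g)
      also have "\<dots> = of_int (cartan_int (\<alpha> a) (\<alpha> b))" by (simp add: t)
      finally show ?thesis by simp
    qed
  qed (rule t)+
  then show ?thesis by blast
qed

section \<open>The ring of power series: precision, units, monomials\<close>

lemma mcoeff_simps [simp]:
  "mcoeff 0 e = 0" "mcoeff (f + g) e = mcoeff f e + mcoeff g e"
  "mcoeff (f - g) e = mcoeff f e - mcoeff g e" "mcoeff (- f) e = - mcoeff f e"
  "mcoeff 1 e = (if e = {#} then 1 else 0)"
  "mcoeff (mfps_const c) e = (if e = {#} then c else 0)"
  by (simp_all add: zero_mfps.rep_eq plus_mfps.rep_eq minus_mfps.rep_eq uminus_mfps.rep_eq
      one_mfps.rep_eq mfps_const.rep_eq)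

lemma mcoeff_sum [simp]: "mcoeff (sum f A) e = (\<Sum>x\<in>A. mcoeff (f x) e)"
  by (induction A rule: infinite_finite_induct) auto

lemma mcoeff_mult: "mcoeff (f * g) e = (\<Sum>d | d \<subseteq># e. mcoeff f d * mcoeff g (e - d))"
  by (simp add: times_mfps.rep_eq)

lemma mcoeff_mult_const_term [simp]: "mcoeff (f * g) {#} = mcoeff f {#} * mcoeff g {#}"
  by (simp add: mcoeff_mult)

lemma mcoeff_power_const_term [simp]: "mcoeff (f ^ n) {#} = mcoeff f {#} ^ n"
  by (induction n) simp_all

text \<open>Congruence modulo all monomials of degree at least \<open>n\<close>; these relations generate the topology.\<close>

definition agree :: "nat \<Rightarrow> ('i, 'c::comm_ring_1) mfps \<Rightarrow> ('i, 'c) mfps \<Rightarrow> bool" where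
  "agree n f g \<longleftrightarrow> (\<forall>e. size e < n \<longrightarrow> mcoeff f e = mcoeff g e)"

lemma agree_refl [simp]: "agree n f f"
  and agree_sym: "agree n f g \<Longrightarrow> agree n g f"
  and agree_trans: "agree n f g \<Longrightarrow> agree n g k \<Longrightarrow> agree n f k"
  and agree_diff: "agree n f g \<Longrightarrow> agree n f' g' \<Longrightarrow> agree n (f - f') (g - g')"
  by (auto simp: agree_def)

lemma agree_mult:
  assumes "agree n f g" "agree n f' g'"
  shows "agree n (f * f') (g * g')"
  unfolding agree_def mcoeff_mult
proof (intro allI impI)
  fix e :: "'a multiset" assume e: "size e < n"
  show "(\<Sum>d | d \<subseteq># e. mcoeff f d * mcoeff f' (e - d)) = (\<Sum>d | d \<subseteq># e. mcoeff g d * mcoeff g' (e - d))"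
  proof (rule sum.cong[OF refl])
    fix d assume "d \<in> {d. d \<subseteq># e}"
    then have "size d < n" "size (e - d) < n"
      using e size_mset_mono[of d e] size_mset_mono[of "e - d" e] by auto
    then show "mcoeff f d * mcoeff f' (e - d) = mcoeff g d * mcoeff g' (e - d)"
      using assms by (simp add: agree_def)
  qed
qed

text \<open>Multiplication by a series without constant term gains one degree of precision.\<close>

lemma agree_Suc_mult:
  assumes "agree n f g" "mcoeff w {#} = 0"
  shows "agree (Suc n) (w * f) (w * g)"
  unfolding agree_def mcoeff_mult
proof (intro allI impI)
  fix e :: "'a multiset" assume e: "size e < Suc n"
  show "(\<Sum>d | d \<subseteq># e. mcoeff w d * mcoeff f (e - d)) = (\<Sum>d | d \<subseteq># e. mcoeff w d * mcoeff g (e - d))"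
  proof (rule sum.cong[OF refl])
    fix d assume d: "d \<in> {d. d \<subseteq># e}"
    show "mcoeff w d * mcoeff f (e - d) = mcoeff w d * mcoeff g (e - d)"
    proof (cases "d = {#}")
      case False
      then have "size (e - d) < n"
        using d e by (simp add: size_Diff_submset) (metis One_nat_def Suc_leI diff_less e leD leI less_le_trans
          nonempty_has_size not_less_eq size_mset_mono)
      then show ?thesis using assms(1) by (simp add: agree_def)
    qed (simp add: assms(2))
  qed
qed

lemma agree_power: "agree n f g \<Longrightarrow> agree n (f ^ k) (g ^ k)"
  by (induction k) (auto intro: agree_mult)

lemma agree_prod: "(\<And>x. x \<in> A \<Longrightarrow> agree n (f x) (g x)) \<Longrightarrow> agree n (prod f A) (prod g A)"
  by (induction A rule: infinite_finite_induct) (auto intro: agree_mult)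

lemma agree_eqI: "(\<And>n. agree n f g) \<Longrightarrow> f = g"
  by (rule mfps_eqI) (auto simp: agree_def)

lemma mult_inverse_mfps:
  fixes f :: "('i, 'c::comm_ring_1) mfps"
  assumes "f dvd 1"
  shows "f * inverse f = 1"
proof -
  obtain g where g: "1 = f * g" using assms by (rule dvdE)
  have "(THE g. f * g = 1) = g"
  proof (rule the_equality)
    show "k = g" if "f * k = 1" for k
    proof -
      have "k = (f * g) * k" by (simp flip: g)
      also have "\<dots> = (f * k) * g" by (simp only: mult_ac)
      finally show ?thesis by (simp add: that)
    qed
  qed (simp add: g)
  then show ?thesis using assms g by (simp add: inverse_mfps_def)
qed

lemma inverse_mfps_eqI:
  fixes f :: "('i, 'c::comm_ring_1) mfps"
  assumes "f * g = 1"
  shows "inverse f = g"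
proof -
  have "f dvd 1" using assms by (metis dvd_triv_left)
  then have "g = (f * inverse f) * g" by (simp add: mult_inverse_mfps)
  also have "\<dots> = inverse f * (f * g)" by (simp add: mult_ac)
  finally show ?thesis by (simp add: assms)
qed

lemma agree_inverse:
  assumes "agree n f g" "f dvd 1" "g dvd 1"
  shows "agree n (inverse f) (inverse g)"
proof -
  have "agree n (inverse f * g * inverse g) (inverse f * f * inverse g)"
    by (rule agree_mult[OF agree_mult[OF agree_refl agree_sym[OF assms(1)]] agree_refl])
  moreover have "inverse f * g * inverse g = inverse f"
    by (simp add: mult.assoc mult_inverse_mfps assms)
  moreover have "inverse f * f * inverse g = inverse g"
    using mult_inverse_mfps[OF assms(2)] by (simp add: mult.commute)
  ultimately show ?thesis by simp
qed

lemma agree_power_int: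
  assumes "agree n f g" "f dvd 1" "g dvd 1"
  shows "agree n (f powi k) (g powi k)"
  using assms by (auto simp: power_int_def intro: agree_power agree_inverse)

lemma mcoeff_power_small:
  assumes "mcoeff f {#} = 0" "size e < n"
  shows "mcoeff (f ^ n) e = 0"
proof -
  have "agree n (f ^ n) 0" for n
  proof (induction n)
    case (Suc n)
    show ?case using agree_Suc_mult[OF Suc assms(1)] by simp
  qed (simp add: agree_def)
  then show ?thesis using assms(2) by (simp add: agree_def)
qed

text \<open>The inverse is the geometric series in \<open>1 - f\<close>.\<close>

lemma unit_if_const_term_one:
  fixes f :: "('i, 'c::comm_ring_1) mfps"
  assumes "mcoeff f {#} = 1"
  shows "f dvd 1"
proof -
  define k where "k = 1 - f"
  define g where "g = Abs_mfps (\<lambda>e. \<Sum>n\<le>size e. mcoeff (k ^ n) e)"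
  have k0: "mcoeff k {#} = 0" using assms by (simp add: k_def)
  have g: "mcoeff g e = (\<Sum>n\<le>size e. mcoeff (k ^ n) e)" for e
    by (simp add: g_def Abs_mfps_inverse)
  have trunc: "agree (Suc m) g (\<Sum>n\<le>m. k ^ n)" for m
    unfolding agree_def
  proof (intro allI impI)
    fix e :: "'i multiset" assume "size e < Suc m"
    then have "(\<Sum>n\<le>size e. mcoeff (k ^ n) e) = (\<Sum>n\<le>m. mcoeff (k ^ n) e)"
      by (intro sum.mono_neutral_left) (auto intro: mcoeff_power_small k0)
    then show "mcoeff g e = mcoeff (\<Sum>n\<le>m. k ^ n) e" by (simp add: g)
  qed
  have "f * g = 1"
  proof (rule mfps_eqI)
    fix e :: "'i multiset"
    have "agree (Suc (size e)) (f * g) (f * (\<Sum>n\<le>size e. k ^ n))"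
      by (intro agree_mult agree_refl trunc)
    then have "mcoeff (f * g) e = mcoeff ((1 - k) * (\<Sum>n\<le>size e. k ^ n)) e"
      by (simp add: agree_def k_def)
    also have "\<dots> = mcoeff (1 - k ^ Suc (size e)) e" by (simp only: sum_gp_basic)
    also have "\<dots> = mcoeff 1 e" using mcoeff_power_small[OF k0, of e "Suc (size e)"] by simp
    finally show "mcoeff (f * g) e = mcoeff 1 e" .
  qed
  then show ?thesis by (metis dvd_triv_left)
qed

lift_definition monom :: "'i multiset \<Rightarrow> ('i, 'c::comm_ring_1) mfps"
  is "\<lambda>u e. if e = u then 1 else 0" .

lemma mcoeff_monom: "mcoeff (monom u) e = (if e = u then 1 else 0)"
  by (simp add: monom.rep_eq)

lemma mcoeff_monom_mult:
  "mcoeff (monom u * f) e = (if u \<subseteq># e then mcoeff f (e - u) else 0)"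
proof -
  have "mcoeff (monom u * f) e = (\<Sum>d | d \<subseteq># e. if d = u then mcoeff f (e - u) else 0)"
    unfolding mcoeff_mult by (rule sum.cong) (auto simp: mcoeff_monom)
  then show ?thesis by (simp add: finite_submultisets)
qed

lemma mcoeff_const_mult_monom: "mcoeff (mfps_const c * monom u) e = (if e = u then c else 0)"
  by (subst mult.commute) (auto simp: mcoeff_monom_mult subset_mset.diff_add Diff_eq_empty_iff_mset subset_mset.antisym)

lemma monom_add: "monom (u + v) = monom u * monom v"
proof (rule mfps_eqI)
  fix e
  have "e = u + v \<longleftrightarrow> u \<subseteq># e \<and> e - u = v" by (metis add_diff_cancel_left' mset_subset_eq_add_left subset_mset.add_diff_inverse)
  then show "mcoeff (monom (u + v)) e = mcoeff (monom u * monom v) e"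
    by (auto simp: mcoeff_monom_mult mcoeff_monom)
qed

lemma monom_0: "monom {#} = 1"
  by (rule mfps_eqI) (simp add: mcoeff_monom)

lemma monom_sum: "monom (sum f A) = (\<Prod>x\<in>A. monom (f x))"
  by (induction A rule: infinite_finite_induct) (simp_all add: monom_0 monom_add)

lemma mfps_var_power:
  fixes a :: 'i
  shows "(mfps_var a :: ('i, 'c::comm_ring_1) mfps) ^ n = monom (replicate_mset n a)"
proof (induction n)
  case 0
  then show ?case by (simp add: monom_0)
next
  case (Suc n)
  have "(mfps_var a :: ('i, 'c) mfps) ^ Suc n = mfps_var a * monom (replicate_mset n a)"
    by (simp only: power_Suc Suc)
  also have "\<dots> = monom {#a#} * monom (replicate_mset n a)"
    by (rule arg_cong[where f = "\<lambda>v. v * _"], rule mfps_eqI) (simp add: mfps_var.rep_eq mcoeff_monom)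
  also have "\<dots> = monom ({#a#} + replicate_mset n a)" by (simp only: monom_add)
  finally show ?case by simp
qed

lemma tendsto_mfps_iff:
  fixes X :: "'b \<Rightarrow> ('i, 'c::comm_ring_1) mfps"
  shows "(X \<longlongrightarrow> L) F \<longleftrightarrow> (\<forall>n. \<forall>\<^sub>F m in F. agree n (X m) L)"
proof
  assume lim: "(X \<longlongrightarrow> L) F"
  show "\<forall>n. \<forall>\<^sub>F m in F. agree n (X m) L"
  proof
    fix n
    have "open {f. agree n f L}"
      unfolding open_mfps_def by (intro ballI exI[of _ n]) (auto simp: agree_def)
    then have "\<forall>\<^sub>F m in F. X m \<in> {f. agree n f L}"
      by (rule topological_tendstoD[OF lim]) simp
    then show "\<forall>\<^sub>F m in F. agree n (X m) L" by simp
  qed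
next
  assume ev: "\<forall>n. \<forall>\<^sub>F m in F. agree n (X m) L"
  show "(X \<longlongrightarrow> L) F"
  proof (rule topological_tendstoI)
    fix U assume "open U" "L \<in> U"
    then obtain n where "\<forall>f. agree n f L \<longrightarrow> f \<in> U"
      unfolding open_mfps_def agree_def by blast
    moreover have "\<forall>\<^sub>F m in F. agree n (X m) L" using ev by blast
    ultimately show "\<forall>\<^sub>F m in F. X m \<in> U" by (auto elim: eventually_mono)
  qed
qed

section \<open>Determinants over a finite index set\<close>

lemma det_on_column_sum:
  assumes S: "finite S" and j: "j \<in> S"
    and col: "\<And>i. i \<in> S \<Longrightarrow> A i j = B i j + C i j"
    and B: "\<And>i k. i \<in> S \<Longrightarrow> k \<in> S \<Longrightarrow> k \<noteq> j \<Longrightarrow> B i k = A i k"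
    and C: "\<And>i k. i \<in> S \<Longrightarrow> k \<in> S \<Longrightarrow> k \<noteq> j \<Longrightarrow> C i k = A i k"
  shows "det_on S A = det_on S B + det_on S C"
proof -
  have "(\<Prod>i\<in>S. A i (p i)) = (\<Prod>i\<in>S. B i (p i)) + (\<Prod>i\<in>S. C i (p i))" if p: "p permutes S" for p
  proof -
    define k where "k = inv p j"
    have k: "k \<in> S" "p k = j"
      using p j by (auto simp: k_def permutes_in_image[OF permutes_inv[OF p]] permutes_inverses)
    have pi: "p i \<in> S" "p i \<noteq> j" if "i \<in> S - {k}" for i
      using that k p by (auto simp: permutes_in_image dest: permutes_inj injD)
    have "(\<Prod>i\<in>S - {k}. B i (p i)) = (\<Prod>i\<in>S - {k}. A i (p i))"
         "(\<Prod>i\<in>S - {k}. C i (p i)) = (\<Prod>i\<in>S - {k}. A i (p i))"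
      using pi B C by (auto intro!: prod.cong)
    then show ?thesis
      using prod.remove[OF S k(1), of "\<lambda>i. A i (p i)"] prod.remove[OF S k(1), of "\<lambda>i. B i (p i)"]
        prod.remove[OF S k(1), of "\<lambda>i. C i (p i)"] col[OF k(1)] k(2)
      by (simp add: distrib_right)
  qed
  then show ?thesis by (simp add: det_on_def distrib_left sum.distrib)
qed

lemma det_on_cong:
  assumes "\<And>i j. i \<in> S \<Longrightarrow> j \<in> S \<Longrightarrow> A i j = B i j"
  shows "det_on S A = det_on S B"
  unfolding det_on_def
  by (rule sum.cong[OF refl], rule arg_cong2[where f = "(*)", OF refl], rule prod.cong)
     (use assms in \<open>auto simp: permutes_in_image\<close>)

text \<open>Composing all permutations with the transposition of \<open>j\<close> and \<open>k\<close> shows that the determinant equals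
  its own negative.\<close>

lemma det_on_equal_columns:
  fixes A :: "'a \<Rightarrow> 'a \<Rightarrow> 'c::{idom, ring_char_0}"
  assumes S: "finite S" and jk: "j \<in> S" "k \<in> S" "j \<noteq> k" and eq: "\<And>i. i \<in> S \<Longrightarrow> A i j = A i k"
  shows "det_on S A = 0"
proof -
  let ?\<tau> = "Transposition.transpose j k"
  have \<tau>: "?\<tau> permutes S" using permutes_swap_id jk by metis
  have perm: "?\<tau> \<circ> p permutes S" if "p permutes S" for p
    using permutes_compose[OF that \<tau>] .
  have "det_on S A = (\<Sum>p | p permutes S. of_int (sign (?\<tau> \<circ> p)) * (\<Prod>i\<in>S. A i ((?\<tau> \<circ> p) i)))"
    unfolding det_on_def
    by (rule sum.reindex_bij_witness[where i = "\<lambda>p. ?\<tau> \<circ> p" and j = "\<lambda>p. ?\<tau> \<circ> p"])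
       (auto simp: perm comp_assoc[symmetric])
  also have "\<dots> = (\<Sum>p | p permutes S. - (of_int (sign p) * (\<Prod>i\<in>S. A i (p i))))"
  proof (rule sum.cong[OF refl])
    fix p assume "p \<in> {p. p permutes S}"
    then have p: "p permutes S" by simp
    have "sign (?\<tau> \<circ> p) = - sign p"
      using sign_compose[of ?\<tau> p] permutes_imp_permutation[OF S p] permutes_imp_permutation[OF S \<tau>] jk(3)
      by (simp add: sign_swap_id)
    moreover have "(\<Prod>i\<in>S. A i ((?\<tau> \<circ> p) i)) = (\<Prod>i\<in>S. A i (p i))"
      by (rule prod.cong[OF refl]) (auto simp: Transposition.transpose_def eq)
    ultimately show "of_int (sign (?\<tau> \<circ> p)) * (\<Prod>i\<in>S. A i ((?\<tau> \<circ> p) i)) =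
        - (of_int (sign p) * (\<Prod>i\<in>S. A i (p i)))" by simp
  qed
  also have "\<dots> = - det_on S A" by (simp add: det_on_def sum_negf)
  finally have "2 * det_on S A = 0" by (simp add: eq_neg_iff_add_eq_0)
  then show ?thesis by simp
qed

lemma det_on_zero_column:
  assumes "finite S" "j \<in> S" "\<And>i. i \<in> S \<Longrightarrow> A i j = 0"
  shows "det_on S A = 0"
proof -
  have "det_on S A = det_on S A + det_on S A"
    by (rule det_on_column_sum[OF assms(1,2)]) (simp_all add: assms(3))
  then show ?thesis by simp
qed

text \<open>The vector of ones is in the kernel. In terms of columns: replacing the column \<open>j\<close> by the sum of the
  other columns gives determinant zero, and by assumption this sum is the negative of the column \<open>j\<close>.\<close>

lemma det_on_zero_row_sums:
  fixes A :: "'a \<Rightarrow> 'a \<Rightarrow> 'c::{idom, ring_char_0}"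
  assumes S: "finite S" "S \<noteq> {}" and rows: "\<And>i. i \<in> S \<Longrightarrow> (\<Sum>j\<in>S. A i j) = 0"
  shows "det_on S A = 0"
proof -
  obtain j where j: "j \<in> S" using S(2) by blast
  have repl: "det_on S (\<lambda>i l. if l = j then \<Sum>k\<in>T. A i k else A i l) = 0" if "T \<subseteq> S - {j}" for T
    using finite_subset[OF that finite_Diff[OF S(1)]] that
  proof (induction T)
    case empty
    show ?case by (rule det_on_zero_column[OF S(1) j]) simp
  next
    case (insert k T)
    have "det_on S (\<lambda>i l. if l = j then \<Sum>k\<in>insert k T. A i k else A i l) =
        det_on S (\<lambda>i l. if l = j then A i k else A i l) +
        det_on S (\<lambda>i l. if l = j then \<Sum>k\<in>T. A i k else A i l)"
      by (rule det_on_column_sum[OF S(1) j]) (use insert.hyps in auto)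
    also have "det_on S (\<lambda>i l. if l = j then A i k else A i l) = 0"
      by (rule det_on_equal_columns[OF S(1) j, of k]) (use insert.prems in auto)
    finally show ?case using insert by simp
  qed
  have "0 = det_on S (\<lambda>i l. if l = j then 0 else A i l)"
    by (rule det_on_zero_column[OF S(1) j, symmetric]) simp
  also have "\<dots> = det_on S A + det_on S (\<lambda>i l. if l = j then \<Sum>k\<in>S - {j}. A i k else A i l)"
    by (rule det_on_column_sum[OF S(1) j]) (use rows in \<open>auto simp flip: sum.remove[OF S(1) j]\<close>)
  finally show ?thesis using repl[of "S - {j}"] by simp
qed

lemma det_on_insert_unit_column:
  assumes S: "finite S" and j: "j \<notin> S"
    and col: "\<And>i. i \<in> insert j S \<Longrightarrow> A i j = (if i = j then 1 else 0)"
  shows "det_on (insert j S) A = det_on S A"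
proof -
  have "det_on S A = (\<Sum>p | p permutes S. of_int (sign p) * (\<Prod>i\<in>insert j S. A i (p i)))"
    unfolding det_on_def
  proof (rule sum.cong[OF refl])
    fix p assume "p \<in> {p. p permutes S}"
    then have "p j = j" using j by (auto simp: permutes_def)
    then show "of_int (sign p) * (\<Prod>i\<in>S. A i (p i)) = of_int (sign p) * (\<Prod>i\<in>insert j S. A i (p i))"
      using S j col[of j] by simp
  qed
  also have "\<dots> = det_on (insert j S) A"
    unfolding det_on_def
  proof (rule sum.mono_neutral_left)
    show "finite {p. p permutes insert j S}" using S by (simp add: finite_permutations)
    show "{p. p permutes S} \<subseteq> {p. p permutes insert j S}"
      by (auto intro: permutes_subset)
    show "\<forall>p\<in>{p. p permutes insert j S} - {p. p permutes S}.
        of_int (sign p) * (\<Prod>i\<in>insert j S. A i (p i)) = 0"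
    proof
      fix p assume p: "p \<in> {p. p permutes insert j S} - {p. p permutes S}"
      then have pp: "p permutes insert j S" by simp
      have "p j \<noteq> j"
      proof
        assume "p j = j"
        then have "p permutes S" by (intro permutes_superset[OF pp]) auto
        then show False using p by simp
      qed
      define k where "k = inv p j"
      have k: "k \<in> insert j S" "p k = j"
        using permutes_in_image[OF permutes_inv[OF pp], of j] permutes_inverses(1)[OF pp]
        by (simp_all add: k_def)
      have "A k (p k) = 0" using col[OF k(1)] k(2) \<open>p j \<noteq> j\<close> by auto
      then have "(\<Prod>i\<in>insert j S. A i (p i)) = 0" using S k(1) by (intro prod_zero) auto
      then show "of_int (sign p) * (\<Prod>i\<in>insert j S. A i (p i)) = 0" by simp
    qed
  qed
  finally show ?thesis by simp
qed

text \<open>This allows determinants over different supports to be compared over a common index set.\<close>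

lemma det_on_unit_columns:
  assumes "finite T" "S \<subseteq> T"
    and col: "\<And>i j. i \<in> T \<Longrightarrow> j \<in> T - S \<Longrightarrow> A i j = (if i = j then 1 else 0)"
  shows "det_on T A = det_on S A"
proof -
  have "finite U \<Longrightarrow> U \<subseteq> T - S \<Longrightarrow> det_on (U \<union> S) A = det_on S A" for U
  proof (induction U rule: finite_induct)
    case (insert j U)
    have "det_on (insert j (U \<union> S)) A = det_on (U \<union> S) A"
      by (rule det_on_insert_unit_column)
         (use insert assms(2) finite_subset[OF assms(2,1)] col in auto)
    then show ?case using insert by simp
  qed simp
  from this[of "T - S"] show ?thesis using assms(1,2) by (simp add: Un_absorb2)
qed

lemma det_on_scale_columns:
  assumes "finite S"
  shows "det_on S (\<lambda>i j. A i j * x j) = det_on S A * (\<Prod>j\<in>S. x j)"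
proof -
  have "(\<Prod>i\<in>S. x (p i)) = (\<Prod>j\<in>S. x j)" if "p permutes S" for p
    using prod.permute[OF that, of x] by (simp add: comp_def)
  then show ?thesis
    unfolding det_on_def sum_distrib_right
    by (intro sum.cong) (auto simp: prod.distrib mult_ac)
qed

section \<open>Weights of index families\<close>

lemma supp_NN:
  assumes "N \<in> NN"
  shows "supp N = {h. N h \<noteq> 0}"
proof -
  have "\<forall>h. h \<notin> HH \<longrightarrow> N h = 0" using assms by (simp add: NN_def)
  then show ?thesis unfolding supp_def by (metis (lifting) neq0_conv)
qed

lemma finite_supp: "N \<in> NN \<Longrightarrow> finite (supp N)"
  by (simp add: supp_NN) (simp add: NN_def)

lemma supp_subset_HH: "supp N \<subseteq> HH"
  by (auto simp: supp_def)

text \<open>The monomial attached to \<open>N\<close> has exponent \<open>wt N\<close>, to which each unit of \<open>N j\<close> contributes \<open>deg j\<close>.\<close>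

definition deg :: "'i \<times> nat \<Rightarrow> 'i multiset" where
  "deg j = replicate_mset (snd j) (fst j)"

definition wt :: "('i \<times> nat \<Rightarrow> nat) \<Rightarrow> 'i multiset" where
  "wt N = (\<Sum>j\<in>supp N. repeat_mset (N j) (deg j))"

lemma wt_eq:
  assumes "N \<in> NN" "finite S" "supp N \<subseteq> S"
  shows "wt N = (\<Sum>j\<in>S. repeat_mset (N j) (deg j))"
  unfolding wt_def
  by (rule sum.mono_neutral_left) (use assms supp_NN[OF assms(1)] in auto)

lemma size_deg [simp]: "size (deg j) = snd j"
  by (simp add: deg_def)

lemma deg_not_empty: "j \<in> HH \<Longrightarrow> deg j \<noteq> {#}"
  by (auto simp: HH_def deg_def)

lemma size_mset_sum: "size (sum f A :: 'a multiset) = (\<Sum>x\<in>A. size (f x))"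
  by (induction A rule: infinite_finite_induct) auto

lemma size_repeat_mset': "size (repeat_mset n M) = n * size M"
  by (induction n) auto

lemma ymon_eq_monom: "ymon N = monom (wt N)" if N: "N \<in> NN" for N :: "'i::finite \<times> nat \<Rightarrow> nat"
proof -
  have "(\<Sum>a\<in>UNIV. replicate_mset (\<Sum>m | (a, m) \<in> supp N. m * N (a, m)) a) = wt N"
  proof (rule multiset_eqI)
    fix b
    have "count (\<Sum>a\<in>UNIV. replicate_mset (\<Sum>m | (a, m) \<in> supp N. m * N (a, m)) a) b
        = (\<Sum>a\<in>UNIV. if a = b then \<Sum>m | (b, m) \<in> supp N. m * N (b, m) else 0)"
      unfolding count_sum by (rule sum.cong) auto
    also have "\<dots> = (\<Sum>m | (b, m) \<in> supp N. m * N (b, m))" by simp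
    also have "\<dots> = (\<Sum>j\<in>{j \<in> supp N. fst j = b}. snd j * N j)"
      by (rule sum.reindex_bij_witness[where i = snd and j = "\<lambda>m. (b, m)"]) auto
    also have "\<dots> = (\<Sum>j\<in>supp N. if fst j = b then snd j * N j else 0)"
      using finite_supp[OF N] by (rule sum.inter_filter)
    also have "\<dots> = count (wt N) b"
      unfolding wt_def count_sum by (rule sum.cong) (auto simp: deg_def)
    finally show "count (\<Sum>a\<in>UNIV. replicate_mset (\<Sum>m | (a, m) \<in> supp N. m * N (a, m)) a) b = count (wt N) b" .
  qed
  then show ?thesis
    unfolding ymon_def mfps_var_power monom_sum[symmetric] by simp
qed

lemma size_wt_ge:
  assumes "N \<in> NN" "j \<in> supp N"
  shows "N j \<le> size (wt N)" "snd j \<le> size (wt N)"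
proof -
  have "N j * snd j \<le> (\<Sum>j\<in>supp N. N j * snd j)"
    by (rule member_le_sum) (use assms finite_supp in auto)
  also have "\<dots> = size (wt N)"
    by (simp add: wt_def size_mset_sum size_repeat_mset')
  finally have le: "N j * snd j \<le> size (wt N)" .
  have pos: "1 \<le> N j" "1 \<le> snd j" using assms(2) by (auto simp: supp_def HH_def)
  show "N j \<le> size (wt N)" using le mult_le_mono2[OF pos(2), of "N j"] by linarith
  show "snd j \<le> size (wt N)" using le mult_le_mono1[OF pos(1), of "snd j"] by linarith
qed

lemma finite_size_wt: "finite {N :: 'i::finite \<times> nat \<Rightarrow> nat. N \<in> NN \<and> size (wt N) \<le> n}"
proof -
  have "finite {N :: 'i::finite \<times> nat \<Rightarrow> nat. \<forall>x. (x \<in> UNIV \<times> {..n} \<longrightarrow> N x \<in> {..n}) \<and> (x \<notin> UNIV \<times> {..n} \<longrightarrow> N x = 0)}"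
    by (rule finite_set_of_finite_funs) auto
  then show ?thesis
  proof (rule rev_finite_subset, intro subsetI CollectI allI)
    fix N :: "'i \<times> nat \<Rightarrow> nat" and x
    assume "N \<in> {N. N \<in> NN \<and> size (wt N) \<le> n}"
    then have N: "N \<in> NN" "size (wt N) \<le> n" by auto
    show "(x \<in> UNIV \<times> {..n} \<longrightarrow> N x \<in> {..n}) \<and> (x \<notin> UNIV \<times> {..n} \<longrightarrow> N x = 0)"
    proof (cases "N x = 0")
      case False
      then have "x \<in> supp N" using N(1) by (simp add: supp_NN)
      then have "N x \<le> n" "snd x \<le> n" using size_wt_ge[OF N(1), of x] N(2) by simp_all
      then show ?thesis using False by (cases x) auto
    qed simp
  qed
qed

section \<open>Families of power series with a Pascal recursion\<close>

text \<open>The two properties of the series \<open>K\<^sup>\<gamma>\<close> and \<open>R\<^sup>\<gamma>\<close> that determine them by their values at \<open>\<gamma> = 0\<close>: the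
  coefficients of degree less than \<open>n\<close> see only the entries \<open>\<gamma> (a, k)\<close> with \<open>k < n\<close>, and Pascal's rule
  holds at every index \<open>j\<close>.\<close>

definition series_family ::
    "('i \<times> nat \<Rightarrow> 'i \<times> nat \<Rightarrow> int) \<Rightarrow> (('i \<times> nat \<Rightarrow> int) \<Rightarrow> ('i::finite, complex) mfps) \<Rightarrow> bool" where
  "series_family G S \<longleftrightarrow>
     (\<forall>n \<gamma> \<gamma>'. (\<forall>j\<in>HH. snd j < n \<longrightarrow> \<gamma> j = \<gamma>' j) \<longrightarrow> agree n (S \<gamma>) (S \<gamma>')) \<and>
     (\<forall>\<gamma>. \<forall>j\<in>HH. S \<gamma> = S (\<gamma>(j := \<gamma> j - 1)) + monom (deg j) * S (\<lambda>i. \<gamma> i + G i j))"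

lemma series_family_diff:
  assumes S: "series_family G S" and T: "series_family G T"
  shows "series_family G (\<lambda>\<gamma>. S \<gamma> - T \<gamma>)"
  unfolding series_family_def
proof (intro conjI allI ballI impI)
  show "agree n (S \<gamma> - T \<gamma>) (S \<gamma>' - T \<gamma>')" if "\<forall>j\<in>HH. snd j < n \<longrightarrow> \<gamma> j = \<gamma>' j" for n \<gamma> \<gamma>'
    using S T that unfolding series_family_def by (intro agree_diff) blast+
  fix \<gamma> :: "'a \<times> nat \<Rightarrow> int" and j :: "'a \<times> nat" assume "j \<in> HH"
  then have "S \<gamma> = S (\<gamma>(j := \<gamma> j - 1)) + monom (deg j) * S (\<lambda>i. \<gamma> i + G i j)"
    "T \<gamma> = T (\<gamma>(j := \<gamma> j - 1)) + monom (deg j) * T (\<lambda>i. \<gamma> i + G i j)"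
    using S T unfolding series_family_def by blast+
  then show "S \<gamma> - T \<gamma> = S (\<gamma>(j := \<gamma> j - 1)) - T (\<gamma>(j := \<gamma> j - 1)) +
      monom (deg j) * (S (\<lambda>i. \<gamma> i + G i j) - T (\<lambda>i. \<gamma> i + G i j))"
    by (simp add: algebra_simps)
qed

lemma series_family_mult:
  assumes S: "series_family G S"
  shows "series_family G (\<lambda>\<gamma>. S \<gamma> * f)"
  unfolding series_family_def
proof (intro conjI allI ballI impI)
  show "agree n (S \<gamma> * f) (S \<gamma>' * f)" if "\<forall>j\<in>HH. snd j < n \<longrightarrow> \<gamma> j = \<gamma>' j" for n \<gamma> \<gamma>'
    using S that unfolding series_family_def by (intro agree_mult agree_refl) blast+
  fix \<gamma> :: "'a \<times> nat \<Rightarrow> int" and j :: "'a \<times> nat" assume "j \<in> HH"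
  then have "S \<gamma> = S (\<gamma>(j := \<gamma> j - 1)) + monom (deg j) * S (\<lambda>i. \<gamma> i + G i j)"
    using S unfolding series_family_def by blast
  then show "S \<gamma> * f = S (\<gamma>(j := \<gamma> j - 1)) * f + monom (deg j) * (S (\<lambda>i. \<gamma> i + G i j) * f)"
    by (simp add: algebra_simps)
qed

lemma series_family_translate:
  assumes S: "series_family G S"
  shows "series_family G (\<lambda>\<gamma>. S (\<lambda>i. \<gamma> i + \<delta> i))"
  unfolding series_family_def
proof (intro conjI allI ballI impI)
  show "agree n (S (\<lambda>i. \<gamma> i + \<delta> i)) (S (\<lambda>i. \<gamma>' i + \<delta> i))"
    if "\<forall>j\<in>HH. snd j < n \<longrightarrow> \<gamma> j = \<gamma>' j" for n \<gamma> \<gamma>'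
    using S that unfolding series_family_def by simp
  fix \<gamma> :: "'a \<times> nat \<Rightarrow> int" and j :: "'a \<times> nat" assume "j \<in> HH"
  then have "S (\<lambda>i. \<gamma> i + \<delta> i) = S ((\<lambda>i. \<gamma> i + \<delta> i)(j := \<gamma> j + \<delta> j - 1)) +
      monom (deg j) * S (\<lambda>i. \<gamma> i + \<delta> i + G i j)"
    using S unfolding series_family_def by blast
  moreover have "(\<lambda>i. \<gamma> i + \<delta> i)(j := \<gamma> j + \<delta> j - 1) = (\<lambda>i. (\<gamma>(j := \<gamma> j - 1)) i + \<delta> i)"
    by (auto simp: fun_eq_iff)
  moreover have "(\<lambda>i. \<gamma> i + \<delta> i + G i j) = (\<lambda>i. \<gamma> i + G i j + \<delta> i)"
    by (simp add: add_ac)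
  ultimately show "S (\<lambda>i. \<gamma> i + \<delta> i) = S (\<lambda>i. (\<gamma>(j := \<gamma> j - 1)) i + \<delta> i) +
      monom (deg j) * S (\<lambda>i. \<gamma> i + G i j + \<delta> i)"
    by simp
qed

text \<open>If all coefficients of smaller degree vanish for all parameters, the coefficient of \<open>e\<close> does not
  change when \<open>\<gamma> j\<close> is lowered by one. So it does not depend on \<open>\<gamma>\<close> at the finitely many places
  \<open>j\<close> that matter for it, and may be computed at \<open>\<gamma> = 0\<close>.\<close>

lemma series_family_eq_0:
  assumes S: "series_family G S" and S0: "S (\<lambda>_. 0) = 0"
  shows "S \<gamma> = 0"
proof -
  have "mcoeff (S \<gamma>) e = 0" for \<gamma> and e :: "'a multiset"
  proof (induction e arbitrary: \<gamma> rule: measure_induct_rule[where f = size])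
    case (less e)
    have step: "mcoeff (S \<gamma>) e = mcoeff (S (\<gamma>(j := \<gamma> j - 1))) e" if j: "j \<in> HH" for j \<gamma>
    proof -
      have "size (e - deg j) < size e" if "deg j \<subseteq># e"
        using that deg_not_empty[OF j]
        by (metis size_Diff_submset diff_less nonempty_has_size size_mset_mono less_le_trans)
      then have "mcoeff (monom (deg j) * S (\<lambda>i. \<gamma> i + G i j)) e = 0"
        using less.IH by (simp add: mcoeff_monom_mult)
      moreover have "S \<gamma> = S (\<gamma>(j := \<gamma> j - 1)) + monom (deg j) * S (\<lambda>i. \<gamma> i + G i j)"
        using S j unfolding series_family_def by blast
      ultimately show ?thesis by (metis mcoeff_simps(2) add.right_neutral)
    qed
    have any: "mcoeff (S (\<gamma>(j := x))) e = mcoeff (S \<gamma>) e" if j: "j \<in> HH" for j \<gamma> x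
    proof (induction x rule: int_induct[where k = "\<gamma> j"])
      case base
      show ?case by simp
    next
      case (step1 x)
      have "mcoeff (S (\<gamma>(j := x + 1))) e = mcoeff (S (\<gamma>(j := x))) e"
        using step[OF j, of "\<gamma>(j := x + 1)"] by simp
      with step1 show ?case by (simp add: fun_upd_def)
    next
      case (step2 x)
      have "mcoeff (S (\<gamma>(j := x))) e = mcoeff (S (\<gamma>(j := x - 1))) e"
        using step[OF j, of "\<gamma>(j := x)"] by simp
      with step2 show ?case by (simp add: fun_upd_def)
    qed
    have clear: "mcoeff (S (\<lambda>i. if i \<in> A then 0 else \<gamma> i)) e = mcoeff (S \<gamma>) e"
      if "finite A" "A \<subseteq> HH" for A
      using that
    proof (induction A)
      case (insert j A)
      have "(\<lambda>i. if i \<in> insert j A then 0 else \<gamma> i) = (\<lambda>i. if i \<in> A then 0 else \<gamma> i)(j := 0)"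
        by (auto simp: fun_eq_iff)
      then show ?case using any[of j _ 0] insert by simp
    qed simp
    define A :: "('a \<times> nat) set" where "A = UNIV \<times> {1..size e}"
    have A: "finite A" "A \<subseteq> HH" by (auto simp: A_def HH_def)
    have "agree (Suc (size e)) (S (\<lambda>i. if i \<in> A then 0 else \<gamma> i)) (S (\<lambda>_. 0))"
    proof -
      have local: "agree n (S \<gamma>) (S \<gamma>')" if "\<forall>j\<in>HH. snd j < n \<longrightarrow> \<gamma> j = \<gamma>' j" for n \<gamma> \<gamma>'
        using S that unfolding series_family_def by blast
      show ?thesis by (rule local) (auto simp: A_def HH_def)
    qed
    then show ?case using clear[OF A] S0 by (simp add: agree_def)
  qed
  then show ?thesis by (intro mfps_eqI) simp
qed

section \<open>Series built from coefficients\<close>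

text \<open>The same properties for the coefficients of the series. The recursion is only required where
  \<open>N j > 0\<close>; if \<open>N j = 0\<close>, then the coefficient does not involve \<open>\<gamma> j\<close>.\<close>

definition coeff_family ::
    "('i \<times> nat \<Rightarrow> 'i \<times> nat \<Rightarrow> int) \<Rightarrow> (('i \<times> nat \<Rightarrow> int) \<Rightarrow> ('i \<times> nat \<Rightarrow> nat) \<Rightarrow> complex) \<Rightarrow> bool" where
  "coeff_family G c \<longleftrightarrow>
     (\<forall>N\<in>NN. \<forall>\<gamma> \<gamma>'. (\<forall>j\<in>supp N. \<gamma> j = \<gamma>' j) \<longrightarrow> c \<gamma> N = c \<gamma>' N) \<and>
     (\<forall>N\<in>NN. \<forall>\<gamma>. \<forall>j\<in>supp N.
        c \<gamma> N = c (\<gamma>(j := \<gamma> j - 1)) N + c (\<lambda>i. \<gamma> i + G i j) (N(j := N j - 1)))"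

definition ser :: "(('i \<times> nat \<Rightarrow> int) \<Rightarrow> ('i \<times> nat \<Rightarrow> nat) \<Rightarrow> complex) \<Rightarrow> ('i \<times> nat \<Rightarrow> int) \<Rightarrow> ('i, complex) mfps" where
  "ser c \<gamma> = Abs_mfps (\<lambda>e. \<Sum>N | N \<in> NN \<and> wt N = e. c \<gamma> N)"

lemma mcoeff_ser: "mcoeff (ser c \<gamma>) e = (\<Sum>N | N \<in> NN \<and> wt N = e. c \<gamma> N)"
  by (simp add: ser_def Abs_mfps_inverse)

lemma finite_wt_eq: "finite {N :: 'i::finite \<times> nat \<Rightarrow> nat. N \<in> NN \<and> wt N = e}"
  by (rule finite_subset[OF _ finite_size_wt[of "size e"]]) auto

lemma NN_update: "N \<in> NN \<Longrightarrow> j \<in> HH \<Longrightarrow> N(j := n) \<in> NN"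
proof -
  assume N: "N \<in> NN" and j: "j \<in> HH"
  have "{h. (N(j := n)) h \<noteq> 0} \<subseteq> insert j {h. N h \<noteq> 0}" by auto
  moreover have "finite (insert j {h. N h \<noteq> 0})" using N by (simp add: NN_def)
  ultimately have "finite {h. (N(j := n)) h \<noteq> 0}" by (rule finite_subset)
  then show "N(j := n) \<in> NN" using N j by (simp add: NN_def)
qed

lemma wt_increment:
  assumes "N \<in> NN" "j \<in> HH"
  shows "wt (N(j := Suc (N j))) = wt N + deg j"
proof -
  define S where "S = insert j (supp N)"
  have S: "finite S" "supp N \<subseteq> S" "supp (N(j := Suc (N j))) \<subseteq> S" "j \<in> S"
    using assms finite_supp by (auto simp: S_def supp_def)
  have "wt (N(j := Suc (N j))) = repeat_mset (Suc (N j)) (deg j) + (\<Sum>i\<in>S - {j}. repeat_mset (N i) (deg i))"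
    unfolding wt_eq[OF NN_update[OF assms] S(1,3)] sum.remove[OF S(1,4)]
    by (intro arg_cong2[where f = "(+)"] sum.cong) auto
  moreover have "wt N = repeat_mset (N j) (deg j) + (\<Sum>i\<in>S - {j}. repeat_mset (N i) (deg i))"
    unfolding wt_eq[OF assms(1) S(1,2)] sum.remove[OF S(1,4)] ..
  ultimately show ?thesis by simp
qed

text \<open>In the coefficient of \<open>e\<close>, the substitution \<open>N \<mapsto> N(j := N j - 1)\<close> identifies the second terms of the
  recursion with the families \<open>N\<close> of weight \<open>e - deg j\<close>.\<close>

lemma series_family_ser:
  fixes G :: "'i::finite \<times> nat \<Rightarrow> 'i \<times> nat \<Rightarrow> int"
  assumes c: "coeff_family G c"
  shows "series_family G (ser c)"
proof -
  have local: "c \<gamma> N = c \<gamma>' N" if "N \<in> NN" "\<forall>j\<in>supp N. \<gamma> j = \<gamma>' j" for N \<gamma> \<gamma>'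
    using c that unfolding coeff_family_def by blast
  have step: "c \<gamma> N = c (\<gamma>(j := \<gamma> j - 1)) N + c (\<lambda>i. \<gamma> i + G i j) (N(j := N j - 1))"
    if "N \<in> NN" "j \<in> supp N" for N \<gamma> j
    using c that unfolding coeff_family_def by blast
  show ?thesis
    unfolding series_family_def
  proof (intro conjI allI impI ballI)
    fix n and \<gamma> \<gamma>' :: "'i \<times> nat \<Rightarrow> int" assume eq: "\<forall>j\<in>HH. snd j < n \<longrightarrow> \<gamma> j = \<gamma>' j"
    show "agree n (ser c \<gamma>) (ser c \<gamma>')"
      unfolding agree_def mcoeff_ser
    proof (intro allI impI sum.cong refl)
      fix e :: "'i multiset" and N assume e: "size e < n" and N: "N \<in> {N. N \<in> NN \<and> wt N = e}"
      show "c \<gamma> N = c \<gamma>' N"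
      proof (rule local)
        show "\<forall>j\<in>supp N. \<gamma> j = \<gamma>' j"
        proof
          fix j assume j: "j \<in> supp N"
          have "snd j \<le> size e" using size_wt_ge(2)[OF _ j] N by auto
          moreover have "j \<in> HH" using j supp_subset_HH by blast
          ultimately show "\<gamma> j = \<gamma>' j" using eq e by simp
        qed
      qed (use N in simp)
    qed
  next
    fix \<gamma> :: "'i \<times> nat \<Rightarrow> int" and j :: "'i \<times> nat" assume j: "j \<in> HH"
    let ?\<gamma>1 = "\<gamma>(j := \<gamma> j - 1)" and ?\<gamma>2 = "\<lambda>i. \<gamma> i + G i j"
    show "ser c \<gamma> = ser c ?\<gamma>1 + monom (deg j) * ser c ?\<gamma>2"
    proof (rule mfps_eqI)
      fix e :: "'i multiset"
      let ?E = "{N. N \<in> NN \<and> wt N = e}"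
      have "mcoeff (ser c \<gamma>) e = (\<Sum>N\<in>?E. c ?\<gamma>1 N + (if N j \<noteq> 0 then c ?\<gamma>2 (N(j := N j - 1)) else 0))"
        unfolding mcoeff_ser
      proof (rule sum.cong[OF refl])
        fix N assume "N \<in> ?E"
        then have N: "N \<in> NN" by simp
        show "c \<gamma> N = c ?\<gamma>1 N + (if N j \<noteq> 0 then c ?\<gamma>2 (N(j := N j - 1)) else 0)"
        proof (cases "N j = 0")
          case True
          then have "c \<gamma> N = c ?\<gamma>1 N" by (intro local[OF N]) (auto simp: supp_def)
          then show ?thesis using True by simp
        next
          case False
          then show ?thesis using step[OF N, of j \<gamma>] by (simp add: supp_NN N)
        qed
      qed
      also have "\<dots> = mcoeff (ser c ?\<gamma>1) e + (\<Sum>N\<in>{N\<in>?E. N j \<noteq> 0}. c ?\<gamma>2 (N(j := N j - 1)))"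
        by (simp only: sum.distrib mcoeff_ser sum.inter_filter[OF finite_wt_eq])
      also have "(\<Sum>N\<in>{N\<in>?E. N j \<noteq> 0}. c ?\<gamma>2 (N(j := N j - 1))) = (\<Sum>N | N \<in> NN \<and> wt N + deg j = e. c ?\<gamma>2 N)"
      proof (rule sum.reindex_bij_witness[where i = "\<lambda>N. N(j := Suc (N j))" and j = "\<lambda>N. N(j := N j - 1)"])
        fix N assume N: "N \<in> {N\<in>?E. N j \<noteq> 0}"
        then show "(N(j := N j - 1))(j := Suc ((N(j := N j - 1)) j)) = N" by auto
        have "N(j := N j - 1) \<in> NN" using N NN_update j by blast
        from wt_increment[OF this j] show "N(j := N j - 1) \<in> {N. N \<in> NN \<and> wt N + deg j = e}"
          using N NN_update[OF _ j] by auto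
      next
        fix N assume "N \<in> {N. N \<in> NN \<and> wt N + deg j = e}"
        then show "N(j := Suc (N j)) \<in> {N\<in>?E. N j \<noteq> 0}"
          using wt_increment[OF _ j] NN_update[OF _ j] by auto
      qed auto
      also have "\<dots> = mcoeff (monom (deg j) * ser c ?\<gamma>2) e"
      proof (cases "deg j \<subseteq># e")
        case True
        then have "{N. N \<in> NN \<and> wt N + deg j = e} = {N. N \<in> NN \<and> wt N = e - deg j}" by auto
        then show ?thesis using True by (simp add: mcoeff_monom_mult mcoeff_ser)
      next
        case False
        then have "{N. N \<in> NN \<and> wt N + deg j = e} = {}" by auto
        then show ?thesis using False by (simp only: mcoeff_monom_mult) simp
      qed
      finally show "mcoeff (ser c \<gamma>) e = mcoeff (ser c ?\<gamma>1 + monom (deg j) * ser c ?\<gamma>2) e"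
        by (simp only: mcoeff_simps)
    qed
  qed
qed

text \<open>Each coefficient of the sum receives only finitely many contributions, so the partial sums over finite
  sets of families become stationary in every degree.\<close>

lemma infsum_eq_ser:
  fixes c :: "('i::finite \<times> nat \<Rightarrow> int) \<Rightarrow> ('i \<times> nat \<Rightarrow> nat) \<Rightarrow> complex"
  shows "(\<Sum>\<^sub>\<infinity>N\<in>NN. mfps_const (c \<gamma> N) * ymon N) = ser c \<gamma>"
proof (rule infsumI)
  show "((\<lambda>N. mfps_const (c \<gamma> N) * ymon N) has_sum ser c \<gamma>) NN"
    unfolding has_sum_def tendsto_mfps_iff
  proof
    fix n
    let ?F = "{N :: 'i \<times> nat \<Rightarrow> nat. N \<in> NN \<and> size (wt N) \<le> n}"
    show "\<forall>\<^sub>F F in finite_subsets_at_top NN. agree n (\<Sum>N\<in>F. mfps_const (c \<gamma> N) * ymon N) (ser c \<gamma>)"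
      unfolding eventually_finite_subsets_at_top
    proof (intro exI[of _ ?F] conjI allI impI)
      show "finite ?F" by (rule finite_size_wt)
      show "?F \<subseteq> NN" by auto
      fix F assume F: "finite F \<and> ?F \<subseteq> F \<and> F \<subseteq> NN"
      show "agree n (\<Sum>N\<in>F. mfps_const (c \<gamma> N) * ymon N) (ser c \<gamma>)"
        unfolding agree_def
      proof (intro allI impI)
        fix e :: "'i multiset" assume e: "size e < n"
        have "mcoeff (\<Sum>N\<in>F. mfps_const (c \<gamma> N) * ymon N) e = (\<Sum>N\<in>F. if e = wt N then c \<gamma> N else 0)"
          unfolding mcoeff_sum
          by (rule sum.cong[OF refl]) (use F in \<open>auto simp: subset_iff ymon_eq_monom mcoeff_const_mult_monom\<close>)
        also have "\<dots> = (\<Sum>N\<in>{N\<in>F. e = wt N}. c \<gamma> N)"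
          using F by (intro sum.inter_filter[symmetric]) simp
        also have "{N\<in>F. e = wt N} = {N. N \<in> NN \<and> wt N = e}"
          using F e by auto
        finally show "mcoeff (\<Sum>N\<in>F. mfps_const (c \<gamma> N) * ymon N) e = mcoeff (ser c \<gamma>) e"
          by (simp add: mcoeff_ser)
      qed
    qed
  qed
qed

section \<open>The coefficients K and R satisfy the recursion\<close>

text \<open>The number \<open>P\<^sub>i\<close> for an arbitrary \<open>\<gamma>\<close>. The set \<open>S\<close> of summation is explicit because the recursion
  compares \<open>N\<close> with \<open>N(j := N j - 1)\<close>, whose supports may differ; both are treated over the larger one.\<close>

definition vac :: "('h \<Rightarrow> 'h \<Rightarrow> int) \<Rightarrow> ('h \<Rightarrow> int) \<Rightarrow> ('h \<Rightarrow> nat) \<Rightarrow> 'h set \<Rightarrow> 'h \<Rightarrow> int" where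
  "vac G \<gamma> N S i = \<gamma> i + (\<Sum>j\<in>S. G i j * int (N j))"

lemma vac_superset:
  assumes "N \<in> NN" "finite S" "supp N \<subseteq> S"
  shows "vac G \<gamma> N S i = vac G \<gamma> N (supp N) i"
  unfolding vac_def
  by (intro arg_cong2[where f = "(+)"] sum.mono_neutral_right) (use assms in \<open>auto simp: supp_NN\<close>)

lemma vac_lower: "vac G (\<gamma>(j := \<gamma> j - 1)) N S i = (if i = j then vac G \<gamma> N S i - 1 else vac G \<gamma> N S i)"
  by (simp add: vac_def)

text \<open>Adding the column \<open>G \<cdot> j\<close> to \<open>\<gamma>\<close> makes up for the unit removed from \<open>N j\<close>.\<close>

lemma vac_decrement:
  assumes "finite S" "j \<in> S" "N j > 0"
  shows "vac G (\<lambda>i. \<gamma> i + G i j) (N(j := N j - 1)) S i = vac G \<gamma> N S i"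
proof -
  have "(\<Sum>k\<in>S. G i k * int ((N(j := N j - 1)) k)) = G i j * (int (N j) - 1) + (\<Sum>k\<in>S - {j}. G i k * int (N k))"
    unfolding sum.remove[OF assms(1,2)] using assms(3)
    by (intro arg_cong2[where f = "(+)"] sum.cong) (auto simp: of_nat_diff)
  then show ?thesis
    unfolding vac_def sum.remove[OF assms(1,2), of "\<lambda>k. G i k * int (N k)"] by (simp add: algebra_simps)
qed

lemma gbinomial_Pascal:
  fixes a :: "'a::field_char_0"
  shows "(a gchoose Suc k) = ((a - 1) gchoose k) + ((a - 1) gchoose Suc k)"
  using gbinomial_Suc_Suc[of "a - 1" k] by simp

text \<open>The binomials \<open>(x + n choose n)\<close>, \<open>(x + n - 1 choose n)\<close> and \<open>(x + n - 1 choose n - 1)\<close>, with value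
  \<open>0\<close> of the last one for \<open>n = 0\<close>. All three obey the same Pascal rule in \<open>x\<close> and \<open>n\<close>.\<close>

definition bin_K :: "int \<Rightarrow> nat \<Rightarrow> complex" where
  "bin_K x n = (of_int x + of_nat n) gchoose n"

definition bin_P :: "int \<Rightarrow> nat \<Rightarrow> complex" where
  "bin_P x n = (of_int x + of_nat n - 1) gchoose n"

definition bin_Q :: "int \<Rightarrow> nat \<Rightarrow> complex" where
  "bin_Q x n = (if n = 0 then 0 else (of_int x + of_nat n - 1) gchoose (n - 1))"

lemma bin_K_step: "n > 0 \<Longrightarrow> bin_K x n = bin_K (x - 1) n + bin_K x (n - 1)"
  using gbinomial_Pascal[of "of_int x + of_nat n" "n - 1"]
  by (simp add: bin_K_def of_nat_diff algebra_simps)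

lemma bin_P_step: "n > 0 \<Longrightarrow> bin_P x n = bin_P (x - 1) n + bin_P x (n - 1)"
  using gbinomial_Pascal[of "of_int x + of_nat n - 1" "n - 1"]
  by (simp add: bin_P_def of_nat_diff algebra_simps)

lemma bin_Q_step: "n > 0 \<Longrightarrow> bin_Q x n = bin_Q (x - 1) n + bin_Q x (n - 1)"
proof -
  assume "n > 0"
  then obtain k where n: "n = Suc k" using not0_implies_Suc by blast
  show ?thesis
  proof (cases k)
    case 0
    then show ?thesis by (simp add: n bin_Q_def)
  next
    case (Suc l)
    then show ?thesis
      using gbinomial_Pascal[of "of_int x + of_nat n - 1" l] by (simp add: n bin_Q_def algebra_simps)
  qed
qed

lemma bin_0 [simp]: "bin_K x 0 = 1" "bin_P x 0 = 1" "bin_Q x 0 = 0"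
  by (simp_all add: bin_K_def bin_P_def bin_Q_def)

definition coeff_K :: "('h \<Rightarrow> 'h \<Rightarrow> int) \<Rightarrow> ('h \<Rightarrow> int) \<Rightarrow> ('h \<Rightarrow> nat) \<Rightarrow> 'h set \<Rightarrow> complex" where
  "coeff_K G \<gamma> N S = (\<Prod>h\<in>S. bin_K (vac G \<gamma> N S h) (N h))"

text \<open>The matrix \<open>F\<close> with the factors \<open>1 / N\<^sub>j (P\<^sub>j + N\<^sub>j - 1 choose N\<^sub>j - 1)\<close> multiplied into its columns: on
  the diagonal they turn \<open>P\<^sub>j\<close> into \<open>bin_P\<close>, and in the other term they cancel \<open>N\<^sub>j\<close>. In this form the
  column \<open>j\<close> depends only on \<open>P\<^sub>j\<close> and \<open>N\<^sub>j\<close>, and it is a unit vector if \<open>N\<^sub>j = 0\<close>.\<close>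

definition mat_R :: "('h \<Rightarrow> 'h \<Rightarrow> int) \<Rightarrow> ('h \<Rightarrow> int) \<Rightarrow> ('h \<Rightarrow> nat) \<Rightarrow> 'h set \<Rightarrow> 'h \<Rightarrow> 'h \<Rightarrow> complex" where
  "mat_R G \<gamma> N S i j = (if i = j then bin_P (vac G \<gamma> N S j) (N j) else 0) - of_int (G i j) * bin_Q (vac G \<gamma> N S j) (N j)"

definition coeff_R :: "('h \<Rightarrow> 'h \<Rightarrow> int) \<Rightarrow> ('h \<Rightarrow> int) \<Rightarrow> ('h \<Rightarrow> nat) \<Rightarrow> 'h set \<Rightarrow> complex" where
  "coeff_R G \<gamma> N S = det_on S (mat_R G \<gamma> N S)"

lemma vac_cong: "(\<And>j. j \<in> S \<Longrightarrow> \<gamma> j = \<gamma>' j) \<Longrightarrow> i \<in> S \<Longrightarrow> vac G \<gamma> N S i = vac G \<gamma>' N S i"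
  by (simp add: vac_def)

lemma supp_decrement_subset: "supp (N(j := N j - 1)) \<subseteq> supp N"
  by (auto simp: supp_def split: if_splits)

lemma coeff_K_superset:
  assumes "N \<in> NN" "finite S" "supp N \<subseteq> S"
  shows "coeff_K G \<gamma> N S = coeff_K G \<gamma> N (supp N)"
  unfolding coeff_K_def vac_superset[OF assms]
  by (rule prod.mono_neutral_right) (use assms in \<open>auto simp: supp_NN\<close>)

text \<open>Only the factor at \<open>j\<close> differs in the three products, and there the recursion is Pascal's rule.\<close>

lemma coeff_family_K: "coeff_family G (\<lambda>\<gamma> N. coeff_K G \<gamma> N (supp N))"
  unfolding coeff_family_def
proof (intro conjI ballI allI impI)
  fix N :: "'a \<times> nat \<Rightarrow> nat" and \<gamma> \<gamma>' :: "'a \<times> nat \<Rightarrow> int"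
  assume "\<forall>j\<in>supp N. \<gamma> j = \<gamma>' j"
  then show "coeff_K G \<gamma> N (supp N) = coeff_K G \<gamma>' N (supp N)"
    unfolding coeff_K_def by (intro prod.cong refl arg_cong2[where f = bin_K] vac_cong) auto
next
  fix N :: "'a \<times> nat \<Rightarrow> nat" and \<gamma> :: "'a \<times> nat \<Rightarrow> int" and j
  assume N: "N \<in> NN" and j: "j \<in> supp N"
  define S where "S = supp N"
  have S: "finite S" "j \<in> S" using N j by (auto simp: S_def finite_supp)
  have pos: "N j > 0" using j by (simp add: supp_def)
  let ?\<gamma>1 = "\<gamma>(j := \<gamma> j - 1)" and ?\<gamma>2 = "\<lambda>i. \<gamma> i + G i j" and ?N = "N(j := N j - 1)"
  let ?R = "\<Prod>h\<in>S - {j}. bin_K (vac G \<gamma> N S h) (N h)"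
  have N': "?N \<in> NN" using NN_update[OF N] j supp_subset_HH by blast
  have "coeff_K G ?\<gamma>1 N S = bin_K (vac G \<gamma> N S j - 1) (N j) * ?R"
    unfolding coeff_K_def prod.remove[OF S] vac_lower
    by (intro arg_cong2[where f = "(*)"] prod.cong) auto
  moreover have "coeff_K G ?\<gamma>2 ?N S = bin_K (vac G \<gamma> N S j) (N j - 1) * ?R"
    unfolding coeff_K_def prod.remove[OF S] vac_decrement[of S j N, OF S pos]
    by (intro arg_cong2[where f = "(*)"] prod.cong) auto
  moreover have "coeff_K G \<gamma> N S = bin_K (vac G \<gamma> N S j) (N j) * ?R"
    unfolding coeff_K_def prod.remove[OF S] ..
  moreover have "coeff_K G ?\<gamma>2 ?N S = coeff_K G ?\<gamma>2 ?N (supp ?N)"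
    by (rule coeff_K_superset[OF N' S(1)]) (use supp_decrement_subset S_def in blast)
  ultimately show "coeff_K G \<gamma> N (supp N) = coeff_K G ?\<gamma>1 N (supp N) + coeff_K G ?\<gamma>2 ?N (supp ?N)"
    unfolding S_def[symmetric] bin_K_step[OF pos, of "vac G \<gamma> N S j"] by (simp only: distrib_right)
qed

lemma coeff_R_superset:
  assumes "N \<in> NN" "finite S" "supp N \<subseteq> S"
  shows "coeff_R G \<gamma> N S = coeff_R G \<gamma> N (supp N)"
proof -
  have "det_on S (mat_R G \<gamma> N S) = det_on (supp N) (mat_R G \<gamma> N S)"
    by (rule det_on_unit_columns[OF assms(2,3)]) (use assms(1) in \<open>auto simp: mat_R_def supp_NN\<close>)
  also have "\<dots> = det_on (supp N) (mat_R G \<gamma> N (supp N))"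
    by (rule det_on_cong) (simp add: mat_R_def vac_superset[OF assms])
  finally show ?thesis by (simp add: coeff_R_def)
qed

text \<open>The three determinants, taken over the support of \<open>N\<close>, differ only in the column \<open>j\<close>. By Pascal's rule
  the column of the first is the sum of the columns of the other two.\<close>

lemma coeff_family_R: "coeff_family G (\<lambda>\<gamma> N. coeff_R G \<gamma> N (supp N))"
  unfolding coeff_family_def
proof (intro conjI ballI allI impI)
  fix N :: "'a \<times> nat \<Rightarrow> nat" and \<gamma> \<gamma>' :: "'a \<times> nat \<Rightarrow> int"
  assume "\<forall>j\<in>supp N. \<gamma> j = \<gamma>' j"
  then have "vac G \<gamma> N (supp N) i = vac G \<gamma>' N (supp N) i" if "i \<in> supp N" for i
    using that by (intro vac_cong) auto
  then show "coeff_R G \<gamma> N (supp N) = coeff_R G \<gamma>' N (supp N)"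
    unfolding coeff_R_def by (intro det_on_cong) (simp add: mat_R_def)
next
  fix N :: "'a \<times> nat \<Rightarrow> nat" and \<gamma> :: "'a \<times> nat \<Rightarrow> int" and j
  assume N: "N \<in> NN" and j: "j \<in> supp N"
  define S where "S = supp N"
  have S: "finite S" "j \<in> S" using N j by (auto simp: S_def finite_supp)
  have pos: "N j > 0" using j by (simp add: supp_def)
  let ?\<gamma>1 = "\<gamma>(j := \<gamma> j - 1)" and ?\<gamma>2 = "\<lambda>i. \<gamma> i + G i j" and ?N = "N(j := N j - 1)"
  have N': "?N \<in> NN" using NN_update[OF N] j supp_subset_HH by blast
  have vac2: "vac G ?\<gamma>2 ?N S i = vac G \<gamma> N S i" for i
    by (rule vac_decrement[of S j N, OF S pos])
  have "coeff_R G \<gamma> N S = coeff_R G ?\<gamma>1 N S + coeff_R G ?\<gamma>2 ?N S"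
    unfolding coeff_R_def
  proof (rule det_on_column_sum[OF S])
    show "mat_R G \<gamma> N S i j = mat_R G ?\<gamma>1 N S i j + mat_R G ?\<gamma>2 ?N S i j" for i
      using bin_P_step[OF pos, of "vac G \<gamma> N S j"] bin_Q_step[OF pos, of "vac G \<gamma> N S j"]
      unfolding mat_R_def vac2 vac_lower by (simp add: algebra_simps)
    show "mat_R G ?\<gamma>1 N S i k = mat_R G \<gamma> N S i k" "mat_R G ?\<gamma>2 ?N S i k = mat_R G \<gamma> N S i k"
      if "k \<noteq> j" for i k
      using that unfolding mat_R_def vac2 vac_lower by simp_all
  qed
  moreover have "coeff_R G ?\<gamma>2 ?N S = coeff_R G ?\<gamma>2 ?N (supp ?N)"
    by (rule coeff_R_superset[OF N' S(1)]) (use supp_decrement_subset S_def in blast)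
  ultimately show "coeff_R G \<gamma> N (supp N) = coeff_R G ?\<gamma>1 N (supp N) + coeff_R G ?\<gamma>2 ?N (supp ?N)"
    by (simp only: S_def)
qed

lemma bin_Q_absorb:
  assumes "n > 0"
  shows "bin_P x n = of_int x / of_nat n * bin_Q x n"
proof -
  obtain k where n: "n = Suc k" using assms not0_implies_Suc by blast
  have "((of_int x + of_nat k :: complex) gchoose Suc k) * of_nat (Suc k) = (of_int x + of_nat k - of_nat k) * ((of_int x + of_nat k) gchoose k)"
    using gbinomial_mult_1[of "of_int x + of_nat k :: complex" k] by (simp add: algebra_simps)
  then have "((of_int x + of_nat k :: complex) gchoose Suc k) =
      of_int x * ((of_int x + of_nat k) gchoose k) / of_nat (Suc k)"
    by (simp add: eq_divide_eq del: of_nat_Suc)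
  then show ?thesis by (simp add: n bin_P_def bin_Q_def)
qed

text \<open>The matrix is \<open>F\<close> with rescaled columns, and the \<open>i\<close>-th row sum of \<open>F\<close> is
  \<open>P\<^sub>i - \<Sum>\<^sub>j G i j N\<^sub>j = \<gamma>\<^sub>i = 0\<close>.\<close>

lemma coeff_R_0:
  assumes N: "N \<in> NN"
  shows "coeff_R G (\<lambda>_. 0) N (supp N) = (if N = (\<lambda>_. 0) then 1 else 0)"
proof (cases "N = (\<lambda>_. 0)")
  case True
  then have "supp N = {}" by (simp add: supp_def)
  then show ?thesis using True by (simp add: coeff_R_def det_on_def)
next
  case False
  define S where "S = supp N"
  have S: "finite S" "S \<noteq> {}"
    using finite_supp[OF N] supp_NN[OF N] False by (auto simp: S_def fun_eq_iff)
  have pos: "N j > 0" if "j \<in> S" for j using that by (simp add: S_def supp_def)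
  define P where "P = vac G (\<lambda>_. 0) N S"
  define A :: "'a \<times> nat \<Rightarrow> 'a \<times> nat \<Rightarrow> complex" where
    "A i j = (if i = j then of_int (P j) else 0) - of_int (G i j) * of_nat (N j)" for i j
  have "coeff_R G (\<lambda>_. 0) N S = det_on S (\<lambda>i j. A i j * (bin_Q (P j) (N j) / of_nat (N j)))"
    unfolding coeff_R_def
    by (rule det_on_cong) (auto simp: mat_R_def A_def P_def[symmetric] pos bin_Q_absorb field_simps)
  also have "\<dots> = det_on S A * (\<Prod>j\<in>S. bin_Q (P j) (N j) / of_nat (N j))"
    by (rule det_on_scale_columns[OF S(1)])
  also have "det_on S A = 0"
  proof (rule det_on_zero_row_sums[OF S])
    fix i assume "i \<in> S"
    then have "(\<Sum>j\<in>S. A i j) = of_int (P i) - (\<Sum>j\<in>S. of_int (G i j) * of_nat (N j))"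
      using S(1) by (simp add: A_def sum_subtractf)
    then show "(\<Sum>j\<in>S. A i j) = 0" by (simp add: P_def vac_def)
  qed
  finally show ?thesis using False by (simp add: S_def)
qed

section \<open>The multiplicative family \<open>K\<^sup>\<gamma> / K\<^sup>0\<close>\<close>

definition K_series :: "('i::finite \<times> nat \<Rightarrow> 'i \<times> nat \<Rightarrow> int) \<Rightarrow> ('i \<times> nat \<Rightarrow> int) \<Rightarrow> ('i, complex) mfps" where
  "K_series G = ser (\<lambda>\<gamma> N. coeff_K G \<gamma> N (supp N))"

definition R_series :: "('i::finite \<times> nat \<Rightarrow> 'i \<times> nat \<Rightarrow> int) \<Rightarrow> ('i \<times> nat \<Rightarrow> int) \<Rightarrow> ('i, complex) mfps" where
  "R_series G = ser (\<lambda>\<gamma> N. coeff_R G \<gamma> N (supp N))"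

definition K_ratio :: "('i::finite \<times> nat \<Rightarrow> 'i \<times> nat \<Rightarrow> int) \<Rightarrow> ('i \<times> nat \<Rightarrow> int) \<Rightarrow> ('i, complex) mfps" where
  "K_ratio G \<gamma> = K_series G \<gamma> * inverse (K_series G (\<lambda>_. 0))"

lemma series_family_K: "series_family G (K_series G)"
  unfolding K_series_def by (rule series_family_ser[OF coeff_family_K])

lemma series_family_R: "series_family G (R_series G)"
  unfolding R_series_def by (rule series_family_ser[OF coeff_family_R])

lemma zero_in_NN: "(\<lambda>_. 0) \<in> NN"
  by (simp add: NN_def)

lemma wt_zero: "wt (\<lambda>_. 0) = {#}"
  by (simp add: wt_def supp_def)

lemma wt_empty_iff: "N \<in> NN \<and> wt N = {#} \<longleftrightarrow> N = (\<lambda>_. 0)"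
proof
  assume N: "N \<in> NN \<and> wt N = {#}"
  have "j \<notin> supp N" for j
  proof
    assume j: "j \<in> supp N"
    then have "N j = 0" using size_wt_ge(1)[of N j] N by simp
    then show False using j by (simp add: supp_def)
  qed
  then show "N = (\<lambda>_. 0)" using supp_NN[of N] N by (auto simp: fun_eq_iff)
qed (auto simp: zero_in_NN wt_zero)

lemma K_series_unit: "K_series G \<gamma> dvd 1"
proof (rule unit_if_const_term_one)
  show "mcoeff (K_series G \<gamma>) {#} = 1"
    by (simp add: K_series_def mcoeff_ser wt_empty_iff coeff_K_def supp_def)
qed

text \<open>For fixed \<open>\<delta>\<close> both sides satisfy the recursion in \<open>\<gamma>\<close>, and they agree at \<open>\<gamma> = 0\<close>.\<close>

lemma K_series_mult:
  "K_series G \<gamma> * K_series G \<delta> = K_series G (\<lambda>i. \<gamma> i + \<delta> i) * K_series G (\<lambda>_. 0)"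
proof -
  have "K_series G \<gamma> * K_series G \<delta> - K_series G (\<lambda>i. \<gamma> i + \<delta> i) * K_series G (\<lambda>_. 0) = 0"
  proof (rule series_family_eq_0[where G = G and S = "\<lambda>\<gamma>. K_series G \<gamma> * K_series G \<delta>
        - K_series G (\<lambda>i. \<gamma> i + \<delta> i) * K_series G (\<lambda>_. 0)"])
    show "series_family G (\<lambda>\<gamma>. K_series G \<gamma> * K_series G \<delta>
        - K_series G (\<lambda>i. \<gamma> i + \<delta> i) * K_series G (\<lambda>_. 0))"
      by (intro series_family_diff series_family_mult series_family_K
          series_family_translate[where S = "K_series G"])
  qed (simp add: mult.commute)
  then show ?thesis by simp
qed

lemma K_ratio_0 [simp]: "K_ratio G (\<lambda>_. 0) = 1"
  by (simp add: K_ratio_def mult_inverse_mfps K_series_unit)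

lemma K_ratio_add: "K_ratio G (\<lambda>i. \<gamma> i + \<delta> i) = K_ratio G \<gamma> * K_ratio G \<delta>"
proof -
  let ?K = "K_series G (\<lambda>_. 0)"
  have 1: "?K * inverse ?K = 1" by (rule mult_inverse_mfps[OF K_series_unit])
  have "K_ratio G \<gamma> * K_ratio G \<delta> = (K_series G \<gamma> * K_series G \<delta>) * inverse ?K * inverse ?K"
    by (simp add: K_ratio_def mult_ac)
  also have "\<dots> = K_ratio G (\<lambda>i. \<gamma> i + \<delta> i) * (?K * inverse ?K)"
    unfolding K_series_mult[of G \<gamma> \<delta>] K_ratio_def by (simp only: mult_ac)
  finally show ?thesis by (simp add: 1)
qed

lemma K_ratio_unit: "K_ratio G \<gamma> dvd 1"
proof -
  have "K_ratio G \<gamma> * K_ratio G (\<lambda>i. - \<gamma> i) = 1" using K_ratio_add[of G \<gamma> "\<lambda>i. - \<gamma> i"] by simp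
  then show ?thesis by (metis dvd_triv_left)
qed

lemma K_ratio_uminus: "K_ratio G (\<lambda>i. - \<gamma> i) = inverse (K_ratio G \<gamma>)"
  using K_ratio_add[of G \<gamma> "\<lambda>i. - \<gamma> i"] by (intro inverse_mfps_eqI[symmetric]) simp

lemma K_ratio_power: "K_ratio G \<gamma> ^ n = K_ratio G (\<lambda>i. int n * \<gamma> i)"
proof (induction n)
  case (Suc n)
  then show ?case using K_ratio_add[of G \<gamma> "\<lambda>i. int n * \<gamma> i"] by (simp add: algebra_simps)
qed simp

lemma K_ratio_power_int: "K_ratio G \<gamma> powi n = K_ratio G (\<lambda>i. n * \<gamma> i)"
  by (simp add: power_int_def K_ratio_power flip: K_ratio_uminus)

lemma K_ratio_prod: "finite A \<Longrightarrow> (\<Prod>x\<in>A. K_ratio G (f x)) = K_ratio G (\<lambda>i. \<Sum>x\<in>A. f x i)"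
proof (induction A rule: finite_induct)
  case (insert x A)
  then show ?case using K_ratio_add[of G "f x" "\<lambda>i. \<Sum>x\<in>A. f x i"] by simp
qed simp

lemma K_ratio_agree:
  assumes "\<And>j. j \<in> HH \<Longrightarrow> snd j < n \<Longrightarrow> \<gamma> j = \<gamma>' j"
  shows "agree n (K_ratio G \<gamma>) (K_ratio G \<gamma>')"
  unfolding K_ratio_def
  using series_family_K[of G] assms unfolding series_family_def by (intro agree_mult agree_refl) blast

lemma K_ratio_cong: "(\<And>j. j \<in> HH \<Longrightarrow> \<gamma> j = \<gamma>' j) \<Longrightarrow> K_ratio G \<gamma> = K_ratio G \<gamma>'"
  by (rule agree_eqI) (simp add: K_ratio_agree)

text \<open>The recursion for \<open>K\<close> at \<open>\<gamma> = 0\<close>, divided by \<open>K\<^sup>0\<close>. In multiplicative notation it is the Q-system.\<close>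

lemma K_ratio_step:
  assumes "j \<in> HH"
  shows "1 = K_ratio G (\<lambda>i. if i = j then - 1 else 0) + monom (deg j) * K_ratio G (\<lambda>i. G i j)"
proof -
  have "K_series G (\<lambda>_. 0) = K_series G ((\<lambda>_. 0)(j := - 1)) + monom (deg j) * K_series G (\<lambda>i. G i j)"
  proof -
    have "\<forall>\<gamma>. K_series G \<gamma> = K_series G (\<gamma>(j := \<gamma> j - 1)) + monom (deg j) * K_series G (\<lambda>i. \<gamma> i + G i j)"
      using series_family_K[of G] assms unfolding series_family_def by blast
    from this[THEN spec, of "\<lambda>_. 0"] show ?thesis by simp
  qed
  from arg_cong[OF this, of "\<lambda>f. f * inverse (K_series G (\<lambda>_. 0))"]
  have "K_ratio G (\<lambda>_. 0) = K_ratio G ((\<lambda>_. 0)(j := - 1)) + monom (deg j) * K_ratio G (\<lambda>i. G i j)"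
    unfolding K_ratio_def by (simp only: distrib_right mult.assoc)
  then show ?thesis by (simp add: fun_upd_def)
qed

lemma R_series_0: "R_series G (\<lambda>_. 0) = 1"
proof (rule mfps_eqI)
  fix e :: "'a multiset"
  have "mcoeff (R_series G (\<lambda>_. 0)) e = (\<Sum>N | N \<in> NN \<and> wt N = e. if N = (\<lambda>_. 0) then 1 else 0)"
    unfolding R_series_def mcoeff_ser by (rule sum.cong[OF refl], rule coeff_R_0) simp
  also have "\<dots> = (if (\<lambda>_. 0) \<in> {N. N \<in> NN \<and> wt N = e} then 1 else 0)"
    by (rule sum.delta[OF finite_wt_eq])
  also have "\<dots> = mcoeff 1 e" by (auto simp: zero_in_NN wt_zero)
  finally show "mcoeff (R_series G (\<lambda>_. 0)) e = mcoeff 1 e" .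
qed

text \<open>The series \<open>R\<^sup>\<gamma> K\<^sup>0\<close> and \<open>K\<^sup>\<gamma>\<close> satisfy the same recursion and agree at \<open>\<gamma> = 0\<close>, as \<open>R\<^sup>0 = 1\<close>.\<close>

lemma R_series_eq_K_ratio: "R_series G \<gamma> = K_ratio G \<gamma>"
proof -
  have "R_series G \<gamma> * K_series G (\<lambda>_. 0) - K_series G \<gamma> = 0"
    by (rule series_family_eq_0[where G = G and S = "\<lambda>\<gamma>. R_series G \<gamma> * K_series G (\<lambda>_. 0) - K_series G \<gamma>"])
       (intro series_family_diff series_family_mult series_family_K series_family_R, simp add: R_series_0)
  then have "K_ratio G \<gamma> = R_series G \<gamma> * (K_series G (\<lambda>_. 0) * inverse (K_series G (\<lambda>_. 0)))"
    unfolding K_ratio_def by (simp flip: mult.assoc)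
  then show ?thesis by (simp add: mult_inverse_mfps K_series_unit)
qed

section \<open>The Q-system\<close>

text \<open>The family \<open>\<gamma>\<close> that belongs to \<open>\<nu> = \<delta>\<^sub>m\<^sup>(\<^sup>a\<^sup>)\<close>.\<close>

definition row_min :: "'i \<Rightarrow> nat \<Rightarrow> 'i \<times> nat \<Rightarrow> int" where
  "row_min a m = (\<lambda>(b, k). if b = a then int (min m k) else 0)"

lemma gam_unit_family: "m \<ge> 1 \<Longrightarrow> int (gam (unit_family a m) h) = row_min a m h"
proof -
  assume m: "m \<ge> 1"
  obtain b k where h: "h = (b, k)" by (cases h)
  have "{k. (b, k) \<in> supp (unit_family a m)} = (if b = a then {m} else {})"
    using m by (auto simp: supp_def unit_family_def HH_def)
  then show ?thesis by (simp add: h gam_def row_min_def unit_family_def min.commute)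
qed

text \<open>The functions \<open>k \<mapsto> min k l\<close> form the Green kernel of the second difference on the positive integers.
  The boundary term vanishes once \<open>f\<close> is constant from \<open>M\<close> on.\<close>

lemma summation_by_parts_min:
  fixes f :: "nat \<Rightarrow> int"
  assumes "f 0 = 0"
  shows "(\<Sum>k=1..M. (2 * f k - f (k + 1) - f (k - 1)) * int (min k l))
       = f (min M l) - int (min M l) * (f (M + 1) - f M)"
proof (induction M)
  case 0
  then show ?case by (simp add: assms)
next
  case (Suc M)
  show ?case
  proof (cases "l \<le> M")
    case True
    then show ?thesis using Suc by (simp add: algebra_simps)
  next
    case False
    then have "min (Suc M) l = Suc M" "min M l = M" by auto
    then show ?thesis using Suc by (simp add: algebra_simps)
  qed
qed

context integral_gram
begin

lemma tnum_eq: "tnum g a = t a"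
  unfolding tnum_def
proof (rule the_equality)
  have "g a a \<noteq> 0" using t_g[of a] by auto
  then show "of_nat (t a) = 2 / g a a" using t_g[of a] by (simp add: field_simps)
  then show "s = t a" if "of_nat s = 2 / g a a" for s
    using that by (metis of_nat_eq_iff)
qed

text \<open>The floor and the real part only convert an integer of complex type, see \<open>of_int_G\<close>.\<close>

definition G :: "'i \<times> nat \<Rightarrow> 'i \<times> nat \<Rightarrow> int" where
  "G = (\<lambda>(a, m) (b, k). - \<lfloor>Re (g a b * of_nat (min (t b * m) (t a * k)))\<rfloor>)"

lemma of_int_G: "of_int (G (a, m) (b, k)) = - (g a b * of_nat (min (t b * m) (t a * k)))"
proof -
  have "g a b * of_nat (t a) \<in> \<int>" using integral[of b a] by (simp add: g_sym)
  then have "g a b * of_nat (min (t b * m) (t a * k)) \<in> \<int>"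
    using integral[of a b] by (cases "t b * m \<le> t a * k") (auto simp: min_def mult.assoc[symmetric])
  then obtain z where z: "g a b * of_nat (min (t b * m) (t a * k)) = of_int z" by (auto elim: Ints_cases)
  then have "G (a, m) (b, k) = - z" by (simp only: G_def prod.case z) simp
  then show ?thesis by (simp only: z of_int_minus)
qed

lemma G_sym: "G (a, m) (b, k) = G (b, k) (a, m)"
proof -
  have "of_int (G (a, m) (b, k)) = (of_int (G (b, k) (a, m)) :: complex)"
    by (simp only: of_int_G g_sym[of a b] min.commute)
  then show ?thesis by simp
qed

lemma PP_eq: "PP g \<nu> N h = of_int (vac G (\<lambda>i. int (gam \<nu> i)) N (supp N) h)"
proof -
  obtain a m where h: "h = (a, m)" by (cases h)
  have "(\<Sum>(b, k)\<in>supp N. g a b * of_nat (min (tnum g b * m) (tnum g a * k)) * of_nat (N (b, k)))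
      = (\<Sum>j\<in>supp N. - (of_int (G (a, m) j) * of_nat (N j)))"
    by (rule sum.cong) (auto simp: of_int_G tnum_eq)
  then show ?thesis by (simp add: h PP_def vac_def sum_negf)
qed

lemma Kser_eq: "Kser g \<nu> = K_series G (\<lambda>i. int (gam \<nu> i))"
proof -
  have "KK g \<nu> = (\<lambda>N. coeff_K G (\<lambda>i. int (gam \<nu> i)) N (supp N))"
    by (simp add: fun_eq_iff KK_def coeff_K_def bin_K_def PP_eq)
  then show ?thesis
    unfolding Kser_def K_series_def by (simp only: infsum_eq_ser[symmetric])
qed

lemma RR_eq:
  assumes "N \<in> NN"
  shows "RR g \<nu> N = coeff_R G (\<lambda>i. int (gam \<nu> i)) N (supp N)"
proof (cases "N = (\<lambda>_. 0)")
  case True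
  then show ?thesis by (simp add: RR_def coeff_R_def det_on_def supp_def)
next
  case False
  define P where "P = vac G (\<lambda>i. int (gam \<nu> i)) N (supp N)"
  define x where "x h = 1 / of_nat (N h) * ((PP g \<nu> N h + of_nat (N h) - 1) gchoose (N h - 1))" for h
  have x: "x h = bin_Q (P h) (N h) / of_nat (N h)" if "h \<in> supp N" for h
    using that by (simp add: x_def P_def PP_eq bin_Q_def supp_def)
  have FF: "FF g \<nu> N i j = (if i = j then of_int (P j) else 0) - of_int (G i j) * of_nat (N j)" for i j
    by (cases i, cases j) (simp add: FF_def P_def PP_eq of_int_G tnum_eq)
  have "RR g \<nu> N = det_on (supp N) (\<lambda>i j. FF g \<nu> N i j * x j)"
    unfolding det_on_scale_columns[OF finite_supp[OF assms]] using False by (simp add: RR_def x_def)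
  also have "\<dots> = det_on (supp N) (mat_R G (\<lambda>i. int (gam \<nu> i)) N (supp N))"
  proof (rule det_on_cong)
    fix i j assume "i \<in> supp N" and j: "j \<in> supp N"
    have "N j > 0" using j by (simp add: supp_def)
    then show "FF g \<nu> N i j * x j = mat_R G (\<lambda>i. int (gam \<nu> i)) N (supp N) i j"
      by (simp add: FF x[OF j] mat_R_def bin_Q_absorb P_def[symmetric] field_simps)
  qed
  finally show ?thesis by (simp add: coeff_R_def)
qed

lemma Rser_eq: "Rser g \<nu> = R_series G (\<lambda>i. int (gam \<nu> i))"
proof -
  have "Rser g \<nu> = (\<Sum>\<^sub>\<infinity>N\<in>NN. mfps_const (coeff_R G (\<lambda>i. int (gam \<nu> i)) N (supp N)) * ymon N)"
    unfolding Rser_def by (rule infsum_cong) (simp add: RR_eq)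
  then show ?thesis unfolding R_series_def by (simp only: infsum_eq_ser[symmetric])
qed

lemma BB_eq:
  "BB g (a, m) (b, k) = 2 * int (min (t b * m) (t a * k)) - int (min (t b * m) (t a * (k + 1)))
     - int (min (t b * m) (t a * (k - 1)))"
  by (simp add: BB_def tnum_eq)

lemma Qexp_eq:
  "Qexp g (a, m) (b, k) = - (2 * G (a, m) (b, k) - G (a, m) (b, k + 1) - G (a, m) (b, k - 1))"
  unfolding Qexp_def
proof (rule the_equality)
  show eq: "of_int (- (2 * G (a, m) (b, k) - G (a, m) (b, k + 1) - G (a, m) (b, k - 1))) =
      g (fst (a, m)) (fst (b, k)) * of_int (BB g (a, m) (b, k))"
    by (simp add: of_int_G BB_eq algebra_simps del: of_nat_min)
  show "z = - (2 * G (a, m) (b, k) - G (a, m) (b, k + 1) - G (a, m) (b, k - 1))"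
    if "of_int z = g (fst (a, m)) (fst (b, k)) * of_int (BB g (a, m) (b, k))" for z
    using that eq by (metis of_int_eq_iff)
qed

lemma min_saturated: "k \<ge> t b * m \<Longrightarrow> min (t b * m) (t a * k) = t b * m"
  using mult_le_mono1[OF t_pos[of a], of k] by (intro min_absorb1) linarith

text \<open>Beyond \<open>m\<close> times the sum of all \<open>t\<^sub>b\<close>, the minima in a row of \<open>B\<close> all equal \<open>t\<^sub>b m\<close>. The bound is
  uniform in \<open>b\<close>, so the rows have finite support.\<close>

lemma BB_eq_0:
  assumes "k > m * (\<Sum>b\<in>UNIV. t b)"
  shows "BB g (a, m) (b, k) = 0"
proof -
  have "t b \<le> (\<Sum>b\<in>UNIV. t b)" by (rule member_le_sum) auto
  then have "t b * m \<le> m * (\<Sum>b\<in>UNIV. t b)" by (simp add: mult.commute)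
  then have "t b * m \<le> k" "t b * m \<le> k + 1" "t b * m \<le> k - 1" using assms by linarith+
  then show ?thesis unfolding BB_eq by (simp only: min_saturated)
qed

lemma finite_BB: "finite {l \<in> HH. BB g (a, m) l \<noteq> 0}"
proof (rule finite_subset)
  show "{l \<in> HH. BB g (a, m) l \<noteq> 0} \<subseteq> UNIV \<times> {1..m * (\<Sum>b\<in>UNIV. t b)}"
    using BB_eq_0 by (auto simp: HH_def not_less[symmetric])
qed simp

text \<open>The exponents of the Q-system are second differences of a row of \<open>G\<close>, which is constant from
  \<open>M\<close> on; summation by parts recovers the row.\<close>

lemma Qexp_row_sum:
  assumes "h \<in> HH"
  shows "(\<Sum>(b, k)\<in>{l \<in> HH. BB g (a, m) l \<noteq> 0}. - Qexp g (a, m) (b, k) * row_min b k h) = G h (a, m)"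
proof -
  obtain c l where h: "h = (c, l)" by (cases h)
  define M where "M = m * (\<Sum>b\<in>UNIV. t b)"
  define f where "f k = G (a, m) (c, k)" for k
  have "(\<Sum>(b, k)\<in>{l \<in> HH. BB g (a, m) l \<noteq> 0}. - Qexp g (a, m) (b, k) * row_min b k h)
      = (\<Sum>(b, k)\<in>UNIV \<times> {1..M}. - Qexp g (a, m) (b, k) * row_min b k h)"
  proof (rule sum.mono_neutral_left)
    show "{l \<in> HH. BB g (a, m) l \<noteq> 0} \<subseteq> UNIV \<times> {1..M}"
      using BB_eq_0 by (auto simp: HH_def M_def not_less[symmetric])
    have "Qexp g (a, m) l = 0" if "BB g (a, m) l = 0" for l
      using that by (simp add: Qexp_def)
    then show "\<forall>i\<in>UNIV \<times> {1..M} - {l \<in> HH. BB g (a, m) l \<noteq> 0}.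
        (case i of (b, k) \<Rightarrow> - Qexp g (a, m) (b, k) * row_min b k h) = 0"
      by (auto simp: HH_def)
  qed simp
  also have "\<dots> = (\<Sum>b\<in>UNIV. \<Sum>k=1..M. - Qexp g (a, m) (b, k) * row_min b k h)"
    by (rule sum.cartesian_product[symmetric])
  also have "\<dots> = (\<Sum>b\<in>UNIV. if b = c then \<Sum>k=1..M. - Qexp g (a, m) (c, k) * int (min k l) else 0)"
    by (rule sum.cong) (auto simp: row_min_def h)
  also have "\<dots> = (\<Sum>k=1..M. (2 * f k - f (k + 1) - f (k - 1)) * int (min k l))"
    by (simp add: Qexp_eq f_def)
  also have "\<dots> = f (min M l) - int (min M l) * (f (M + 1) - f M)"
  proof (rule summation_by_parts_min)
    have "of_int (f 0) = (0 :: complex)" by (simp add: f_def of_int_G)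
    then show "f 0 = 0" by simp
  qed
  also have "\<dots> = f l"
  proof -
    have "t c \<le> (\<Sum>b\<in>UNIV. t b)" by (rule member_le_sum) auto
    then have "t c * m \<le> M" by (simp add: M_def mult.commute)
    then have const: "f k = f M" if "k \<ge> M" for k
      using that by (simp add: f_def G_def min_saturated del: of_nat_min)
    show ?thesis
    proof (cases "l \<le> M")
      case True
      then show ?thesis using const[of "M + 1"] by simp
    next
      case False
      then show ?thesis using const[of "M + 1"] const[of l] by simp
    qed
  qed
  finally show ?thesis by (simp add: f_def h G_sym)
qed

definition Q_sol :: "'i \<Rightarrow> nat \<Rightarrow> ('i, complex) mfps" where
  "Q_sol a m = K_ratio G (row_min a m)"

lemma Q_sol_0: "Q_sol a 0 = 1"
proof -
  have "row_min a 0 = (\<lambda>_. 0)" by (auto simp: row_min_def fun_eq_iff)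
  then show ?thesis by (simp add: Q_sol_def)
qed

lemma Q_sol_product:
  "(\<Prod>(b, k)\<in>{l \<in> HH. BB g (a, m) l \<noteq> 0}. Q_sol b k powi (- Qexp g (a, m) (b, k)))
   = K_ratio G (\<lambda>h. G h (a, m))"
proof -
  let ?L = "{l \<in> HH. BB g (a, m) l \<noteq> 0}"
  have "(\<Prod>(b, k)\<in>?L. Q_sol b k powi (- Qexp g (a, m) (b, k)))
      = (\<Prod>l\<in>?L. K_ratio G (\<lambda>h. case l of (b, k) \<Rightarrow> - Qexp g (a, m) (b, k) * row_min b k h))"
    by (rule prod.cong) (auto simp: Q_sol_def K_ratio_power_int)
  also have "\<dots> = K_ratio G (\<lambda>h. \<Sum>l\<in>?L. case l of (b, k) \<Rightarrow> - Qexp g (a, m) (b, k) * row_min b k h)"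
    by (rule K_ratio_prod[OF finite_BB])
  also have "\<dots> = K_ratio G (\<lambda>h. G h (a, m))"
    by (rule K_ratio_cong) (rule Qexp_row_sum)
  finally show ?thesis .
qed

text \<open>The second difference of \<open>min m k\<close> in \<open>m\<close> is \<open>-1\<close> for \<open>k = m\<close> and \<open>0\<close> otherwise, so the factor of
  \<open>K_ratio_step\<close> at the negative unit family is \<open>Q\<^sub>m\<^sub>+\<^sub>1 Q\<^sub>m\<^sub>-\<^sub>1 / Q\<^sub>m\<^sup>2\<close>.\<close>

lemma Q_sol_system: "Q_system g Q_sol"
  unfolding Q_system_def
proof (intro conjI allI impI)
  fix a :: 'i and m :: nat assume m: "m \<ge> 1"
  have j: "(a, m) \<in> HH" using m by (simp add: HH_def)
  let ?e = "K_ratio G (\<lambda>i. if i = (a, m) then - 1 else 0)"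
  have second_difference: "Q_sol a m ^ 2 * ?e = Q_sol a (m + 1) * Q_sol a (m - 1)"
  proof -
    have "Q_sol a m ^ 2 * ?e = K_ratio G (\<lambda>i. int 2 * row_min a m i + (if i = (a, m) then - 1 else 0))"
      unfolding Q_sol_def K_ratio_power K_ratio_add[symmetric] ..
    also have "\<dots> = K_ratio G (\<lambda>i. row_min a (m + 1) i + row_min a (m - 1) i)"
    proof (rule K_ratio_cong)
      fix i :: "'i \<times> nat" assume "i \<in> HH"
      obtain b k where i: "i = (b, k)" by (cases i)
      consider "k < m" | "k = m" | "k > m" by linarith
      then show "int 2 * row_min a m i + (if i = (a, m) then - 1 else 0) = row_min a (m + 1) i + row_min a (m - 1) i"
        using m by cases (auto simp: i row_min_def min_def)
    qed
    also have "\<dots> = Q_sol a (m + 1) * Q_sol a (m - 1)"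
      unfolding Q_sol_def K_ratio_add ..
    finally show ?thesis .
  qed
  have "Q_sol a m ^ 2 = Q_sol a m ^ 2 * (?e + monom (deg (a, m)) * K_ratio G (\<lambda>h. G h (a, m)))"
    by (simp flip: K_ratio_step[OF j])
  also have "\<dots> = Q_sol a m ^ 2 * ?e + monom (deg (a, m)) * Q_sol a m ^ 2 * K_ratio G (\<lambda>h. G h (a, m))"
    by (simp only: distrib_left mult_ac)
  also have "monom (deg (a, m)) = mfps_var a ^ m" by (simp add: mfps_var_power deg_def)
  finally show "Q_sol a m ^ 2 = Q_sol a (m + 1) * Q_sol a (m - 1) + mfps_var a ^ m * Q_sol a m ^ 2 *
      (\<Prod>(b, k)\<in>{l \<in> HH. BB g (a, m) l \<noteq> 0}. Q_sol b k powi (- Qexp g (a, m) (b, k)))"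
    unfolding Q_sol_product second_difference .
qed (rule Q_sol_0)

lemma Q_sol_convergent: "convergent (Q_sol a)"
proof -
  have "Q_sol a \<longlonglongrightarrow> K_ratio G (\<lambda>(b, k). if b = a then int k else 0)"
    unfolding tendsto_mfps_iff
  proof
    fix n
    show "\<forall>\<^sub>F m in sequentially. agree n (Q_sol a m) (K_ratio G (\<lambda>(b, k). if b = a then int k else 0))"
      using eventually_ge_at_top[of n]
    proof (rule eventually_mono)
      fix m assume "m \<ge> n"
      then show "agree n (Q_sol a m) (K_ratio G (\<lambda>(b, k). if b = a then int k else 0))"
        unfolding Q_sol_def by (intro K_ratio_agree) (auto simp: row_min_def)
    qed
  qed
  then show ?thesis by (rule convergentI)
qed

lemma canonical_Q_sol: "canonical_solution g Q_sol"
  unfolding canonical_solution_def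
  using Q_sol_system Q_sol_convergent K_ratio_unit by (auto simp: Q_sol_def)

end

section \<open>Uniqueness of the canonical solution\<close>

context integral_gram
begin

lemma canonical_solution_unit:
  assumes "canonical_solution g Q"
  shows "Q a m dvd 1"
  using assms by (cases "m = 0") (auto simp: canonical_solution_def Q_system_def)

lemma canonical_solution_ratio_tendsto_1:
  assumes Q: "canonical_solution g Q"
  obtains M where "\<And>m. m \<ge> M \<Longrightarrow> agree n (Q a (Suc m) * inverse (Q a m)) 1"
proof -
  obtain L where "Q a \<longlonglongrightarrow> L" using Q unfolding canonical_solution_def convergent_def by blast
  then have "\<forall>\<^sub>F m in sequentially. agree n (Q a m) L" by (simp add: tendsto_mfps_iff)
  then obtain M where M: "\<And>m. m \<ge> M \<Longrightarrow> agree n (Q a m) L" by (auto simp: eventually_sequentially)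
  show ?thesis
  proof (rule that[of M])
    fix m assume "m \<ge> M"
    then have "agree n (Q a (Suc m)) (Q a m)"
      using agree_trans[OF M[of "Suc m"] agree_sym[OF M[of m]]] by simp
    then have "agree n (Q a (Suc m) * inverse (Q a m)) (Q a m * inverse (Q a m))"
      by (rule agree_mult) simp
    then show "agree n (Q a (Suc m) * inverse (Q a m)) 1"
      by (simp add: mult_inverse_mfps canonical_solution_unit[OF Q])
  qed
qed

lemma canonical_solution_ratio_step:
  assumes Q: "canonical_solution g Q" and m: "m \<ge> 1"
    and X: "X = 1 - mfps_var a ^ m *
      (\<Prod>(b, k)\<in>{l \<in> HH. BB g (a, m) l \<noteq> 0}. Q b k powi (- Qexp g (a, m) (b, k)))"
  shows "Q a (m + 1) * inverse (Q a m) = Q a m * inverse (Q a (m - 1)) * X"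
proof -
  let ?P = "\<Prod>(b, k)\<in>{l \<in> HH. BB g (a, m) l \<noteq> 0}. Q b k powi (- Qexp g (a, m) (b, k))"
  let ?u = "inverse (Q a m)" and ?v = "inverse (Q a (m - 1))"
  have u: "Q a m * ?u = 1" and v: "Q a (m - 1) * ?v = 1"
    by (simp_all add: mult_inverse_mfps canonical_solution_unit[OF Q])
  have "Q a m ^ 2 = Q a (m + 1) * Q a (m - 1) + mfps_var a ^ m * Q a m ^ 2 * ?P"
    using Q m by (auto simp: canonical_solution_def Q_system_def)
  then have eq: "Q a m ^ 2 * X = Q a (m + 1) * Q a (m - 1)"
    by (simp add: X algebra_simps)
  have "Q a m * ?v * X = Q a m * ?v * X * (Q a m * ?u)" by (simp add: u)
  also have "\<dots> = (Q a m ^ 2 * X) * ?u * ?v" by (simp only: power2_eq_square mult_ac)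
  also have "\<dots> = Q a (m + 1) * ?u * (Q a (m - 1) * ?v)" unfolding eq by (simp only: mult_ac)
  finally show ?thesis by (simp only: v mult_1_right)
qed

text \<open>Agreement of two solutions up to some degree improves by one degree when passed through the
  last term of the Q-system, because of the factor \<open>y\<^sub>a ^ m\<close>. This controls the ratio of consecutive
  quotients \<open>Q\<^sub>m\<^sub>+\<^sub>1 / Q\<^sub>m\<close>; the quotients themselves are then compared downwards from large \<open>m\<close>, where they
  are close to \<open>1\<close> by convergence.\<close>

lemma canonical_solution_agree:
  assumes Q: "canonical_solution g Q" and Q': "canonical_solution g Q'"
  shows "agree n (Q a m) (Q' a m)"
proof (induction n arbitrary: a m)
  case 0
  show ?case by (simp add: agree_def)
next
  case (Suc n)
  define X where "X Q m = 1 - mfps_var a ^ m *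
      (\<Prod>(b, k)\<in>{l \<in> HH. BB g (a, m) l \<noteq> 0}. Q b k powi (- Qexp g (a, m) (b, k)))"
    for Q :: "'i \<Rightarrow> nat \<Rightarrow> ('i, complex) mfps" and m
  define r where "r Q m = Q a (Suc m) * inverse (Q a m)"
    for Q :: "'i \<Rightarrow> nat \<Rightarrow> ('i, complex) mfps" and m
  have var0: "mcoeff (mfps_var a ^ Suc m :: ('i, complex) mfps) {#} = 0" for m
    by (simp add: mfps_var.rep_eq)
  have X_agree: "agree (Suc n) (X Q (Suc m)) (X Q' (Suc m))" for m
    unfolding X_def
  proof (intro agree_diff agree_refl agree_Suc_mult[OF _ var0] agree_prod)
    fix l :: "'i \<times> nat"
    show "agree n (case l of (b, k) \<Rightarrow> Q b k powi (- Qexp g (a, Suc m) (b, k)))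
        (case l of (b, k) \<Rightarrow> Q' b k powi (- Qexp g (a, Suc m) (b, k)))"
      by (cases l) (auto intro!: agree_power_int Suc canonical_solution_unit[OF Q] canonical_solution_unit[OF Q'])
  qed
  have X_unit: "X P (Suc m) dvd 1" for P m
    by (rule unit_if_const_term_one) (simp only: X_def mcoeff_simps mcoeff_mult_const_term var0, simp)
  have r_step: "r P m = r P (Suc m) * inverse (X P (Suc m))" if "canonical_solution g P" for P m
  proof -
    have "r P (Suc m) = r P m * X P (Suc m)"
      using canonical_solution_ratio_step[OF that _ X_def, of "Suc m"] by (simp add: r_def)
    then show ?thesis by (simp add: mult.assoc mult_inverse_mfps X_unit)
  qed
  have r_agree: "agree (Suc n) (r Q m) (r Q' m)" for m
  proof -
    obtain M where M: "\<And>m. m \<ge> M \<Longrightarrow> agree (Suc n) (r Q m) 1"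
      using canonical_solution_ratio_tendsto_1[OF Q, of "Suc n" a] unfolding r_def by blast
    obtain M' where M': "\<And>m. m \<ge> M' \<Longrightarrow> agree (Suc n) (r Q' m) 1"
      using canonical_solution_ratio_tendsto_1[OF Q', of "Suc n" a] unfolding r_def by blast
    define K where "K = max m (max M M')"
    have "m \<le> K" by (simp add: K_def)
    then show ?thesis
    proof (induction rule: inc_induct)
      case base
      have "K \<ge> M" "K \<ge> M'" by (auto simp: K_def)
      then show ?case using agree_trans[OF M agree_sym[OF M']] by simp
    next
      case (step i)
      show ?case
        unfolding r_step[OF Q, of i] r_step[OF Q', of i]
        by (intro agree_mult agree_inverse step.IH X_agree X_unit)
    qed
  qed
  show ?case
  proof (induction m)
    case 0
    show ?case using Q Q' by (simp add: canonical_solution_def Q_system_def)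
  next
    case (Suc m)
    have from_ratio: "P a (Suc m) = r P m * P a m" if "canonical_solution g P" for P
    proof -
      have "r P m * P a m = P a (Suc m) * (P a m * inverse (P a m))" by (simp only: r_def mult_ac)
      then show ?thesis by (simp add: mult_inverse_mfps canonical_solution_unit[OF that])
    qed
    show ?case
      unfolding from_ratio[OF Q] from_ratio[OF Q'] by (rule agree_mult[OF r_agree Suc])
  qed
qed

lemma canonical_solution_iff: "canonical_solution g Q \<longleftrightarrow> Q = Q_sol"
proof
  assume "canonical_solution g Q"
  then have "Q a m = Q_sol a m" for a m
    using canonical_solution_agree canonical_Q_sol by (blast intro: agree_eqI)
  then show "Q = Q_sol" by (simp add: fun_eq_iff)
qed (simp add: canonical_Q_sol)

lemma gam_zero: "gam (\<lambda>_. 0) h = 0"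
  by (cases h) (simp add: gam_def supp_def)

lemma Q_sol_eq:
  assumes "m \<ge> 1"
  shows "Q_sol a m = Rser g (unit_family a m)"
    and "Q_sol a m = Kser g (unit_family a m) / Kser g (\<lambda>_. 0)"
  by (simp_all add: Q_sol_def Rser_eq Kser_eq R_series_eq_K_ratio K_ratio_def divide_mfps_def
      gam_unit_family[OF assms] gam_zero)

end

theorem theorem5p3:
  fixes scale :: "complex \<Rightarrow> 'g::ab_group_add \<Rightarrow> 'g"
    and br :: "'g \<Rightarrow> 'g \<Rightarrow> 'g"
    and h :: "'g set"
    and \<kappa> :: "'g \<Rightarrow> 'g \<Rightarrow> complex"
    and \<alpha> :: "'i::finite \<Rightarrow> 'g \<Rightarrow> complex"
    and g :: "'i \<Rightarrow> 'i \<Rightarrow> complex"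
  assumes "simple_lie_algebra scale br"
    and "lie_algebra.cartan_subalgebra scale br h"
    and "lie_algebra.normalized_form scale br h \<kappa>"
    and "lie_algebra.simple_roots scale br h \<alpha>"
    and "\<And>a b. g a b = lie_algebra.dual_form h \<kappa> (\<alpha> a) (\<alpha> b)"
  shows "(\<exists>!Q. canonical_solution g Q) \<and>
         (\<forall>Q. canonical_solution g Q \<longrightarrow> (\<forall>a. \<forall>m\<ge>1.
            Q a m = Rser g (unit_family a m) \<and>
            Q a m = Kser g (unit_family a m) / Kser g (\<lambda>_. 0)))"
proof -
  obtain t where "integral_gram g t"
    using integral_gram_simple_roots[OF assms] by blast
  then interpret integral_gram g t .
  show ?thesis
    unfolding canonical_solution_iff by (simp add: Q_sol_eq[symmetric])
qed

end
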